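(* Let $n\ge 2$ and $0<\alpha<1$. Let $\theta_0:\mathbb{R}^n\to\mathbb{R}$ be a Schwartz function, $\theta_0\in\mathcal{S}(\mathbb{R}^n)$, with $\sup_{x\in\mathbb{R}^n}\theta_0(x)>0$. Then there is no smooth global solution $\theta$ (i.e. no smooth solution on $[0,\infty)$) of the Cauchy problem $$\theta_t+u\cdot\nabla\theta=0,\qquad u=\nabla\Lambda^{-2+2\alpha}\theta,\qquad \theta(x,0)=\theta_0(x),\qquad x\in\mathbb{R}^n,\ t>0.$$
   Context: $\Lambda^s=(-\Delta)^{s/2}$ denotes the fractional Laplacian, i.e. the Fourier multiplier with $\widehat{\Lambda^s f}(\xi)=(2\pi|\xi|)^s\widehat f(\xi)$, where $\widehat f(\xi)=\int_{\mathbb{R}^n}e^{-2\pi i x\cdot\xi}f(x)\,dx$. Thus $u(\cdot,t)$ has Fourier transform $2\pi i\xi\,(2\pi|\xi|)^{-2+2\alpha}\,\widehat\theta(\xi,t)$, which for $n\ge2$ and $\theta(\cdot,t)\in\bigcap_{s\ge 0}H^s(\mathbb{R}^n)$ defines a bounded continuous vector field $u(\cdot,t)$. Smooth solution: for $T>0$, a smooth solution on $[0,T]$ is a real-valued $\theta\in C^1([0,T];H^s(\mathbb{R}^n))$ for every $s\ge 0$ satisfying the equation pointwise on $\mathbb{R}^n\times[0,T]$ and the initial condition. A smooth global solution is a $\theta$ on $\mathbb{R}^n\times[0,\infty)$ whose restriction to $[0,T]$ is a smooth solution for every $T>0$. *)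

theory Defs
  imports "HOL-Analysis.Analysis"
begin

definition partial_deriv :: "'n::finite \<Rightarrow> (real^'n \<Rightarrow> real) \<Rightarrow> real^'n \<Rightarrow> real" where
  "partial_deriv j f x = frechet_derivative f (at x) (axis j 1)"

text \<open>Multi-indices are represented by the list of directions of differentiation.
  Differentiability of all iterated partial derivatives makes \<^term>\<open>f\<close> of class C-infinity.\<close>

definition schwartz :: "(real^'n::finite \<Rightarrow> real) \<Rightarrow> bool" where
  "schwartz f \<longleftrightarrow>
     (\<forall>js x. foldr partial_deriv js f differentiable (at x)) \<and>
     (\<forall>js k. bounded (range (\<lambda>x. norm x ^ k * foldr partial_deriv js f x)))"

definition square_integrable :: "(real^'n::finite \<Rightarrow> complex) \<Rightarrow> bool" where
  "square_integrable f \<longleftrightarrow>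
     f \<in> borel_measurable lborel \<and> integrable lborel (\<lambda>x. (norm (f x))\<^sup>2)"

definition fourier_integral :: "(real^'n::finite \<Rightarrow> complex) \<Rightarrow> real^'n \<Rightarrow> complex" where
  "fourier_integral f \<xi> = (LINT x|lborel. cis (- 2 * pi * (x \<bullet> \<xi>)) * f x)"

definition inverse_fourier_integral :: "(real^'n::finite \<Rightarrow> complex) \<Rightarrow> real^'n \<Rightarrow> complex" where
  "inverse_fourier_integral g x = (LINT \<xi>|lborel. cis (2 * pi * (x \<bullet> \<xi>)) * g \<xi>)"

text \<open>Functions in the Sobolev spaces need not be integrable, so the Fourier transform is the
  Plancherel one: the limit in L2 of the Fourier integrals of the truncations of \<^term>\<open>f\<close> to
  balls (which are integrable). It is determined up to a null set.\<close>

definition is_fourier_L2 ::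
    "(real^'n::finite \<Rightarrow> complex) \<Rightarrow> (real^'n \<Rightarrow> complex) \<Rightarrow> bool" where
  "is_fourier_L2 f g \<longleftrightarrow>
     square_integrable f \<and> square_integrable g \<and>
     ((\<lambda>R. \<integral>\<^sup>+ \<xi>. ennreal ((norm (g \<xi> -
          fourier_integral (\<lambda>x. indicator (ball 0 R) x *\<^sub>R f x) \<xi>))\<^sup>2) \<partial>lborel) \<longlongrightarrow> 0) at_top"

definition fourier_L2 :: "(real^'n::finite \<Rightarrow> real) \<Rightarrow> real^'n \<Rightarrow> complex" where
  "fourier_L2 f = (SOME g. is_fourier_L2 (\<lambda>x. complex_of_real (f x)) g)"

text \<open>Functions in H^s are identified when they agree almost everywhere; here
  they are represented by arbitrary Borel functions in the class.\<close>

definition in_sobolev :: "real \<Rightarrow> (real^'n::finite \<Rightarrow> real) \<Rightarrow> bool" where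
  "in_sobolev s f \<longleftrightarrow>
     (\<exists>g. is_fourier_L2 (\<lambda>x. complex_of_real (f x)) g \<and>
          square_integrable (\<lambda>\<xi>. (1 + (norm \<xi>)\<^sup>2) powr (s / 2) *\<^sub>R g \<xi>))"

definition sobolev_norm :: "real \<Rightarrow> (real^'n::finite \<Rightarrow> real) \<Rightarrow> real" where
  "sobolev_norm s f =
     sqrt (LINT \<xi>|lborel. (1 + (norm \<xi>)\<^sup>2) powr s * (norm (fourier_L2 f \<xi>))\<^sup>2)"

text \<open>\<^term>\<open>\<theta>\<close> belongs to C^1([0,T]; H^s), with one-sided derivatives at the end points;
  \<^term>\<open>\<theta>'\<close> is the derivative of the curve with respect to the norm of H^s.\<close>

definition C1_sobolev :: "real \<Rightarrow> real \<Rightarrow> (real \<Rightarrow> real^'n::finite \<Rightarrow> real) \<Rightarrow> bool" where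
  "C1_sobolev s T \<theta> \<longleftrightarrow>
     (\<forall>t\<in>{0..T}. in_sobolev s (\<theta> t)) \<and>
     (\<exists>\<theta>'. \<forall>t\<in>{0..T}.
        in_sobolev s (\<theta>' t) \<and>
        ((\<lambda>\<tau>. sobolev_norm s (\<lambda>x. (\<theta> \<tau> x - \<theta> t x) / (\<tau> - t) - \<theta>' t x)) \<longlongrightarrow> 0)
          (at t within {0..T}) \<and>
        ((\<lambda>\<tau>. sobolev_norm s (\<lambda>x. \<theta>' \<tau> x - \<theta>' t x)) \<longlongrightarrow> 0) (at t within {0..T}))"

text \<open>\<open>u = \<nabla>\<Lambda>\<^sup>-\<^sup>2\<^sup>+\<^sup>2\<^sup>\<alpha> f\<close>, where \<open>\<Lambda>\<close> has symbol \<open>2\<pi>|\<xi>|\<close>. When \<open>f\<close> lies in H^s for all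
  \<open>s \<ge> 0\<close> and \<open>n \<ge> 2\<close>, the function \<open>2\<pi>i\<xi>\<^sub>j (2\<pi>|\<xi>|)\<^sup>-\<^sup>2\<^sup>+\<^sup>2\<^sup>\<alpha>\<close> times the Fourier transform of \<open>f\<close>
  is integrable (but need not be square integrable), so the bounded continuous function with this
  Fourier transform is given by the inversion integral. The integral is real because \<open>f\<close> is real
  and the symbol at \<open>-\<xi>\<close> is the conjugate of the symbol at \<open>\<xi>\<close>; \<^const>\<open>Re\<close> only adjusts the type.\<close>

definition velocity :: "real \<Rightarrow> (real^'n::finite \<Rightarrow> real) \<Rightarrow> real^'n \<Rightarrow> real^'n" where
  "velocity \<alpha> f x =
     (\<chi> j. Re (inverse_fourier_integral
        (\<lambda>\<xi>. 2 * pi * \<i> * complex_of_real (\<xi> $ j)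
              * complex_of_real ((2 * pi * norm \<xi>) powr (- 2 + 2 * \<alpha>)) * fourier_L2 f \<xi>) x))"

definition smooth_solution ::
    "real \<Rightarrow> (real^'n::finite \<Rightarrow> real) \<Rightarrow> real \<Rightarrow> (real \<Rightarrow> real^'n \<Rightarrow> real) \<Rightarrow> bool" where
  "smooth_solution \<alpha> \<theta>0 T \<theta> \<longleftrightarrow>
     (\<forall>s\<ge>0. C1_sobolev s T \<theta>) \<and>
     (\<forall>t\<in>{0..T}. \<forall>x. \<exists>\<theta>t grad\<theta>.
        ((\<lambda>\<tau>. \<theta> \<tau> x) has_real_derivative \<theta>t) (at t within {0..T}) \<and>
        GDERIV (\<theta> t) x :> grad\<theta> \<and>
        \<theta>t + velocity \<alpha> (\<theta> t) x \<bullet> grad\<theta> = 0) \<and>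
     (\<forall>x. \<theta> 0 x = \<theta>0 x)"

text \<open>The values of \<^term>\<open>\<theta>\<close> at negative times are irrelevant.\<close>

definition smooth_global_solution ::
    "real \<Rightarrow> (real^'n::finite \<Rightarrow> real) \<Rightarrow> (real \<Rightarrow> real^'n \<Rightarrow> real) \<Rightarrow> bool" where
  "smooth_global_solution \<alpha> \<theta>0 \<theta> \<longleftrightarrow> (\<forall>T>0. smooth_solution \<alpha> \<theta>0 T \<theta>)"

end

(*
  The velocity u = grad Lambda^(2 alpha - 2) theta satisfies div u = - Lambda^(2 alpha) theta, so for
  every nonnegative increasing function phi the integral of phi(theta) is dissipated at the rate
  int phi(theta) Lambda^(2 alpha) theta dx.  Symmetrising the kernel of Lambda^(2 alpha), written by
  subordination as an average of heat kernels, bounds this rate below: if phi vanishes up to a level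
  m > l > 0, it is at least a constant times (m - l) |{theta > l}|^(- 2 alpha / n) int phi(theta).
  Hence the smaller a superlevel set, the faster the higher ones decay, and a De Giorgi iteration over
  increasing levels makes some set {theta > M} with 0 < M < sup theta0 null in finite time.
  As long as the solution is smooth, Lambda^(2 alpha) theta is bounded, so that int phi(theta) can
  decay at most exponentially and never vanishes: a contradiction.  Only L2-type Fourier data are
  given, so inversion and the pairing with the heat semigroup are derived by duality with Gaussians.
*)

theory Submission
  imports Defs "HOL-Probability.Characteristic_Functions" "HOL-Real_Asymp.Real_Asymp"
begin

section \<open>The heat kernel and its Fourier transform\<close>

text \<open>Beyond continuity and square integrability, a time slice enters only through one
  weighted L1 norm of its transform, \<open>freq_norm\<close> with \<beta> = |1 - 2 \<alpha>|. Its
  weight dominates the symbols of the identity, the gradient, the velocity (order 2 \<alpha> - 1)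
  and Lambda^(2 \<alpha>), and Cauchy-Schwarz bounds it by the H^(n + 2) norm as long as 2 \<beta> <
  n; this is where n >= 2 enters. Neither div u nor Lambda^(2 \<alpha>) \<theta> is formed in space:
  the integration by parts is an identity between symbols. The function phi is the square of the
  positive part of z - l. It is C^1, so the chain rule applies, and l > 0 confines it to a set of
  finite measure, so square integrability of \<theta> makes all the energies finite. The damping
  rate is a negative power of the energy at a lower level. This feedback is what beats the powers of
  2 lost when the gaps between levels and between times are halved at each step of the iteration.
  The exponential lower bound has a rate depending on the time horizon; that is harmless, because
  the time at which the energy would have to vanish is fixed in advance by the initial
  energy.\<close>

lemma Basis_vec_real: "(Basis :: (real^'n::finite) set) = (\<lambda>i. axis i 1) ` UNIV"
  by (auto simp: Basis_vec_def)

lemma inj_axis_1: "inj (\<lambda>i::'n::finite. axis i (1::real))"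
  by (auto simp: inj_def axis_eq_axis)

text \<open>Fubini for products of functions of one coordinate each, which reduces Gaussian
  integrals and singular weights to the real line. \<open>lborel\<close> is an image of a product
  measure indexed by \<open>Basis\<close>, so \<open>ix\<close> translates a basis vector back into
  its coordinate.\<close>

lemma
  fixes f :: "'n::finite \<Rightarrow> real \<Rightarrow> 'b::{real_normed_field,banach,second_countable_topology}"
  assumes f: "\<And>i. integrable lborel (f i)"
  shows integrable_lborel_vec_prod: "integrable lborel (\<lambda>x::real^'n. \<Prod>i\<in>UNIV. f i (x $ i))"
    and integral_lborel_vec_prod:
      "(LINT x|lborel. (\<Prod>i\<in>UNIV. f i ((x::real^'n) $ i))) = (\<Prod>i\<in>UNIV. (LINT x|lborel. f i x))"
proof -
  interpret product_sigma_finite "\<lambda>_::real^'n. lborel :: real measure"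
    by unfold_locales
  define ix where "ix = inv (\<lambda>i::'n. axis i (1::real))"
  have ix: "ix (axis i 1) = i" for i
    unfolding ix_def by (rule inv_f_f[OF inj_axis_1])
  define F where "F b = f (ix b)" for b
  have eq: "(\<Prod>i\<in>UNIV. g i (x $ i)) = (\<Prod>b\<in>Basis. g (ix b) (x \<bullet> b))"
    for x :: "real^'n" and g :: "'n \<Rightarrow> real \<Rightarrow> 'b"
    unfolding Basis_vec_real by (subst prod.reindex) (auto simp: inj_axis_1 ix inner_axis)
  have F: "integrable lborel (F b)" for b
    unfolding F_def by (rule f)
  have [measurable]: "F b \<in> borel_measurable borel" for b
    using borel_measurable_integrable[OF F] by simp
  have inn: "(\<Sum>b\<in>Basis. y b *\<^sub>R b) \<bullet> c = y c" if "c \<in> Basis" for y :: "real^'n \<Rightarrow> real" and c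
    using that by (rule inner_sum_left_Basis)
  have pr: "(\<Prod>b\<in>Basis. F b ((\<Sum>c\<in>Basis. y c *\<^sub>R c) \<bullet> b)) = (\<Prod>b\<in>Basis. F b (y b))" for y :: "real^'n \<Rightarrow> real"
    by (intro prod.cong refl) (simp add: inn)
  have 1: "integrable (Pi\<^sub>M Basis (\<lambda>_::real^'n. lborel :: real measure)) (\<lambda>y. \<Prod>b\<in>Basis. F b (y b))"
    by (intro product_integrable_prod F) auto
  have 2: "(LINT y|Pi\<^sub>M Basis (\<lambda>_::real^'n. lborel :: real measure). (\<Prod>b\<in>Basis. F b (y b)))
     = (\<Prod>b\<in>(Basis::(real^'n) set). (LINT x|lborel. F b x))"
    by (intro product_integral_prod F) auto
  show "integrable lborel (\<lambda>x::real^'n. \<Prod>i\<in>UNIV. f i (x $ i))"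
    unfolding eq F_def[symmetric]
    by (subst lborel_eq, subst integrable_distr_eq) (use 1 in \<open>simp_all add: pr cong: measurable_cong_sets\<close>)
  have "(LINT x|lborel. (\<Prod>i\<in>UNIV. f i ((x::real^'n) $ i))) = (\<Prod>b\<in>(Basis::(real^'n) set). (LINT x|lborel. F b x))"
    unfolding eq F_def[symmetric]
    by (subst lborel_eq, subst integral_distr) (use 2 in \<open>simp_all add: pr cong: measurable_cong_sets\<close>)
  also have "\<dots> = (\<Prod>i\<in>UNIV. (LINT x|lborel. f i x))"
    unfolding Basis_vec_real F_def by (subst prod.reindex) (auto simp: inj_axis_1 ix)
  finally show "(LINT x|lborel. (\<Prod>i\<in>UNIV. f i ((x::real^'n) $ i))) = (\<Prod>i\<in>UNIV. (LINT x|lborel. f i x))" .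
qed

text \<open>Integrability is itself translation invariant, and where it fails both sides take the
  default value 0; hence no hypothesis on \<open>f\<close>.\<close>

lemma integral_lborel_translate:
  fixes f :: "'a::euclidean_space \<Rightarrow> 'b::{banach,second_countable_topology}"
  shows "(LINT x|lborel. f (x + h)) = (LINT x|lborel. f x)"
proof (cases "integrable lborel f")
  case True
  then have [measurable]: "f \<in> borel_measurable borel" by auto
  show ?thesis
    by (subst (2) lborel_distr_plus[of h, symmetric], subst integral_distr) (auto simp: add.commute)
next
  case False
  have "\<not> integrable lborel (\<lambda>x. f (x + h))"
  proof
    assume *: "integrable lborel (\<lambda>x. f (x + h))"
    then have [measurable]: "(\<lambda>x. f (x + h)) \<in> borel_measurable borel" by auto
    have "integrable (distr lborel borel ((+) (-h))) (\<lambda>x. f (x + h))"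
      using * by (simp add: lborel_distr_plus)
    then have "integrable lborel f"
      by (subst (asm) integrable_distr_eq) auto
    with False show False by simp
  qed
  then show ?thesis using False by (simp add: not_integrable_integral_eq)
qed

lemma integrable_lborel_translate:
  fixes f :: "'a::euclidean_space \<Rightarrow> 'b::{banach,second_countable_topology}"
  assumes "integrable lborel f"
  shows "integrable lborel (\<lambda>x. f (x + h))"
proof -
  have [measurable]: "f \<in> borel_measurable borel" using assms by auto
  have "integrable (distr lborel borel ((+) h)) f"
    using assms by (simp add: lborel_distr_plus)
  then show ?thesis
    by (subst (asm) integrable_distr_eq) (auto simp: add.commute)
qed

definition heat_symbol :: "real \<Rightarrow> real^'n::finite \<Rightarrow> real" where
  "heat_symbol t \<xi> = exp (- (t * (2 * pi * norm \<xi>)\<^sup>2))"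

text \<open>The Gauss-Weierstrass kernel of exp(t Laplacian), whose coordinates are independent
  normal variables of variance 2 t. In product form its mass and its Fourier transform are computed
  one coordinate at a time; \<open>heat_kernel_eq\<close> gives the radial formula.\<close>

definition heat_kernel :: "real \<Rightarrow> real^'n::finite \<Rightarrow> real" where
  "heat_kernel t x = (\<Prod>i\<in>UNIV. normal_density 0 (sqrt (2 * t)) (x $ i))"

lemma norm_vec_square: "(norm (x :: real^'n::finite))\<^sup>2 = (\<Sum>i\<in>UNIV. (x $ i)\<^sup>2)"
  by (simp add: norm_vec_def L2_set_def sum_nonneg)

lemma cis_measurable [measurable]: "cis \<in> borel_measurable borel"
  by (intro borel_measurable_continuous_onI continuous_intros)

lemma fourier_gaussian_real:
  assumes "t > 0"
  shows "integrable lborel (\<lambda>\<xi>. cis (2 * pi * (x * \<xi>)) * exp (- (t * (2 * pi * \<xi>)\<^sup>2)))"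
    and "(LINT \<xi>|lborel. cis (2 * pi * (x * \<xi>)) * exp (- (t * (2 * pi * \<xi>)\<^sup>2)))
       = complex_of_real (normal_density 0 (sqrt (2 * t)) x)"
proof -
  \<comment> \<open>For this \<open>c\<close> the number (c \<xi>)^2 / 2 equals t (2 pi \<xi>)^2, so
    the substitution s = c \<xi> turns the integral into the characteristic function of the standard
    normal law.\<close>
  define c where "c = 2 * pi * sqrt (2 * t)"
  have c: "c > 0" using assms by (simp add: c_def)
  let ?F = "\<lambda>s. std_normal_density s *\<^sub>R cis (2 * pi * x / c * s)"
  have intF: "integrable lborel ?F"
    by (rule Bochner_Integration.integrable_bound[OF integrable_normal_density[of 1 0]])
       auto
  have F: "(LINT s|lborel. ?F s) = complex_of_real (exp (- ((2 * pi * x / c)\<^sup>2) / 2))"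
  proof -
    have "char std_normal_distribution (2 * pi * x / c) = (LINT s|lborel. ?F s)"
      unfolding char_def
      by (subst integral_density) (auto simp: cis_conv_exp mult_ac)
    then show ?thesis by (simp add: char_std_normal_distribution)
  qed
  have eq: "cis (2 * pi * (x * \<xi>)) * exp (- (t * (2 * pi * \<xi>)\<^sup>2)) = sqrt (2 * pi) *\<^sub>R ?F (0 + c * \<xi>)" for \<xi>
  proof -
    have "(c * \<xi>)\<^sup>2 / 2 = t * (2 * pi * \<xi>)\<^sup>2"
      using assms by (simp add: c_def power_mult_distrib)
    moreover have "2 * pi * x / c * (c * \<xi>) = 2 * pi * (x * \<xi>)" using c by simp
    ultimately show ?thesis
      by (simp add: std_normal_density_def scaleR_conv_of_real real_sqrt_mult)
  qed
  show "integrable lborel (\<lambda>\<xi>. cis (2 * pi * (x * \<xi>)) * exp (- (t * (2 * pi * \<xi>)\<^sup>2)))"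
    unfolding eq by (rule integrable_scaleR_right) (use lborel_integrable_real_affine[OF intF, of c 0] c in auto)
  have "(LINT \<xi>|lborel. cis (2 * pi * (x * \<xi>)) * exp (- (t * (2 * pi * \<xi>)\<^sup>2)))
      = sqrt (2 * pi) *\<^sub>R (LINT \<xi>|lborel. ?F (0 + c * \<xi>))"
    unfolding eq by (rule integral_scaleR_right)
  also have "(LINT \<xi>|lborel. ?F (0 + c * \<xi>)) = (1 / c) *\<^sub>R (LINT s|lborel. ?F s)"
    using lborel_integral_real_affine[of c ?F 0] c by simp
  also have "sqrt (2 * pi) *\<^sub>R (1 / c) *\<^sub>R (LINT s|lborel. ?F s)
      = complex_of_real (sqrt (2 * pi) / c * exp (- ((2 * pi * x / c)\<^sup>2) / 2))"
    unfolding F by (simp add: scaleR_conv_of_real)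
  also have "sqrt (2 * pi) / c * exp (- ((2 * pi * x / c)\<^sup>2) / 2) = normal_density 0 (sqrt (2 * t)) x"
  proof -
    have "(2 * pi * x / c)\<^sup>2 / 2 = x\<^sup>2 / (2 * (sqrt (2 * t))\<^sup>2)"
      using assms by (simp add: c_def power_divide power_mult_distrib)
    moreover have "sqrt (2 * pi) / c = 1 / sqrt (2 * pi * (sqrt (2 * t))\<^sup>2)"
    proof -
      have "sqrt (2 * pi * (sqrt (2 * t))\<^sup>2) = sqrt (2 * pi) * sqrt (2 * t)"
        using assms by (simp add: real_sqrt_mult)
      moreover have "sqrt (2 * pi) * sqrt (2 * pi) = 2 * pi" by simp
      ultimately show ?thesis using assms by (simp add: c_def field_simps)
    qed
    ultimately show ?thesis by (simp add: normal_density_def)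
  qed
  finally show "(LINT \<xi>|lborel. cis (2 * pi * (x * \<xi>)) * exp (- (t * (2 * pi * \<xi>)\<^sup>2)))
       = complex_of_real (normal_density 0 (sqrt (2 * t)) x)" .
qed

lemma heat_symbol_prod: "heat_symbol t \<xi> = (\<Prod>i\<in>UNIV. exp (- (t * (2 * pi * \<xi> $ i)\<^sup>2)))"
  unfolding heat_symbol_def
  by (simp add: exp_sum[symmetric] power_mult_distrib norm_vec_square sum_distrib_left sum_negf)

lemma cis_inner_prod: "cis (c * (x \<bullet> \<xi>)) = (\<Prod>i\<in>UNIV. cis (c * (x $ i * \<xi> $ i)))"
  for x :: "real^'n::finite"
  unfolding cis_conv_exp exp_sum[OF finite, symmetric] inner_vec_def
  by (simp add: sum_distrib_left)

lemma
  fixes x :: "real^'n::finite"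
  assumes "t > 0"
  shows integrable_cis_heat_symbol:
      "integrable lborel (\<lambda>\<xi>. cis (2 * pi * (x \<bullet> \<xi>)) * complex_of_real (heat_symbol t \<xi>))"
    and integral_cis_heat_symbol:
      "(LINT \<xi>|lborel. cis (2 * pi * (x \<bullet> \<xi>)) * complex_of_real (heat_symbol t \<xi>))
         = complex_of_real (heat_kernel t x)"
proof -
  have eq: "cis (2 * pi * (x \<bullet> \<xi>)) * complex_of_real (heat_symbol t \<xi>)
     = (\<Prod>i\<in>UNIV. cis (2 * pi * (x $ i * \<xi> $ i)) * complex_of_real (exp (- (t * (2 * pi * \<xi> $ i)\<^sup>2))))" for \<xi>
    by (simp add: heat_symbol_prod cis_inner_prod prod.distrib)
  show "integrable lborel (\<lambda>\<xi>. cis (2 * pi * (x \<bullet> \<xi>)) * complex_of_real (heat_symbol t \<xi>))"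
    unfolding eq by (rule integrable_lborel_vec_prod) (rule fourier_gaussian_real[OF assms])
  show "(LINT \<xi>|lborel. cis (2 * pi * (x \<bullet> \<xi>)) * complex_of_real (heat_symbol t \<xi>))
         = complex_of_real (heat_kernel t x)"
    unfolding eq
    by (subst integral_lborel_vec_prod)
       (simp_all add: fourier_gaussian_real[OF assms] heat_kernel_def del: of_real_exp)
qed

lemma heat_symbol_pos [simp]: "0 < heat_symbol t \<xi>"
  and heat_symbol_nonneg [simp]: "0 \<le> heat_symbol t \<xi>"
  and heat_symbol_le_1: "t \<ge> 0 \<Longrightarrow> heat_symbol t \<xi> \<le> 1"
  by (simp_all add: heat_symbol_def)

lemma integrable_heat_symbol:
  assumes "t > 0" shows "integrable lborel (heat_symbol t :: real^'n::finite \<Rightarrow> real)"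
  using integrable_cis_heat_symbol[OF assms, of "0::real^'n"]
  by (simp add: complex_of_real_integrable_eq)

lemma heat_kernel_nonneg [simp]: "0 \<le> heat_kernel t x"
  unfolding heat_kernel_def by (intro prod_nonneg) simp

lemma heat_kernel_minus: "heat_kernel t (x - y) = heat_kernel t (y - x)"
  by (simp add: heat_kernel_def normal_density_def power2_commute)

lemma
  assumes "t > 0"
  shows integrable_heat_kernel: "integrable lborel (heat_kernel t :: real^'n::finite \<Rightarrow> real)"
    and integral_heat_kernel: "(LINT x|lborel. heat_kernel t (x::real^'n)) = 1"
proof -
  show "integrable lborel (heat_kernel t :: real^'n::finite \<Rightarrow> real)"
    unfolding heat_kernel_def by (rule integrable_lborel_vec_prod) (use assms in auto)
  show "(LINT x|lborel. heat_kernel t (x::real^'n)) = 1"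
    unfolding heat_kernel_def by (subst integral_lborel_vec_prod) (use assms in auto)
qed

lemma heat_kernel_eq:
  assumes "t > 0"
  shows "heat_kernel t (x::real^'n::finite) = (4 * pi * t) powr (- (real CARD('n) / 2)) * exp (- ((norm x)\<^sup>2 / (4 * t)))"
proof -
  have 1: "normal_density 0 (sqrt (2 * t)) y = (4 * pi * t) powr (- (1 / 2)) * exp (- (y\<^sup>2 / (4 * t)))" for y
    using assms by (simp add: normal_density_def powr_minus powr_half_sqrt field_simps)
  have 2: "((4 * pi * t) powr (- (1 / 2))) ^ CARD('n) = (4 * pi * t) powr (- (real CARD('n) / 2))"
    using assms by (subst powr_realpow[symmetric]) (simp_all add: powr_powr)
  show ?thesis unfolding heat_kernel_def 1
    by (simp add: prod.distrib 2 exp_sum[symmetric] norm_vec_square sum_divide_distrib sum_negf)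
qed

lemma heat_kernel_measurable [measurable]: "heat_kernel t \<in> borel_measurable borel"
  unfolding heat_kernel_def
  by measurable

lemma heat_symbol_measurable [measurable]: "heat_symbol t \<in> borel_measurable borel"
  unfolding heat_symbol_def by measurable

section \<open>The Plancherel Fourier transform and its inversion\<close>

lemma integrable_pair_dominated:
  fixes F :: "'a::euclidean_space \<times> 'b::euclidean_space \<Rightarrow> 'c::{banach,second_countable_topology}"
    and a :: "'a \<Rightarrow> real" and b :: "'b \<Rightarrow> real"
  assumes a: "integrable lborel a" and b: "integrable lborel b"
    and F [measurable]: "F \<in> borel_measurable (lborel \<Otimes>\<^sub>M lborel)"
    and le: "\<And>x y. norm (F (x, y)) \<le> a x * b y"
  shows "integrable (lborel \<Otimes>\<^sub>M lborel) F"
proof -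
  have [measurable]: "a \<in> borel_measurable borel" "b \<in> borel_measurable borel"
    using a b by auto
  have "integrable (lborel \<Otimes>\<^sub>M lborel) (\<lambda>(x, y). a x * b y)"
    by (rule lborel_pair.Fubini_integrable) (use a b in \<open>auto simp: abs_mult\<close>)
  then show ?thesis
    by (rule Bochner_Integration.integrable_bound) (auto intro: order_trans[OF le abs_ge_self])
qed

lemma integrable_mult_square:
  fixes f g :: "'a \<Rightarrow> 'b::{banach,second_countable_topology,real_normed_algebra}"
  assumes [measurable]: "f \<in> borel_measurable M" "g \<in> borel_measurable M"
    and f: "integrable M (\<lambda>x. (norm (f x))\<^sup>2)" and g: "integrable M (\<lambda>x. (norm (g x))\<^sup>2)"
  shows "integrable M (\<lambda>x. f x * g x)"
proof (rule Bochner_Integration.integrable_bound[OF Bochner_Integration.integrable_add[OF f g]])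
  show "AE x in M. norm (f x * g x) \<le> norm ((norm (f x))\<^sup>2 + (norm (g x))\<^sup>2)"
  proof (rule AE_I2)
    fix x
    have "norm (f x * g x) \<le> norm (f x) * norm (g x)" by (rule norm_mult_ineq)
    also have "\<dots> \<le> (norm (f x))\<^sup>2 + (norm (g x))\<^sup>2"
      using sum_squares_bound[of "norm (f x)" "norm (g x)"]
        mult_nonneg_nonneg[OF norm_ge_zero[of "f x"] norm_ge_zero[of "g x"]] by linarith
    finally show "norm (f x * g x) \<le> norm ((norm (f x))\<^sup>2 + (norm (g x))\<^sup>2)" by simp
  qed
qed auto

lemma Cauchy_Schwarz_integral:
  fixes f g :: "'a \<Rightarrow> real"
  assumes [measurable]: "f \<in> borel_measurable M" "g \<in> borel_measurable M"
    and f: "integrable M (\<lambda>x. (f x)\<^sup>2)" and g: "integrable M (\<lambda>x. (g x)\<^sup>2)"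
  shows "integrable M (\<lambda>x. \<bar>f x * g x\<bar>)"
    and "(LINT x|M. \<bar>f x * g x\<bar>) \<le> sqrt (LINT x|M. (f x)\<^sup>2) * sqrt (LINT x|M. (g x)\<^sup>2)"
proof -
  show i: "integrable M (\<lambda>x. \<bar>f x * g x\<bar>)"
    using integrable_mult_square[of f M g] f g by auto
  have "(\<integral>\<^sup>+x. ennreal \<bar>f x\<bar> * ennreal \<bar>g x\<bar> \<partial>M)\<^sup>2
      \<le> (\<integral>\<^sup>+x. (ennreal \<bar>f x\<bar>)\<^sup>2 \<partial>M) * (\<integral>\<^sup>+x. (ennreal \<bar>g x\<bar>)\<^sup>2 \<partial>M)"
    by (rule Cauchy_Schwarz_nn_integral) auto
  also have "(\<integral>\<^sup>+x. ennreal \<bar>f x\<bar> * ennreal \<bar>g x\<bar> \<partial>M) = ennreal (LINT x|M. \<bar>f x * g x\<bar>)"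
    using nn_integral_eq_integral[OF i] by (simp add: ennreal_mult abs_mult)
  also have "(\<integral>\<^sup>+x. (ennreal \<bar>f x\<bar>)\<^sup>2 \<partial>M) = ennreal (LINT x|M. (f x)\<^sup>2)"
    using nn_integral_eq_integral[OF f] by (simp add: ennreal_power)
  also have "(\<integral>\<^sup>+x. (ennreal \<bar>g x\<bar>)\<^sup>2 \<partial>M) = ennreal (LINT x|M. (g x)\<^sup>2)"
    using nn_integral_eq_integral[OF g] by (simp add: ennreal_power)
  finally have "(LINT x|M. \<bar>f x * g x\<bar>)\<^sup>2 \<le> (LINT x|M. (f x)\<^sup>2) * (LINT x|M. (g x)\<^sup>2)"
    by (simp add: ennreal_power ennreal_mult[symmetric])
  then show "(LINT x|M. \<bar>f x * g x\<bar>) \<le> sqrt (LINT x|M. (f x)\<^sup>2) * sqrt (LINT x|M. (g x)\<^sup>2)"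
    unfolding real_sqrt_mult[symmetric] by (intro real_le_rsqrt)
qed

definition trunc :: "real \<Rightarrow> (real^'n::finite \<Rightarrow> complex) \<Rightarrow> real^'n \<Rightarrow> complex" where
  "trunc R f x = indicator (ball 0 R) x *\<^sub>R f x"

lemma is_fourier_L2_trunc:
  "is_fourier_L2 f g \<longleftrightarrow> square_integrable f \<and> square_integrable g \<and>
    ((\<lambda>R. \<integral>\<^sup>+ \<xi>. ennreal ((norm (g \<xi> - fourier_integral (trunc R f) \<xi>))\<^sup>2) \<partial>lborel) \<longlongrightarrow> 0) at_top"
  unfolding is_fourier_L2_def trunc_def[abs_def] ..

lemma square_integrableD:
  assumes "square_integrable f"
  shows "f \<in> borel_measurable borel" "integrable lborel (\<lambda>x. (norm (f x))\<^sup>2)"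
  using assms by (auto simp: square_integrable_def)

lemma trunc_measurable [measurable]:
  assumes [measurable]: "f \<in> borel_measurable borel"
  shows "trunc R f \<in> borel_measurable borel"
  unfolding trunc_def[abs_def] by (intro borel_measurable_scaleR borel_measurable_indicator) auto

text \<open>On a ball, which has finite measure, |f| is at most 1 + |f|^2.\<close>

lemma integrable_trunc:
  assumes "square_integrable f"
  shows "integrable lborel (trunc R f)"
proof -
  note [measurable] = square_integrableD(1)[OF assms]
  have "integrable lborel (\<lambda>x. indicator (ball 0 R) x + (norm (f x))\<^sup>2)"
    using square_integrableD(2)[OF assms] emeasure_bounded_finite[OF bounded_ball, of 0 R]
    by (intro Bochner_Integration.integrable_add integrable_real_indicator) auto
  then show ?thesis
  proof (rule Bochner_Integration.integrable_bound)
    show "AE x in lborel. norm (trunc R f x) \<le> norm (indicator (ball 0 R) x + (norm (f x))\<^sup>2 :: real)"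
    proof (rule AE_I2)
      fix x
      have "norm (f x) \<le> 1 + (norm (f x))\<^sup>2"
        using sum_squares_bound[of "norm (f x)" 1] norm_ge_zero[of "f x"] by (simp del: norm_ge_zero)
      then show "norm (trunc R f x) \<le> norm (indicator (ball 0 R) x + (norm (f x))\<^sup>2 :: real)"
        by (auto simp: trunc_def indicator_def)
    qed
  qed measurable
qed

lemma fourier_integral_measurable [measurable]:
  assumes [measurable]: "f \<in> borel_measurable borel"
  shows "fourier_integral f \<in> borel_measurable borel"
  unfolding fourier_integral_def[abs_def] by measurable

lemma integrable_cis_mult:
  assumes "integrable lborel (f :: real^'n::finite \<Rightarrow> complex)"
  shows "integrable lborel (\<lambda>x. cis (c * (x \<bullet> \<xi>)) * f x)"
proof -
  have [measurable]: "f \<in> borel_measurable borel" using assms by auto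
  show ?thesis
    by (rule Bochner_Integration.integrable_bound[OF assms]) (auto simp: norm_mult)
qed

lemma integrable_cis_mult':
  assumes "integrable lborel (f :: real^'n::finite \<Rightarrow> complex)"
  shows "integrable lborel (\<lambda>\<xi>. cis (c * (x \<bullet> \<xi>)) * f \<xi>)"
  using integrable_cis_mult[OF assms, of c x] by (simp add: inner_commute)

text \<open>Fubini: integrating the modulated Gaussian in \<xi> first produces the heat kernel
  centred at \<open>x\<close>. The Gaussian makes the double integral absolutely convergent.\<close>

lemma multiplication_formula_integrable:
  fixes f :: "real^'n::finite \<Rightarrow> complex"
  assumes f: "integrable lborel f" and t: "t > 0"
  shows "(LINT \<xi>|lborel. fourier_integral f \<xi> * (cis (2 * pi * (x \<bullet> \<xi>)) * heat_symbol t \<xi>))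
       = (LINT y|lborel. f y * heat_kernel t (x - y))"
proof -
  have [measurable]: "f \<in> borel_measurable borel" using f by auto
  let ?K = "\<lambda>\<xi> y. cis (- 2 * pi * (y \<bullet> \<xi>)) * f y * (cis (2 * pi * (x \<bullet> \<xi>)) * heat_symbol t \<xi>)"
  have "integrable (lborel \<Otimes>\<^sub>M lborel) (case_prod ?K)"
    by (rule integrable_pair_dominated[OF integrable_heat_symbol[OF t] integrable_norm[OF f]])
       (auto simp: norm_mult mult_ac)
  then have fub: "(LINT \<xi>|lborel. (LINT y|lborel. ?K \<xi> y)) = (LINT y|lborel. (LINT \<xi>|lborel. ?K \<xi> y))"
    by (rule lborel_pair.Fubini_integral[symmetric])
  have e1: "(LINT y|lborel. ?K \<xi> y) = fourier_integral f \<xi> * (cis (2 * pi * (x \<bullet> \<xi>)) * heat_symbol t \<xi>)" for \<xi>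
    unfolding fourier_integral_def by (rule integral_mult_left_zero)
  have e2: "(LINT \<xi>|lborel. ?K \<xi> y) = f y * heat_kernel t (x - y)" for y
  proof -
    have "?K \<xi> y = f y * (cis (2 * pi * ((x - y) \<bullet> \<xi>)) * heat_symbol t \<xi>)" for \<xi>
      by (simp add: inner_diff_left right_diff_distrib cis_divide[symmetric] cis_inverse[symmetric] field_simps flip: cis_cnj)
    then show ?thesis by (simp only: integral_mult_right_zero integral_cis_heat_symbol[OF t])
  qed
  show ?thesis using fub unfolding e1 e2 .
qed

lemma integrable_square_heat_symbol:
  assumes "t > 0" shows "integrable lborel (\<lambda>\<xi>::real^'n::finite. (heat_symbol t \<xi>)\<^sup>2)"
proof (rule Bochner_Integration.integrable_bound[OF integrable_heat_symbol[OF assms]])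
  show "AE \<xi>::real^'n in lborel. norm ((heat_symbol t \<xi>)\<^sup>2) \<le> norm (heat_symbol t \<xi>)"
    using assms heat_symbol_le_1[of t]
    by (intro AE_I2) (auto simp: power2_eq_square abs_mult intro!: mult_left_le)
qed measurable

lemma heat_kernel_le:
  assumes "t > 0" shows "heat_kernel t (x::real^'n::finite) \<le> (4 * pi * t) powr (- (real CARD('n) / 2))"
  unfolding heat_kernel_eq[OF assms] using assms by (intro mult_left_le) auto

lemma integrable_heat_kernel_diff:
  assumes "t > 0" shows "integrable lborel (\<lambda>y::real^'n::finite. heat_kernel t (x - y))"
    and "(LINT y|lborel. heat_kernel t (x - (y::real^'n))) = 1"
proof -
  have eq: "heat_kernel t (x - y) = heat_kernel t (y + (- x))" for y :: "real^'n"
    by (subst heat_kernel_minus) simp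
  show "integrable lborel (\<lambda>y::real^'n::finite. heat_kernel t (x - y))"
    unfolding eq by (rule integrable_lborel_translate[OF integrable_heat_kernel[OF assms]])
  show "(LINT y|lborel. heat_kernel t (x - (y::real^'n))) = 1"
    unfolding eq by (subst integral_lborel_translate) (rule integral_heat_kernel[OF assms])
qed

text \<open>The kernel is bounded and integrable, hence square integrable, and can be paired with
  \<open>f\<close>.\<close>

lemma integrable_mult_heat_kernel:
  fixes f :: "real^'n::finite \<Rightarrow> complex"
  assumes f: "square_integrable f" and t: "t > 0"
  shows "integrable lborel (\<lambda>y. f y * heat_kernel t (x - y))"
proof (rule integrable_mult_square)
  show "integrable lborel (\<lambda>y. (norm (complex_of_real (heat_kernel t (x - y))))\<^sup>2)"
  proof (rule Bochner_Integration.integrable_bound)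
    let ?C = "(4 * pi * t) powr (- (real CARD('n) / 2))"
    show "integrable lborel (\<lambda>y. ?C * heat_kernel t (x - y))"
      using integrable_heat_kernel_diff[OF t] by auto
    show "AE y in lborel. norm ((norm (complex_of_real (heat_kernel t (x - y))))\<^sup>2) \<le> norm (?C * heat_kernel t (x - y))"
      using heat_kernel_le[OF t, of "x - _"]
      by (intro AE_I2) (auto simp: power2_eq_square abs_mult intro!: mult_right_mono)
  qed measurable
qed (use square_integrableD[OF f] in auto)

lemma tendsto_ennreal_0_le:
  fixes X U :: "'a \<Rightarrow> ennreal"
  assumes "(U \<longlongrightarrow> 0) F" "\<And>R. X R \<le> U R"
  shows "(X \<longlongrightarrow> 0) F"
  by (rule tendsto_sandwich[OF _ _ tendsto_const[of 0 F] assms(1)]) (auto simp: assms(2))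

lemma tendsto_of_square_ennreal:
  fixes X :: "'a \<Rightarrow> 'b::real_normed_vector"
  assumes "(U \<longlongrightarrow> 0) F" "\<And>k. ennreal ((norm (L - X k))\<^sup>2) \<le> U k"
  shows "(X \<longlongrightarrow> L) F"
proof -
  have "((\<lambda>k. ennreal ((norm (L - X k))\<^sup>2)) \<longlongrightarrow> ennreal 0) F"
    unfolding ennreal_0 by (rule tendsto_ennreal_0_le) (fact assms)+
  then have "((\<lambda>k. (norm (L - X k))\<^sup>2) \<longlongrightarrow> 0) F"
    by (subst (asm) tendsto_ennreal_iff) auto
  from tendsto_real_sqrt[OF this] have "((\<lambda>k. norm (X k - L)) \<longlongrightarrow> 0) F"
    by (simp add: norm_minus_commute)
  then show ?thesis by (simp only: tendsto_norm_zero_iff LIM_zero_iff)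
qed

text \<open>Passage to the limit in the formula for the truncations of \<open>f\<close>. On the
  frequency side they converge in L2 and are paired with a Gaussian in L2; on the spatial side
  dominated convergence applies. This pairing is how the Plancherel transform, known only as an L2
  limit, is brought back to \<open>f\<close>.\<close>

lemma multiplication_formula:
  fixes f :: "real^'n::finite \<Rightarrow> complex"
  assumes fg: "is_fourier_L2 f g" and t: "t > 0"
  shows "(LINT \<xi>|lborel. g \<xi> * (cis (2 * pi * (x \<bullet> \<xi>)) * heat_symbol t \<xi>))
       = (LINT y|lborel. f y * heat_kernel t (x - y))"
proof -
  let ?\<psi> = "\<lambda>\<xi>. cis (2 * pi * (x \<bullet> \<xi>)) * heat_symbol t \<xi>"
  have f: "square_integrable f" and g: "square_integrable g"
    and lim: "((\<lambda>R. \<integral>\<^sup>+ \<xi>. ennreal ((norm (g \<xi> - fourier_integral (trunc R f) \<xi>))\<^sup>2) \<partial>lborel) \<longlongrightarrow> 0) at_top"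
    using fg by (auto simp: is_fourier_L2_trunc)
  note [measurable] = square_integrableD(1)[OF f] square_integrableD(1)[OF g]
  let ?G = "\<lambda>k::nat. fourier_integral (trunc (real k) f)"
  let ?H = "\<integral>\<^sup>+ \<xi>. (ennreal (heat_symbol t \<xi>))\<^sup>2 \<partial>(lborel :: (real^'n) measure)"
  have H: "?H < \<infinity>"
    using integrable_square_heat_symbol[OF t, where 'n='n]
    by (simp add: ennreal_power integrable_iff_bounded)
  have psi2: "integrable lborel (\<lambda>\<xi>. (norm (?\<psi> \<xi>))\<^sup>2)"
    using integrable_square_heat_symbol[OF t] by (simp add: norm_mult)
  have gpsi: "integrable lborel (\<lambda>\<xi>. g \<xi> * ?\<psi> \<xi>)"
    by (rule integrable_mult_square) (use square_integrableD[OF g] psi2 in auto)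
  have psi1: "integrable lborel ?\<psi>"
    by (rule integrable_cis_heat_symbol[OF t])
  have Gpsi: "integrable lborel (\<lambda>\<xi>. ?G k \<xi> * ?\<psi> \<xi>)" for k
  proof -
    let ?C = "LINT y|lborel. norm (trunc (real k) f y)"
    show ?thesis
    proof (rule Bochner_Integration.integrable_bound)
      show "integrable lborel (\<lambda>\<xi>. ?C *\<^sub>R ?\<psi> \<xi>)" using psi1 by (rule integrable_scaleR_right)
      have "norm (?G k \<xi>) \<le> ?C" for \<xi>
        unfolding fourier_integral_def
        by (rule order_trans[OF integral_norm_bound]) (simp add: norm_mult)
      then show "AE \<xi> in lborel. norm (?G k \<xi> * ?\<psi> \<xi>) \<le> norm (?C *\<^sub>R ?\<psi> \<xi>)"
        by (intro AE_I2) (simp add: norm_mult mult_right_mono)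
    qed measurable
  qed
  have "(\<lambda>k. LINT y|lborel. trunc (real k) f y * heat_kernel t (x - y)) \<longlonglongrightarrow> (LINT y|lborel. f y * heat_kernel t (x - y))"
  proof (rule integral_dominated_convergence[where w="\<lambda>y. norm (f y * heat_kernel t (x - y))"])
    show "integrable lborel (\<lambda>y. norm (f y * heat_kernel t (x - y)))"
      by (intro integrable_norm integrable_mult_heat_kernel f t)
    show "AE y in lborel. norm (trunc (real k) f y * heat_kernel t (x - y)) \<le> norm (f y * heat_kernel t (x - y))" for k
      by (auto simp: trunc_def indicator_def)
    show "AE y in lborel. (\<lambda>k. trunc (real k) f y * heat_kernel t (x - y)) \<longlonglongrightarrow> f y * heat_kernel t (x - y)"
    proof (intro AE_I2 tendsto_mult tendsto_const)
      fix y :: "real^'n"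
      obtain N where N: "norm y < real N" using reals_Archimedean2 by blast
      show "(\<lambda>k. trunc (real k) f y) \<longlonglongrightarrow> f y"
        by (rule tendsto_eventually, rule eventually_sequentiallyI[of N]) (use N in \<open>auto simp: trunc_def\<close>)
    qed
  qed measurable
  moreover have "(\<lambda>k. LINT \<xi>|lborel. ?G k \<xi> * ?\<psi> \<xi>) \<longlonglongrightarrow> (LINT \<xi>|lborel. g \<xi> * ?\<psi> \<xi>)"
  proof -
    have le: "(ennreal (norm ((LINT \<xi>|lborel. g \<xi> * ?\<psi> \<xi>) - (LINT \<xi>|lborel. ?G k \<xi> * ?\<psi> \<xi>))))\<^sup>2
       \<le> (\<integral>\<^sup>+ \<xi>. ennreal ((norm (g \<xi> - ?G k \<xi>))\<^sup>2) \<partial>lborel) * ?H" for k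
    proof -
      have diff: "(LINT \<xi>|lborel. g \<xi> * ?\<psi> \<xi>) - (LINT \<xi>|lborel. ?G k \<xi> * ?\<psi> \<xi>)
         = (LINT \<xi>|lborel. g \<xi> * ?\<psi> \<xi> - ?G k \<xi> * ?\<psi> \<xi>)"
        by (rule Bochner_Integration.integral_diff[symmetric]) (fact gpsi Gpsi)+
      have "ennreal (norm ((LINT \<xi>|lborel. g \<xi> * ?\<psi> \<xi>) - (LINT \<xi>|lborel. ?G k \<xi> * ?\<psi> \<xi>)))
         \<le> (\<integral>\<^sup>+ \<xi>. norm (g \<xi> * ?\<psi> \<xi> - ?G k \<xi> * ?\<psi> \<xi>) \<partial>lborel)"
        unfolding diff by (rule integral_norm_bound_ennreal) (intro Bochner_Integration.integrable_diff gpsi Gpsi)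
      also have "\<dots> = (\<integral>\<^sup>+ \<xi>. ennreal (norm (g \<xi> - ?G k \<xi>)) * ennreal (heat_symbol t \<xi>) \<partial>lborel)"
      proof (rule nn_integral_cong)
        fix \<xi> :: "real^'n"
        have "norm (g \<xi> * ?\<psi> \<xi> - ?G k \<xi> * ?\<psi> \<xi>) = norm (g \<xi> - ?G k \<xi>) * heat_symbol t \<xi>"
          unfolding left_diff_distrib[symmetric] by (simp add: norm_mult)
        then show "ennreal (norm (g \<xi> * ?\<psi> \<xi> - ?G k \<xi> * ?\<psi> \<xi>))
            = ennreal (norm (g \<xi> - ?G k \<xi>)) * ennreal (heat_symbol t \<xi>)"
          by (simp only: ennreal_mult norm_ge_zero heat_symbol_nonneg)
      qed
      finally have "(ennreal (norm ((LINT \<xi>|lborel. g \<xi> * ?\<psi> \<xi>) - (LINT \<xi>|lborel. ?G k \<xi> * ?\<psi> \<xi>))))\<^sup>2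
        \<le> (\<integral>\<^sup>+ \<xi>. ennreal (norm (g \<xi> - ?G k \<xi>)) * ennreal (heat_symbol t \<xi>) \<partial>lborel)\<^sup>2"
        by (rule power_mono) simp
      also have "\<dots> \<le> (\<integral>\<^sup>+ \<xi>. (ennreal (norm (g \<xi> - ?G k \<xi>)))\<^sup>2 \<partial>lborel) * ?H"
        by (rule Cauchy_Schwarz_nn_integral) measurable
      finally show ?thesis by (simp add: ennreal_power)
    qed
    have "(\<lambda>k. (\<integral>\<^sup>+ \<xi>. ennreal ((norm (g \<xi> - ?G k \<xi>))\<^sup>2) \<partial>lborel) * ?H) \<longlonglongrightarrow> 0 * ?H"
      using H unfolding mult.commute[of _ ?H]
      by (intro ennreal_tendsto_cmult filterlim_compose[OF lim] filterlim_real_sequentially) auto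
    then show ?thesis
      unfolding mult_zero_left
      by (rule tendsto_of_square_ennreal) (use le in \<open>simp only: ennreal_power norm_ge_zero\<close>)
  qed
  moreover have "(LINT \<xi>|lborel. ?G k \<xi> * ?\<psi> \<xi>) = (LINT y|lborel. trunc (real k) f y * heat_kernel t (x - y))" for k
    by (rule multiplication_formula_integrable[OF integrable_trunc[OF f] t])
  ultimately show ?thesis by (simp only:) (rule LIMSEQ_unique)
qed

text \<open>At distance at least \<open>d\<close> the kernel at a small time is the kernel at time 1
  times a factor that does not depend on \<open>z\<close>. A function that is merely square
  integrable can thus be integrated over the far region against one fixed kernel.\<close>

lemma heat_kernel_tail:
  fixes z :: "real^'n::finite"
  assumes t: "0 < t" "t \<le> 1" and d: "0 \<le> d" "d \<le> norm z"
  shows "heat_kernel t z \<le> t powr (- (real CARD('n) / 2)) * exp (- (d\<^sup>2 / 4 * (1 / t - 1))) * heat_kernel 1 z"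
proof -
  have "0 \<le> ((norm z)\<^sup>2 - d\<^sup>2) / 4 * (1 / t - 1)"
    using assms by (intro mult_nonneg_nonneg) (auto intro!: power_mono)
  then have "- ((norm z)\<^sup>2 / (4 * t)) \<le> - (d\<^sup>2 / 4 * (1 / t - 1)) + - ((norm z)\<^sup>2 / 4)"
    using t by (simp add: field_simps)
  then have "exp (- ((norm z)\<^sup>2 / (4 * t))) \<le> exp (- (d\<^sup>2 / 4 * (1 / t - 1))) * exp (- ((norm z)\<^sup>2 / 4))"
    unfolding exp_add[symmetric] by (simp only: exp_le_cancel_iff)
  then have "(4 * pi * t) powr (- (real CARD('n) / 2)) * exp (- ((norm z)\<^sup>2 / (4 * t)))
      \<le> (4 * pi * t) powr (- (real CARD('n) / 2)) * (exp (- (d\<^sup>2 / 4 * (1 / t - 1))) * exp (- ((norm z)\<^sup>2 / 4)))"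
    by (intro mult_left_mono) auto
  then show ?thesis
    using t by (simp add: heat_kernel_eq powr_mult mult_ac)
qed

text \<open>Approximate identity at a point of continuity: near \<open>x\<close> continuity bounds
  the difference by e / 2, far from \<open>x\<close> the bound of \<open>heat_kernel_tail\<close> is
  used.\<close>

lemma heat_approximation:
  fixes f :: "real^'n::finite \<Rightarrow> complex"
  assumes f: "square_integrable f" and cont: "isCont f x"
  shows "(\<lambda>k. LINT y|lborel. f y * heat_kernel (1 / real (Suc k)) (x - y)) \<longlonglongrightarrow> f x"
proof (rule LIMSEQ_I)
  fix e :: real assume e: "0 < e"
  note [measurable] = square_integrableD(1)[OF f]
  obtain d where d: "d > 0" and fd: "\<And>y. norm (y - x) < d \<Longrightarrow> norm (f y - f x) < e / 2"
    using cont e unfolding isCont_def LIM_def dist_norm by (metis diff_self half_gt_zero norm_zero)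
  define t where "t k = 1 / real (Suc k)" for k
  have t: "0 < t k" "t k \<le> 1" for k by (auto simp: t_def)
  \<comment> \<open>The factor of \<open>heat_kernel_tail\<close> at time \<open>t k\<close>; it
    tends to 0 because the exponential in k outweighs the power of k.\<close>
  define a where "a k = t k powr (- (real CARD('n) / 2)) * exp (- (d\<^sup>2 / 4 * (1 / t k - 1)))" for k
  have int: "integrable lborel (\<lambda>y. (f y - f x) * heat_kernel s (x - y))" if "s > 0" for s
    using integrable_heat_kernel_diff[OF that, of x]
    by (simp only: left_diff_distrib)
       (intro Bochner_Integration.integrable_diff integrable_mult_heat_kernel[OF f that] integrable_mult_right
          integrable_of_real)
  have int': "integrable lborel (\<lambda>y. norm (f y - f x) * heat_kernel s (x - y))" if "s > 0" for s
    using integrable_norm[OF int[OF that]] by (simp add: norm_mult)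
  define M where "M = (LINT y|lborel. norm (f y - f x) * heat_kernel 1 (x - y))"
  have "(\<lambda>k. a k * M) \<longlonglongrightarrow> 0 * M"
  proof (intro tendsto_mult tendsto_const)
    have "(\<lambda>k::nat. (1 / real (Suc k)) powr (- (real CARD('n) / 2)) * exp (- (d\<^sup>2 / 4 * (1 / (1 / real (Suc k)) - 1)))) \<longlonglongrightarrow> 0"
      using d by real_asymp
    then show "a \<longlonglongrightarrow> 0" by (simp add: a_def[abs_def] t_def)
  qed
  then have "eventually (\<lambda>k. a k * M < e / 2) sequentially"
    using e by (intro order_tendstoD(2)[where a="e / 2"]) auto
  then obtain N where N: "\<And>k. k \<ge> N \<Longrightarrow> a k * M < e / 2"
    by (auto simp: eventually_sequentially)
  show "\<exists>no. \<forall>k\<ge>no. norm ((LINT y|lborel. f y * heat_kernel (1 / real (Suc k)) (x - y)) - f x) < e"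
  proof (intro exI allI impI)
    fix k assume k: "k \<ge> N"
    have "(LINT y|lborel. f y * heat_kernel (t k) (x - y)) - f x
        = (LINT y|lborel. f y * heat_kernel (t k) (x - y)) - (LINT y|lborel. f x * heat_kernel (t k) (x - y))"
      using integrable_heat_kernel_diff(2)[OF t(1), of k x] by simp
    also have "\<dots> = (LINT y|lborel. (f y - f x) * heat_kernel (t k) (x - y))"
      unfolding left_diff_distrib using integrable_heat_kernel_diff[OF t(1), of k x]
      by (intro Bochner_Integration.integral_diff[symmetric] integrable_mult_heat_kernel[OF f] t
           integrable_mult_right integrable_of_real)
    also have "norm \<dots> \<le> (LINT y|lborel. norm (f y - f x) * heat_kernel (t k) (x - y))"
      by (rule order_trans[OF integral_norm_bound]) (simp add: norm_mult)
    also have "\<dots> \<le> (LINT y|lborel. e / 2 * heat_kernel (t k) (x - y) + a k * (norm (f y - f x) * heat_kernel 1 (x - y)))"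
    proof (rule integral_mono)
      show "integrable lborel (\<lambda>y. e / 2 * heat_kernel (t k) (x - y) + a k * (norm (f y - f x) * heat_kernel 1 (x - y)))"
        by (intro Bochner_Integration.integrable_add integrable_mult_right integrable_heat_kernel_diff t int') simp
      fix y
      show "norm (f y - f x) * heat_kernel (t k) (x - y)
         \<le> e / 2 * heat_kernel (t k) (x - y) + a k * (norm (f y - f x) * heat_kernel 1 (x - y))"
      proof (cases "norm (y - x) < d")
        case True
        have "0 \<le> a k" by (simp add: a_def)
        from mult_nonneg_nonneg[OF this mult_nonneg_nonneg[OF norm_ge_zero[of "f y - f x"] heat_kernel_nonneg[of 1 "x - y"]]]
        show ?thesis
          using mult_right_mono[OF less_imp_le[OF fd[OF True]] heat_kernel_nonneg[of "t k" "x - y"]]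
          by linarith
      next
        case False
        then have "heat_kernel (t k) (x - y) \<le> a k * heat_kernel 1 (x - y)"
          unfolding a_def using t d by (intro heat_kernel_tail) (auto simp: norm_minus_commute)
        from mult_left_mono[OF this norm_ge_zero[of "f y - f x"]]
        moreover have "0 \<le> e / 2 * heat_kernel (t k) (x - y)" using e by simp
        ultimately show ?thesis by (simp add: mult_ac)
      qed
    qed (intro int' t)
    also have "\<dots> = e / 2 + a k * M"
      unfolding M_def
      by (subst Bochner_Integration.integral_add)
         (auto intro!: integrable_mult_right integrable_heat_kernel_diff t int' simp: integrable_heat_kernel_diff(2)[OF t(1)] simp del: integral_mult_right_zero integrable_mult_right_iff simp add: integral_mult_right_zero)
    also have "\<dots> < e" using N[OF k] by simp
    finally show "norm ((LINT y|lborel. f y * heat_kernel (1 / real (Suc k)) (x - y)) - f x) < e"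
      by (simp add: t_def)
  qed
qed

text \<open>The inversion integral is regularised by the heat symbol at time 1 / (k + 1). As k
  grows, the frequency side tends to the inversion integral, dominated by |g|, while by the
  multiplication formula the same numbers are heat averages of \<open>f\<close>, which tend to
  \<open>f x\<close>.\<close>

lemma fourier_inversion:
  fixes f :: "real^'n::finite \<Rightarrow> complex"
  assumes fg: "is_fourier_L2 f g" and g: "integrable lborel g" and cont: "isCont f x"
  shows "inverse_fourier_integral g x = f x"
proof -
  have f: "square_integrable f" using fg by (simp add: is_fourier_L2_def)
  have [measurable]: "g \<in> borel_measurable borel" using g by auto
  let ?t = "\<lambda>k. 1 / real (Suc k)"
  have "(\<lambda>k. LINT \<xi>|lborel. g \<xi> * (cis (2 * pi * (x \<bullet> \<xi>)) * heat_symbol (?t k) \<xi>))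
      \<longlonglongrightarrow> (LINT \<xi>|lborel. g \<xi> * (cis (2 * pi * (x \<bullet> \<xi>)) * of_real 1))"
  proof (rule integral_dominated_convergence[where w="\<lambda>\<xi>. norm (g \<xi>)"])
    show "AE \<xi> in lborel. (\<lambda>k. g \<xi> * (cis (2 * pi * (x \<bullet> \<xi>)) * complex_of_real (heat_symbol (?t k) \<xi>)))
        \<longlonglongrightarrow> g \<xi> * (cis (2 * pi * (x \<bullet> \<xi>)) * complex_of_real 1)"
    proof (intro AE_I2 tendsto_mult tendsto_const tendsto_of_real)
      fix \<xi> :: "real^'n"
      have "(\<lambda>k. exp (- (?t k * (2 * pi * norm \<xi>)\<^sup>2))) \<longlonglongrightarrow> exp (- (0 * (2 * pi * norm \<xi>)\<^sup>2))"
        by (intro tendsto_intros LIMSEQ_Suc[OF lim_1_over_n])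
      then show "(\<lambda>k. heat_symbol (?t k) \<xi>) \<longlonglongrightarrow> 1" by (simp add: heat_symbol_def)
    qed
    show "AE \<xi> in lborel. norm (g \<xi> * (cis (2 * pi * (x \<bullet> \<xi>)) * complex_of_real (heat_symbol (?t k) \<xi>))) \<le> norm (g \<xi>)" for k
      using heat_symbol_le_1[of "?t k"] by (intro AE_I2) (auto simp: norm_mult intro!: mult_left_le)
  qed (use g in auto)
  moreover have "(LINT \<xi>|lborel. g \<xi> * (cis (2 * pi * (x \<bullet> \<xi>)) * heat_symbol (?t k) \<xi>))
      = (LINT y|lborel. f y * heat_kernel (?t k) (x - y))" for k
    by (rule multiplication_formula[OF fg]) simp
  ultimately show ?thesis
    using LIMSEQ_unique[OF _ heat_approximation[OF f cont]]
    by (simp add: inverse_fourier_integral_def mult.commute)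
qed

section \<open>Linearity and uniqueness of the Plancherel transform\<close>

lemma norm_add_square_le: "(norm (a + b))\<^sup>2 \<le> 2 * (norm a)\<^sup>2 + 2 * (norm (b :: 'a::real_normed_vector))\<^sup>2"
proof -
  have "(norm (a + b))\<^sup>2 \<le> (norm a + norm b)\<^sup>2"
    by (intro power_mono norm_triangle_ineq norm_ge_zero)
  also have "\<dots> \<le> 2 * (norm a)\<^sup>2 + 2 * (norm b)\<^sup>2"
    using sum_squares_bound[of "norm a" "norm b"] by (simp add: power2_sum)
  finally show ?thesis .
qed

lemma square_integrable_lincomb:
  assumes "square_integrable f" "square_integrable g"
  shows "square_integrable (\<lambda>x. a * f x + b * g x)"
proof -
  note [measurable] = square_integrableD(1)[OF assms(1)] square_integrableD(1)[OF assms(2)]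
  have "integrable lborel (\<lambda>x. (norm (a * f x + b * g x))\<^sup>2)"
  proof (rule Bochner_Integration.integrable_bound)
    show "integrable lborel (\<lambda>x. 2 * (norm a)\<^sup>2 * (norm (f x))\<^sup>2 + 2 * (norm b)\<^sup>2 * (norm (g x))\<^sup>2)"
      using assms by (intro Bochner_Integration.integrable_add integrable_mult_right square_integrableD)
    show "AE x in lborel. norm ((norm (a * f x + b * g x))\<^sup>2) \<le> norm (2 * (norm a)\<^sup>2 * (norm (f x))\<^sup>2 + 2 * (norm b)\<^sup>2 * (norm (g x))\<^sup>2)"
      using norm_add_square_le[of "a * f _" "b * g _"] by (intro AE_I2) (auto simp: norm_mult power_mult_distrib mult.assoc)
  qed measurable
  then show ?thesis by (simp add: square_integrable_def)
qed

lemma nn_integral_norm_square_lincomb: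
  fixes u v :: "'a \<Rightarrow> complex"
  assumes [measurable]: "u \<in> borel_measurable M" "v \<in> borel_measurable M"
  shows "(\<integral>\<^sup>+ x. ennreal ((norm (a * u x + b * v x))\<^sup>2) \<partial>M)
    \<le> ennreal (2 * (norm a)\<^sup>2) * (\<integral>\<^sup>+ x. ennreal ((norm (u x))\<^sup>2) \<partial>M)
      + ennreal (2 * (norm b)\<^sup>2) * (\<integral>\<^sup>+ x. ennreal ((norm (v x))\<^sup>2) \<partial>M)"
proof -
  have "(\<integral>\<^sup>+ x. ennreal ((norm (a * u x + b * v x))\<^sup>2) \<partial>M)
     \<le> (\<integral>\<^sup>+ x. ennreal (2 * (norm a)\<^sup>2) * ennreal ((norm (u x))\<^sup>2) + ennreal (2 * (norm b)\<^sup>2) * ennreal ((norm (v x))\<^sup>2) \<partial>M)"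
    using norm_add_square_le[of "a * u _" "b * v _"]
    by (intro nn_integral_mono)
       (auto simp: norm_mult power_mult_distrib mult.assoc ennreal_mult[symmetric] ennreal_plus[symmetric] simp del: ennreal_plus)
  also have "\<dots> = ennreal (2 * (norm a)\<^sup>2) * (\<integral>\<^sup>+ x. ennreal ((norm (u x))\<^sup>2) \<partial>M)
      + ennreal (2 * (norm b)\<^sup>2) * (\<integral>\<^sup>+ x. ennreal ((norm (v x))\<^sup>2) \<partial>M)"
    by (simp add: nn_integral_add nn_integral_cmult)
  finally show ?thesis .
qed

lemma tendsto_ennreal_lincomb_0:
  fixes U V :: "real \<Rightarrow> ennreal"
  assumes "(U \<longlongrightarrow> 0) F" "(V \<longlongrightarrow> 0) F" and le: "\<And>R. X R \<le> ennreal a * U R + ennreal b * V R"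
  shows "(X \<longlongrightarrow> 0) F"
proof -
  have "((\<lambda>R. ennreal a * U R + ennreal b * V R) \<longlongrightarrow> ennreal a * 0 + ennreal b * 0) F"
    by (intro tendsto_add ennreal_tendsto_cmult assms) auto
  then show ?thesis
    unfolding mult_zero_right add_0_right by (rule tendsto_ennreal_0_le) (rule le)
qed

lemma is_fourier_L2_lincomb:
  assumes 1: "is_fourier_L2 f1 g1" and 2: "is_fourier_L2 f2 g2"
  shows "is_fourier_L2 (\<lambda>x. a * f1 x + b * f2 x) (\<lambda>\<xi>. a * g1 \<xi> + b * g2 \<xi>)"
proof -
  have sf: "square_integrable f1" "square_integrable f2" and sg: "square_integrable g1" "square_integrable g2"
    using 1 2 by (auto simp: is_fourier_L2_def)
  note [measurable] = sf[THEN square_integrableD(1)] sg[THEN square_integrableD(1)]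
  have F: "fourier_integral (trunc R (\<lambda>x. a * f1 x + b * f2 x)) \<xi>
      = a * fourier_integral (trunc R f1) \<xi> + b * fourier_integral (trunc R f2) \<xi>" for R \<xi>
  proof -
    have eq: "cis (- 2 * pi * (x \<bullet> \<xi>)) * trunc R (\<lambda>x. a * f1 x + b * f2 x) x
       = a * (cis (- 2 * pi * (x \<bullet> \<xi>)) * trunc R f1 x) + b * (cis (- 2 * pi * (x \<bullet> \<xi>)) * trunc R f2 x)" for x
      by (simp add: trunc_def algebra_simps)
    note int = integrable_mult_right[OF integrable_cis_mult[OF integrable_trunc]]
    show ?thesis
      unfolding fourier_integral_def eq
      by (subst Bochner_Integration.integral_add[OF int[OF sf(1)] int[OF sf(2)]])
         (simp only: integral_mult_right_zero)
  qed
  have "((\<lambda>R. \<integral>\<^sup>+ \<xi>. ennreal ((norm (a * g1 \<xi> + b * g2 \<xi> -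
       fourier_integral (trunc R (\<lambda>x. a * f1 x + b * f2 x)) \<xi>))\<^sup>2) \<partial>lborel) \<longlongrightarrow> 0) at_top"
  proof (rule tendsto_ennreal_lincomb_0)
    show "((\<lambda>R. \<integral>\<^sup>+ \<xi>. ennreal ((norm (g1 \<xi> - fourier_integral (trunc R f1) \<xi>))\<^sup>2) \<partial>lborel) \<longlongrightarrow> 0) at_top"
      "((\<lambda>R. \<integral>\<^sup>+ \<xi>. ennreal ((norm (g2 \<xi> - fourier_integral (trunc R f2) \<xi>))\<^sup>2) \<partial>lborel) \<longlongrightarrow> 0) at_top"
      using 1 2 by (auto simp: is_fourier_L2_trunc)
    show "(\<integral>\<^sup>+ \<xi>. ennreal ((norm (a * g1 \<xi> + b * g2 \<xi> - fourier_integral (trunc R (\<lambda>x. a * f1 x + b * f2 x)) \<xi>))\<^sup>2) \<partial>lborel)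
      \<le> ennreal (2 * (norm a)\<^sup>2) * (\<integral>\<^sup>+ \<xi>. ennreal ((norm (g1 \<xi> - fourier_integral (trunc R f1) \<xi>))\<^sup>2) \<partial>lborel)
       + ennreal (2 * (norm b)\<^sup>2) * (\<integral>\<^sup>+ \<xi>. ennreal ((norm (g2 \<xi> - fourier_integral (trunc R f2) \<xi>))\<^sup>2) \<partial>lborel)" for R
    proof -
      have "a * g1 \<xi> + b * g2 \<xi> - fourier_integral (trunc R (\<lambda>x. a * f1 x + b * f2 x)) \<xi>
         = a * (g1 \<xi> - fourier_integral (trunc R f1) \<xi>) + b * (g2 \<xi> - fourier_integral (trunc R f2) \<xi>)" for \<xi>
        by (simp add: F algebra_simps)
      then show ?thesis
        by (simp only:) (rule nn_integral_norm_square_lincomb; measurable)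
    qed
  qed
  then show ?thesis
    using square_integrable_lincomb[OF sf] square_integrable_lincomb[OF sg]
    by (simp add: is_fourier_L2_trunc)
qed

text \<open>Since \<open>fourier_L2\<close> is an arbitrary choice among representatives, every
  identity for it, linearity included, can hold only almost everywhere and is obtained through this
  uniqueness.\<close>

lemma is_fourier_L2_unique:
  assumes 1: "is_fourier_L2 f g1" and 2: "is_fourier_L2 f g2"
  shows "AE \<xi> in lborel. g1 \<xi> = g2 \<xi>"
proof -
  have sf: "square_integrable f" and sg: "square_integrable g1" "square_integrable g2"
    using 1 2 by (auto simp: is_fourier_L2_def)
  note [measurable] = sf[THEN square_integrableD(1)] sg[THEN square_integrableD(1)]
  have "((\<lambda>R::real. \<integral>\<^sup>+ \<xi>. ennreal ((norm (g1 \<xi> - g2 \<xi>))\<^sup>2) \<partial>lborel) \<longlongrightarrow> 0) at_top"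
  proof (rule tendsto_ennreal_lincomb_0)
    show "((\<lambda>R. \<integral>\<^sup>+ \<xi>. ennreal ((norm (g1 \<xi> - fourier_integral (trunc R f) \<xi>))\<^sup>2) \<partial>lborel) \<longlongrightarrow> 0) at_top"
      "((\<lambda>R. \<integral>\<^sup>+ \<xi>. ennreal ((norm (g2 \<xi> - fourier_integral (trunc R f) \<xi>))\<^sup>2) \<partial>lborel) \<longlongrightarrow> 0) at_top"
      using 1 2 by (auto simp: is_fourier_L2_trunc)
    show "(\<integral>\<^sup>+ \<xi>. ennreal ((norm (g1 \<xi> - g2 \<xi>))\<^sup>2) \<partial>lborel)
      \<le> ennreal (2 * (norm (1::complex))\<^sup>2) * (\<integral>\<^sup>+ \<xi>. ennreal ((norm (g1 \<xi> - fourier_integral (trunc R f) \<xi>))\<^sup>2) \<partial>lborel)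
       + ennreal (2 * (norm (-1::complex))\<^sup>2) * (\<integral>\<^sup>+ \<xi>. ennreal ((norm (g2 \<xi> - fourier_integral (trunc R f) \<xi>))\<^sup>2) \<partial>lborel)" for R
    proof -
      have "g1 \<xi> - g2 \<xi> = 1 * (g1 \<xi> - fourier_integral (trunc R f) \<xi>) + (-1) * (g2 \<xi> - fourier_integral (trunc R f) \<xi>)" for \<xi>
        by simp
      then show ?thesis
        by (simp only:) (rule nn_integral_norm_square_lincomb; measurable)
    qed
  qed
  then have "(\<integral>\<^sup>+ \<xi>. ennreal ((norm (g1 \<xi> - g2 \<xi>))\<^sup>2) \<partial>lborel) = 0"
    by (simp add: tendsto_const_iff)
  then show ?thesis by (subst (asm) nn_integral_0_iff_AE) auto
qed

section \<open>Weighted integrability of Sobolev functions\<close>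

text \<open>Bridge from gauge integrals of nonnegative functions, for which the power integrals are
  available, to Lebesgue integrals.\<close>

lemma set_lborel_of_has_integral:
  fixes f :: "'a::euclidean_space \<Rightarrow> real"
  assumes [measurable]: "f \<in> borel_measurable borel" "S \<in> sets borel"
    and nonneg: "\<And>x. x \<in> S \<Longrightarrow> 0 \<le> f x" and I: "(f has_integral I) S"
  shows "integrable lborel (\<lambda>x. indicator S x * f x)" "(LINT x|lborel. indicator S x * f x) = I"
proof -
  have "has_bochner_integral lborel (\<lambda>x. indicator S x * f x) I"
  proof (rule has_bochner_integral_nn_integral)
    show "AE x in lborel. 0 \<le> indicator S x * f x" using nonneg by (auto simp: indicator_def)
    show "0 \<le> I" using has_integral_nonneg[OF I nonneg] .
    show "(\<integral>\<^sup>+ x. ennreal (indicator S x * f x) \<partial>lborel) = ennreal I"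
      using nn_integral_has_integral_lebesgue[OF nonneg I] by simp
  qed measurable
  then show "integrable lborel (\<lambda>x. indicator S x * f x)" "(LINT x|lborel. indicator S x * f x) = I"
    by (auto simp: has_bochner_integral_iff)
qed

lemma integrable_powr_from_0:
  assumes "- 1 < (a::real)"
  shows "integrable lborel (\<lambda>x. indicator {0..1} x * x powr a)"
  by (rule set_lborel_of_has_integral(1)[OF _ _ _ has_integral_powr_from_0]) (use assms in auto)

lemma
  assumes "(a::real) < - 1" "c > 0"
  shows integrable_powr_to_inf: "integrable lborel (\<lambda>x. indicator {c..} x * x powr a)"
    and integral_powr_to_inf: "(LINT x|lborel. indicator {c..} x * x powr a) = - (c powr (a + 1)) / (a + 1)"
  by (rule set_lborel_of_has_integral[OF _ _ _ has_integral_powr_to_inf[OF assms]]; simp)+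

lemma integrable_singular_weight_real:
  assumes "0 \<le> a" "a < 1"
  shows "integrable lborel (\<lambda>x::real. \<bar>x\<bar> powr (- a) / (1 + x\<^sup>2))"
proof -
  define h where "h x = indicator {0..1} x * x powr (- a) + indicator {1..} x * x powr (- 2)" for x :: real
  have h: "integrable lborel h"
    unfolding h_def by (intro Bochner_Integration.integrable_add integrable_powr_from_0 integrable_powr_to_inf) (use assms in auto)
  have h0: "0 \<le> h x" for x by (simp add: h_def)
  have le: "\<bar>x\<bar> powr (- a) / (1 + x\<^sup>2) \<le> h \<bar>x\<bar>" for x
  proof (cases "\<bar>x\<bar> \<le> 1")
    case True
    have "\<bar>x\<bar> powr (- a) / (1 + x\<^sup>2) \<le> \<bar>x\<bar> powr (- a) / 1"
      by (intro divide_left_mono) (auto simp: add_pos_nonneg)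
    also have "\<dots> \<le> h \<bar>x\<bar>" using True by (auto simp: h_def)
    finally show ?thesis .
  next
    case False
    then have x: "\<bar>x\<bar> > 1" by simp
    have "\<bar>x\<bar> powr (- a) \<le> \<bar>x\<bar> powr 0"
      using x assms by (intro powr_mono) auto
    then have "\<bar>x\<bar> powr (- a) / (1 + x\<^sup>2) \<le> 1 / x\<^sup>2"
      using x by (intro frac_le) (auto split: if_splits)
    also have "1 / x\<^sup>2 = \<bar>x\<bar> powr (- 2)"
      using x by (simp add: powr_minus_divide)
    also have "\<dots> \<le> h \<bar>x\<bar>" using x by (auto simp: h_def)
    finally show ?thesis .
  qed
  have "integrable lborel (\<lambda>x. h x + h (0 + (-1) * x))"
    by (intro Bochner_Integration.integrable_add h lborel_integrable_real_affine) auto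
  then show ?thesis
  proof (rule Bochner_Integration.integrable_bound)
    show "AE x in lborel. norm (\<bar>x\<bar> powr (- a) / (1 + x\<^sup>2)) \<le> norm (h x + h (0 + (-1) * x))"
    proof (rule AE_I2)
      fix x :: real
      have "h \<bar>x\<bar> \<le> h x + h (- x)" using h0[of x] h0[of "- x"] by (auto simp: abs_if)
      then show "norm (\<bar>x\<bar> powr (- a) / (1 + x\<^sup>2)) \<le> norm (h x + h (0 + (-1) * x))"
        using le[of x] by (simp add: add_nonneg_nonneg[OF h0 h0])
    qed
  qed measurable
qed

lemma AE_component_nonzero: "AE \<xi>::real^'n::finite in lborel. \<xi> $ i \<noteq> 0"
proof -
  have [measurable]: "{\<xi>::real^'n. \<xi> $ i = 0} \<in> sets borel"
    by (intro borel_closed closed_Collect_eq continuous_intros)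
  have "negligible {\<xi>::real^'n. \<xi> \<bullet> axis i 1 = 0}"
    by (rule negligible_standard_hyperplane) (auto simp: Basis_vec_def)
  then have "{\<xi>::real^'n. \<xi> $ i = 0} \<in> null_sets lborel"
    by (simp add: inner_axis negligible_iff_null_sets null_sets_completion_iff)
  from AE_not_in[OF this] show ?thesis by simp
qed

text \<open>The singularity is shared equally among the coordinates: |\<xi>|^(-\<beta>) is a product
  of n factors |\<xi>|^(-\<beta>/n), each at most |\<xi>_i|^(-\<beta>/n), and the decay is treated
  in the same way. A product of integrable functions of one variable dominates, since \<beta>/n < 1,
  and polar coordinates are avoided.\<close>

lemma integrable_singular_weight:
  assumes "0 \<le> \<beta>" "\<beta> < real CARD('n)"
  shows "integrable lborel (\<lambda>\<xi>::real^'n::finite. norm \<xi> powr (- \<beta>) * (1 + (norm \<xi>)\<^sup>2) powr (- real CARD('n)))"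
proof -
  let ?n = "real CARD('n)"
  let ?F = "\<lambda>\<xi>::real^'n. \<Prod>i\<in>UNIV. \<bar>\<xi> $ i\<bar> powr (- (\<beta> / ?n)) / (1 + (\<xi> $ i)\<^sup>2)"
  have n: "?n > 0" by simp
  have "integrable lborel ?F"
    by (rule integrable_lborel_vec_prod, rule integrable_singular_weight_real) (use assms n in auto)
  then show ?thesis
  proof (rule Bochner_Integration.integrable_bound)
    \<comment> \<open>The comparison is made off the coordinate hyperplanes, because
      \<open>0 powr _\<close> is 0 and the product would vanish on them.\<close>
    have "AE \<xi>::real^'n in lborel. \<forall>i\<in>UNIV. \<xi> $ i \<noteq> 0"
      by (rule AE_finite_allI) (auto simp: AE_component_nonzero)
    then show "AE \<xi>::real^'n in lborel. norm (norm \<xi> powr (- \<beta>) * (1 + (norm \<xi>)\<^sup>2) powr (- ?n)) \<le> norm (?F \<xi>)"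
    proof eventually_elim
      case (elim \<xi>)
      have pos: "norm \<xi> > 0" using elim by (metis UNIV_I zero_index zero_less_norm_iff)
      have "(\<Prod>i\<in>(UNIV::'n set). norm \<xi> powr (- (\<beta> / ?n)) / (1 + (norm \<xi>)\<^sup>2)) \<le> ?F \<xi>"
      proof (rule prod_mono)
        fix i :: 'n
        have i: "0 < \<bar>\<xi> $ i\<bar>" "\<bar>\<xi> $ i\<bar> \<le> norm \<xi>" using elim component_le_norm_cart[of \<xi> i] by auto
        have "norm \<xi> powr (- (\<beta> / ?n)) / (1 + (norm \<xi>)\<^sup>2) \<le> \<bar>\<xi> $ i\<bar> powr (- (\<beta> / ?n)) / (1 + (\<xi> $ i)\<^sup>2)"
        proof (rule frac_le)
          show "norm \<xi> powr (- (\<beta> / ?n)) \<le> \<bar>\<xi> $ i\<bar> powr (- (\<beta> / ?n))"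
            using i assms by (intro powr_mono2') auto
          show "1 + (\<xi> $ i)\<^sup>2 \<le> 1 + (norm \<xi>)\<^sup>2"
            using i by (simp add: abs_le_square_iff[symmetric])
        qed (auto simp: add_pos_nonneg)
        then show "0 \<le> norm \<xi> powr (- (\<beta> / ?n)) / (1 + (norm \<xi>)\<^sup>2) \<and>
            norm \<xi> powr (- (\<beta> / ?n)) / (1 + (norm \<xi>)\<^sup>2) \<le> \<bar>\<xi> $ i\<bar> powr (- (\<beta> / ?n)) / (1 + (\<xi> $ i)\<^sup>2)"
          by simp
      qed
      also have "(\<Prod>i\<in>(UNIV::'n set). norm \<xi> powr (- (\<beta> / ?n)) / (1 + (norm \<xi>)\<^sup>2))
          = norm \<xi> powr (- \<beta>) * (1 + (norm \<xi>)\<^sup>2) powr (- ?n)"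
      proof -
        have "(norm \<xi> powr (- (\<beta> / ?n))) ^ CARD('n) = norm \<xi> powr (- \<beta>)"
          using pos n by (subst powr_realpow[symmetric]) (auto simp: powr_powr)
        moreover have "(1 + (norm \<xi>)\<^sup>2) ^ CARD('n) = (1 + (norm \<xi>)\<^sup>2) powr ?n"
          by (rule powr_realpow[symmetric]) (simp add: add_pos_nonneg)
        ultimately show ?thesis by (simp add: power_divide powr_minus divide_inverse power_mult_distrib power_inverse)
      qed
      finally show ?case by (simp add: prod_nonneg)
    qed
  qed measurable
qed

text \<open>Up to constants it dominates every symbol |\<xi>|^a with -\<beta> <= a <= 2: the first
  factor covers high frequencies, the second one the singularity at 0.\<close>

definition freq_weight :: "real \<Rightarrow> real^'n::finite \<Rightarrow> real" where
  "freq_weight \<beta> \<xi> = (1 + (norm \<xi>)\<^sup>2) * (1 + norm \<xi> powr (- \<beta>))"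

lemma freq_weight_measurable [measurable]: "freq_weight \<beta> \<in> borel_measurable borel"
  unfolding freq_weight_def[abs_def] by measurable

lemma freq_weight_ge_1: "1 \<le> freq_weight \<beta> \<xi>"
proof -
  have "1 * 1 \<le> freq_weight \<beta> \<xi>" unfolding freq_weight_def by (intro mult_mono) auto
  then show ?thesis by simp
qed

lemma freq_weight_nonneg [simp]: "0 \<le> freq_weight \<beta> \<xi>"
  using freq_weight_ge_1[of \<beta> \<xi>] by linarith

lemma freq_weight_ge: "1 + (norm \<xi>)\<^sup>2 \<le> freq_weight \<beta> \<xi>"
  unfolding freq_weight_def using mult_left_mono[of 1 "1 + norm \<xi> powr (- \<beta>)" "1 + (norm \<xi>)\<^sup>2"] by simp

text \<open>With q = 1 + |\<xi>|^2 the exponent (n + 2)/2 leaves exactly q^(-n) after multiplication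
  by q and squaring, and squaring doubles the order of the singularity; hence the condition on 2
  \<beta>.\<close>

lemma integrable_freq_weight_square:
  assumes "0 \<le> \<beta>" "2 * \<beta> < real CARD('n)"
  shows "integrable lborel (\<lambda>\<xi>::real^'n::finite.
    (freq_weight \<beta> \<xi> * (1 + (norm \<xi>)\<^sup>2) powr (- ((real CARD('n) + 2) / 2)))\<^sup>2)"
proof -
  let ?n = "real CARD('n)"
  let ?G = "\<lambda>b (\<xi>::real^'n). norm \<xi> powr (- b) * (1 + (norm \<xi>)\<^sup>2) powr (- ?n)"
  have "integrable lborel (\<lambda>\<xi>. 2 * ?G 0 \<xi> + 2 * ?G (2 * \<beta>) \<xi>)"
    by (intro Bochner_Integration.integrable_add integrable_mult_right integrable_singular_weight) (use assms in auto)
  then show ?thesis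
  proof (rule Bochner_Integration.integrable_bound)
    have "AE \<xi>::real^'n in lborel. \<xi> $ undefined \<noteq> 0" by (rule AE_component_nonzero)
    then show "AE \<xi>::real^'n in lborel. norm ((freq_weight \<beta> \<xi> * (1 + (norm \<xi>)\<^sup>2) powr (- ((?n + 2) / 2)))\<^sup>2)
        \<le> norm (2 * ?G 0 \<xi> + 2 * ?G (2 * \<beta>) \<xi>)"
    proof eventually_elim
      case (elim \<xi>)
      have pos: "norm \<xi> > 0" using elim by (metis zero_index zero_less_norm_iff)
      define q where "q = 1 + (norm \<xi>)\<^sup>2"
      have q: "q > 0" by (simp add: q_def add_pos_nonneg)
      have "(q * q powr (- ((?n + 2) / 2)))\<^sup>2 = q powr (- ?n)"
      proof -
        have "q * q powr (- ((?n + 2) / 2)) = q powr (- (?n / 2))"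
          using q powr_add[of q 1 "- ((?n + 2) / 2)"] by (simp add: add_divide_distrib)
        then show ?thesis using q by (simp add: power2_eq_square powr_add[symmetric])
      qed
      moreover have "(1 + norm \<xi> powr (- \<beta>))\<^sup>2 \<le> 2 + 2 * norm \<xi> powr (- (2 * \<beta>))"
      proof -
        have "(norm \<xi> powr (- \<beta>))\<^sup>2 = norm \<xi> powr (- (2 * \<beta>))"
          by (simp add: power2_eq_square powr_add[symmetric])
        then show ?thesis
          using sum_squares_bound[of 1 "norm \<xi> powr (- \<beta>)"] by (simp add: power2_sum)
      qed
      ultimately have "(q * q powr (- ((?n + 2) / 2)))\<^sup>2 * (1 + norm \<xi> powr (- \<beta>))\<^sup>2
         \<le> q powr (- ?n) * (2 + 2 * norm \<xi> powr (- (2 * \<beta>)))"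
        by (simp add: mult_left_mono)
      also have "(q * q powr (- ((?n + 2) / 2)))\<^sup>2 * (1 + norm \<xi> powr (- \<beta>))\<^sup>2
         = (freq_weight \<beta> \<xi> * (1 + (norm \<xi>)\<^sup>2) powr (- ((?n + 2) / 2)))\<^sup>2"
        by (simp only: freq_weight_def q_def power_mult_distrib mult_ac)
      also have "q powr (- ?n) * (2 + 2 * norm \<xi> powr (- (2 * \<beta>))) = 2 * ?G 0 \<xi> + 2 * ?G (2 * \<beta>) \<xi>"
        using pos by (simp add: q_def algebra_simps)
      finally show ?case
        unfolding real_norm_def abs_power2 by (rule order_trans[OF _ abs_ge_self])
    qed
  qed measurable
qed

text \<open>Cauchy-Schwarz after inserting q^(-s/2) q^(s/2) with q = 1 + |\<xi>|^2 and s = n + 2.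
  The constant is the L2 norm of the weighted first factor and so does not depend on
  \<open>h\<close>.\<close>

lemma freq_weight_bound:
  assumes "0 \<le> \<beta>" "2 * \<beta> < real CARD('n)"
  obtains K where "K \<ge> 0"
    "\<And>h :: real^'n::finite \<Rightarrow> complex. h \<in> borel_measurable borel \<Longrightarrow>
      integrable lborel (\<lambda>\<xi>. (1 + (norm \<xi>)\<^sup>2) powr (real CARD('n) + 2) * (norm (h \<xi>))\<^sup>2) \<Longrightarrow>
      integrable lborel (\<lambda>\<xi>. freq_weight \<beta> \<xi> * norm (h \<xi>)) \<and>
      (LINT \<xi>|lborel. freq_weight \<beta> \<xi> * norm (h \<xi>))
        \<le> K * sqrt (LINT \<xi>|lborel. (1 + (norm \<xi>)\<^sup>2) powr (real CARD('n) + 2) * (norm (h \<xi>))\<^sup>2)"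
proof
  let ?s = "real CARD('n) + 2"
  let ?a = "\<lambda>\<xi>::real^'n. freq_weight \<beta> \<xi> * (1 + (norm \<xi>)\<^sup>2) powr (- (?s / 2))"
  let ?K = "sqrt (LINT \<xi>|lborel. (?a \<xi>)\<^sup>2)"
  show "?K \<ge> 0" by simp
  fix h :: "real^'n \<Rightarrow> complex"
  assume [measurable]: "h \<in> borel_measurable borel"
    and h: "integrable lborel (\<lambda>\<xi>. (1 + (norm \<xi>)\<^sup>2) powr ?s * (norm (h \<xi>))\<^sup>2)"
  let ?b = "\<lambda>\<xi>. (1 + (norm \<xi>)\<^sup>2) powr (?s / 2) * norm (h \<xi>)"
  have q: "1 + (norm \<xi>)\<^sup>2 > 0" for \<xi> :: "real^'n" by (simp add: add_pos_nonneg)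
  have b2: "(?b \<xi>)\<^sup>2 = (1 + (norm \<xi>)\<^sup>2) powr ?s * (norm (h \<xi>))\<^sup>2" for \<xi>
    by (simp add: power_mult_distrib power2_eq_square powr_add[symmetric])
  have ab: "\<bar>?a \<xi> * ?b \<xi>\<bar> = freq_weight \<beta> \<xi> * norm (h \<xi>)" for \<xi>
  proof -
    have "(1 + (norm \<xi>)\<^sup>2) powr (- (?s / 2)) * (1 + (norm \<xi>)\<^sup>2) powr (?s / 2) = 1"
      using q[of \<xi>] by (simp only: powr_add[symmetric]) simp
    then have "?a \<xi> * ?b \<xi> = freq_weight \<beta> \<xi> * norm (h \<xi>)" by (simp add: mult_ac)
    then show ?thesis by (simp only: abs_of_nonneg mult_nonneg_nonneg freq_weight_nonneg norm_ge_zero)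
  qed
  have "integrable lborel (\<lambda>\<xi>. \<bar>?a \<xi> * ?b \<xi>\<bar>)"
    and "(LINT \<xi>|lborel. \<bar>?a \<xi> * ?b \<xi>\<bar>) \<le> ?K * sqrt (LINT \<xi>|lborel. (?b \<xi>)\<^sup>2)"
    by (rule Cauchy_Schwarz_integral;
        use integrable_freq_weight_square[OF assms] h in \<open>(simp only: b2; fail) | measurable\<close>)+
  then show "integrable lborel (\<lambda>\<xi>. freq_weight \<beta> \<xi> * norm (h \<xi>)) \<and>
      (LINT \<xi>|lborel. freq_weight \<beta> \<xi> * norm (h \<xi>))
        \<le> ?K * sqrt (LINT \<xi>|lborel. (1 + (norm \<xi>)\<^sup>2) powr ?s * (norm (h \<xi>))\<^sup>2)"
    unfolding ab b2 ..
qed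

text \<open>\<open>in_sobolev\<close> only provides some transform with finite weighted norm;
  uniqueness almost everywhere carries this over to the chosen representative
  \<open>fourier_L2 f\<close>.\<close>

lemma in_sobolevD:
  fixes f :: "real^'n::finite \<Rightarrow> real"
  assumes "in_sobolev s f"
  shows "is_fourier_L2 (\<lambda>x. complex_of_real (f x)) (fourier_L2 f)"
    and "integrable lborel (\<lambda>\<xi>. (1 + (norm \<xi>)\<^sup>2) powr s * (norm (fourier_L2 f \<xi>))\<^sup>2)"
proof -
  obtain g where g: "is_fourier_L2 (\<lambda>x. complex_of_real (f x)) g"
    and sq: "square_integrable (\<lambda>\<xi>. (1 + (norm \<xi>)\<^sup>2) powr (s / 2) *\<^sub>R g \<xi>)"
    using assms unfolding in_sobolev_def by blast
  show F: "is_fourier_L2 (\<lambda>x. complex_of_real (f x)) (fourier_L2 f)"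
    unfolding fourier_L2_def by (rule someI[of "is_fourier_L2 (\<lambda>x. complex_of_real (f x))", OF g])
  have [measurable]: "g \<in> borel_measurable borel" "fourier_L2 f \<in> borel_measurable borel"
    using g F by (auto simp: is_fourier_L2_def square_integrable_def)
  have eq: "(norm ((1 + (norm \<xi>)\<^sup>2) powr (s / 2) *\<^sub>R g \<xi>))\<^sup>2 = (1 + (norm \<xi>)\<^sup>2) powr s * (norm (g \<xi>))\<^sup>2" for \<xi>
    by (simp add: power_mult_distrib power2_eq_square powr_add[symmetric])
  have *: "integrable lborel (\<lambda>\<xi>. (1 + (norm \<xi>)\<^sup>2) powr s * (norm (g \<xi>))\<^sup>2)"
    using square_integrableD(2)[OF sq] unfolding eq .
  show "integrable lborel (\<lambda>\<xi>. (1 + (norm \<xi>)\<^sup>2) powr s * (norm (fourier_L2 f \<xi>))\<^sup>2)"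
    by (rule integrable_cong_AE_imp[OF *]; measurable?)
       (use is_fourier_L2_unique[OF F g] in \<open>auto elim!: eventually_mono\<close>)
qed

lemma fourier_L2_measurable:
  assumes "in_sobolev s f"
  shows "fourier_L2 f \<in> borel_measurable borel"
  using in_sobolevD(1)[OF assms] by (auto simp: is_fourier_L2_def square_integrable_def)

lemma
  fixes f1 f2 :: "real^'n::finite \<Rightarrow> real"
  assumes 1: "in_sobolev s f1" and 2: "in_sobolev s f2"
  shows in_sobolev_lincomb: "in_sobolev s (\<lambda>x. a * f1 x + b * f2 x)"
    and fourier_L2_lincomb: "AE \<xi> in lborel. fourier_L2 (\<lambda>x. a * f1 x + b * f2 x) \<xi> = a * fourier_L2 f1 \<xi> + b * fourier_L2 f2 \<xi>"
proof -
  let ?q = "\<lambda>\<xi>::real^'n. (1 + (norm \<xi>)\<^sup>2) powr (s / 2)"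
  have F: "is_fourier_L2 (\<lambda>x. complex_of_real (a * f1 x + b * f2 x)) (\<lambda>\<xi>. a * fourier_L2 f1 \<xi> + b * fourier_L2 f2 \<xi>)"
    using is_fourier_L2_lincomb[OF in_sobolevD(1)[OF 1] in_sobolevD(1)[OF 2], of a b] by simp
  have sq: "square_integrable (\<lambda>\<xi>. ?q \<xi> *\<^sub>R fourier_L2 f \<xi>)" if "in_sobolev s f" for f :: "real^'n \<Rightarrow> real"
  proof -
    note [measurable] = fourier_L2_measurable[OF that]
    have "(norm (?q \<xi> *\<^sub>R fourier_L2 f \<xi>))\<^sup>2 = (1 + (norm \<xi>)\<^sup>2) powr s * (norm (fourier_L2 f \<xi>))\<^sup>2" for \<xi>
      by (simp add: power_mult_distrib power2_eq_square powr_add[symmetric])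
    then show ?thesis
      unfolding square_integrable_def using in_sobolevD(2)[OF that] by simp
  qed
  have "?q \<xi> *\<^sub>R (a * fourier_L2 f1 \<xi> + b * fourier_L2 f2 \<xi>) = a * (?q \<xi> *\<^sub>R fourier_L2 f1 \<xi>) + b * (?q \<xi> *\<^sub>R fourier_L2 f2 \<xi>)" for \<xi>
    by (simp add: algebra_simps)
  then have "square_integrable (\<lambda>\<xi>. ?q \<xi> *\<^sub>R (a * fourier_L2 f1 \<xi> + b * fourier_L2 f2 \<xi>))"
    using square_integrable_lincomb[OF sq[OF 1] sq[OF 2], of a b] by simp
  with F show S: "in_sobolev s (\<lambda>x. a * f1 x + b * f2 x)"
    unfolding in_sobolev_def by blast
  show "AE \<xi> in lborel. fourier_L2 (\<lambda>x. a * f1 x + b * f2 x) \<xi> = a * fourier_L2 f1 \<xi> + b * fourier_L2 f2 \<xi>"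
    by (rule is_fourier_L2_unique[OF in_sobolevD(1)[OF S] F])
qed

definition freq_norm :: "real \<Rightarrow> (real^'n::finite \<Rightarrow> complex) \<Rightarrow> real" where
  "freq_norm \<beta> h = (LINT \<xi>|lborel. freq_weight \<beta> \<xi> * norm (h \<xi>))"

lemma freq_norm_sobolev:
  assumes "0 \<le> \<beta>" "2 * \<beta> < real CARD('n)"
  obtains K where "K \<ge> 0"
    "\<And>f :: real^'n::finite \<Rightarrow> real. in_sobolev (real CARD('n) + 2) f \<Longrightarrow>
      integrable lborel (\<lambda>\<xi>. freq_weight \<beta> \<xi> * norm (fourier_L2 f \<xi>)) \<and>
      freq_norm \<beta> (fourier_L2 f) \<le> K * sobolev_norm (real CARD('n) + 2) f"
proof -
  obtain K where K: "K \<ge> 0"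
    "\<And>h :: real^'n::finite \<Rightarrow> complex. h \<in> borel_measurable borel \<Longrightarrow>
      integrable lborel (\<lambda>\<xi>. (1 + (norm \<xi>)\<^sup>2) powr (real CARD('n) + 2) * (norm (h \<xi>))\<^sup>2) \<Longrightarrow>
      integrable lborel (\<lambda>\<xi>. freq_weight \<beta> \<xi> * norm (h \<xi>)) \<and>
      (LINT \<xi>|lborel. freq_weight \<beta> \<xi> * norm (h \<xi>))
        \<le> K * sqrt (LINT \<xi>|lborel. (1 + (norm \<xi>)\<^sup>2) powr (real CARD('n) + 2) * (norm (h \<xi>))\<^sup>2)"
    using freq_weight_bound[where 'n='n, OF assms] by blast
  show ?thesis
    by (rule that[OF K(1)])
       (use K(2)[OF fourier_L2_measurable in_sobolevD(2)] in \<open>auto simp: freq_norm_def sobolev_norm_def\<close>)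
qed

lemma freq_norm_nonneg: "0 \<le> freq_norm \<beta> h"
  unfolding freq_norm_def by (intro Bochner_Integration.integral_nonneg) simp

text \<open>Differentiability of the curve in H^(n + 2) at \<open>t\<close>, turned into a Lipschitz
  bound at that one time for the weighted L1 norm of the transforms. The constant may depend on
  \<open>t\<close>.\<close>

lemma freq_norm_C1_sobolev:
  fixes \<theta> :: "real \<Rightarrow> real^'n::finite \<Rightarrow> real"
  assumes \<beta>: "0 \<le> \<beta>" "2 * \<beta> < real CARD('n)" and C1: "C1_sobolev (real CARD('n) + 2) T \<theta>" and t: "t \<in> {0..T}"
  obtains L where "L \<ge> 0"
    "\<forall>\<^sub>F \<tau> in at t within {0..T}. freq_norm \<beta> (\<lambda>\<xi>. fourier_L2 (\<theta> \<tau>) \<xi> - fourier_L2 (\<theta> t) \<xi>) \<le> L * \<bar>\<tau> - t\<bar>"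
proof -
  let ?s = "real CARD('n) + 2"
  obtain \<theta>' where s: "\<And>\<tau>. \<tau> \<in> {0..T} \<Longrightarrow> in_sobolev ?s (\<theta> \<tau>)" and s': "in_sobolev ?s (\<theta>' t)"
    and lim: "((\<lambda>\<tau>. sobolev_norm ?s (\<lambda>x. (\<theta> \<tau> x - \<theta> t x) / (\<tau> - t) - \<theta>' t x)) \<longlongrightarrow> 0) (at t within {0..T})"
    using C1 t unfolding C1_sobolev_def by blast
  obtain K where K: "K \<ge> 0"
    "\<And>f :: real^'n::finite \<Rightarrow> real. in_sobolev ?s f \<Longrightarrow>
      integrable lborel (\<lambda>\<xi>. freq_weight \<beta> \<xi> * norm (fourier_L2 f \<xi>)) \<and>
      freq_norm \<beta> (fourier_L2 f) \<le> K * sobolev_norm ?s f"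
    using freq_norm_sobolev[where 'n='n, OF \<beta>] by blast
  \<comment> \<open>\<open>K\<close> accounts for the difference quotient minus the derivative,
    whose Sobolev norm is eventually below 1; the second summand accounts for the derivative
    itself.\<close>
  let ?L = "K + freq_norm \<beta> (fourier_L2 (\<theta>' t))"
  show ?thesis
  proof (rule that[of ?L])
    show "?L \<ge> 0" by (intro add_nonneg_nonneg K(1) freq_norm_nonneg)
    have "\<forall>\<^sub>F \<tau> in at t within {0..T}. sobolev_norm ?s (\<lambda>x. (\<theta> \<tau> x - \<theta> t x) / (\<tau> - t) - \<theta>' t x) < 1"
      by (rule order_tendstoD(2)[OF lim]) simp
    moreover have "\<forall>\<^sub>F \<tau> in at t within {0..T}. \<tau> \<in> {0..T} \<and> \<tau> \<noteq> t"
      by (simp add: eventually_at_filter)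
    ultimately show "\<forall>\<^sub>F \<tau> in at t within {0..T}. freq_norm \<beta> (\<lambda>\<xi>. fourier_L2 (\<theta> \<tau>) \<xi> - fourier_L2 (\<theta> t) \<xi>) \<le> ?L * \<bar>\<tau> - t\<bar>"
    proof eventually_elim
      case (elim \<tau>)
      define q where "q = (\<lambda>x. (\<theta> \<tau> x - \<theta> t x) / (\<tau> - t) - \<theta>' t x)"
      define d where "d = (\<lambda>x. 1 / (\<tau> - t) * \<theta> \<tau> x + (- 1 / (\<tau> - t)) * \<theta> t x)"
      have sd: "in_sobolev ?s d"
        unfolding d_def by (rule in_sobolev_lincomb) (use s t elim in auto)
      have q_eq: "q = (\<lambda>x. 1 * d x + (- 1) * \<theta>' t x)"
        by (simp add: q_def d_def diff_divide_distrib)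
      have sq: "in_sobolev ?s q"
        unfolding q_eq by (rule in_sobolev_lincomb[OF sd s'])
      have "AE \<xi> in lborel. fourier_L2 q \<xi> = fourier_L2 d \<xi> - fourier_L2 (\<theta>' t) \<xi>"
        using fourier_L2_lincomb[OF sd s', of 1 "-1"] unfolding q_eq by simp
      moreover have "AE \<xi> in lborel. fourier_L2 d \<xi> = (fourier_L2 (\<theta> \<tau>) \<xi> - fourier_L2 (\<theta> t) \<xi>) / complex_of_real (\<tau> - t)"
        using fourier_L2_lincomb[OF s[of \<tau>] s[of t], of "1 / (\<tau> - t)" "- 1 / (\<tau> - t)"] elim t
        unfolding d_def by (simp add: diff_divide_distrib)
      ultimately have ae: "AE \<xi> in lborel. fourier_L2 (\<theta> \<tau>) \<xi> - fourier_L2 (\<theta> t) \<xi>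
          = complex_of_real (\<tau> - t) * (fourier_L2 q \<xi> + fourier_L2 (\<theta>' t) \<xi>)"
        by eventually_elim (use elim in simp)
      note [measurable] = fourier_L2_measurable[OF sq] fourier_L2_measurable[OF s']
      have [measurable]: "fourier_L2 (\<theta> \<tau>) \<in> borel_measurable borel" "fourier_L2 (\<theta> t) \<in> borel_measurable borel"
        by (rule fourier_L2_measurable[OF s], use elim t in simp)+
      have "freq_norm \<beta> (\<lambda>\<xi>. fourier_L2 (\<theta> \<tau>) \<xi> - fourier_L2 (\<theta> t) \<xi>)
         \<le> (LINT \<xi>|lborel. \<bar>\<tau> - t\<bar> * (freq_weight \<beta> \<xi> * norm (fourier_L2 q \<xi>) + freq_weight \<beta> \<xi> * norm (fourier_L2 (\<theta>' t) \<xi>)))"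
        unfolding freq_norm_def
      proof (rule integral_mono_AE)
        have le: "AE \<xi> in lborel. freq_weight \<beta> \<xi> * norm (fourier_L2 (\<theta> \<tau>) \<xi> - fourier_L2 (\<theta> t) \<xi>)
          \<le> \<bar>\<tau> - t\<bar> * (freq_weight \<beta> \<xi> * norm (fourier_L2 q \<xi>) + freq_weight \<beta> \<xi> * norm (fourier_L2 (\<theta>' t) \<xi>))"
          using ae
        proof eventually_elim
          case (elim \<xi>)
          have "norm (fourier_L2 (\<theta> \<tau>) \<xi> - fourier_L2 (\<theta> t) \<xi>) \<le> \<bar>\<tau> - t\<bar> * (norm (fourier_L2 q \<xi>) + norm (fourier_L2 (\<theta>' t) \<xi>))"
            unfolding elim norm_mult norm_of_real by (intro mult_left_mono norm_triangle_ineq) simp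
          from mult_left_mono[OF this freq_weight_nonneg[of \<beta> \<xi>]]
          show ?case by (simp add: algebra_simps)
        qed
        then show "AE \<xi> in lborel. freq_weight \<beta> \<xi> * norm (fourier_L2 (\<theta> \<tau>) \<xi> - fourier_L2 (\<theta> t) \<xi>)
          \<le> \<bar>\<tau> - t\<bar> * (freq_weight \<beta> \<xi> * norm (fourier_L2 q \<xi>) + freq_weight \<beta> \<xi> * norm (fourier_L2 (\<theta>' t) \<xi>))" .
        show int: "integrable lborel (\<lambda>\<xi>. \<bar>\<tau> - t\<bar> * (freq_weight \<beta> \<xi> * norm (fourier_L2 q \<xi>) + freq_weight \<beta> \<xi> * norm (fourier_L2 (\<theta>' t) \<xi>)))"
          using K(2)[OF sq] K(2)[OF s'] by (intro integrable_mult_right Bochner_Integration.integrable_add) auto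
        show "integrable lborel (\<lambda>\<xi>. freq_weight \<beta> \<xi> * norm (fourier_L2 (\<theta> \<tau>) \<xi> - fourier_L2 (\<theta> t) \<xi>))"
        proof (rule Bochner_Integration.integrable_bound[OF int])
          show "AE \<xi> in lborel. norm (freq_weight \<beta> \<xi> * norm (fourier_L2 (\<theta> \<tau>) \<xi> - fourier_L2 (\<theta> t) \<xi>))
          \<le> norm (\<bar>\<tau> - t\<bar> * (freq_weight \<beta> \<xi> * norm (fourier_L2 q \<xi>) + freq_weight \<beta> \<xi> * norm (fourier_L2 (\<theta>' t) \<xi>)))"
            using le by eventually_elim (simp add: abs_mult)
        qed measurable
      qed
      also have "\<dots> = \<bar>\<tau> - t\<bar> * (freq_norm \<beta> (fourier_L2 q) + freq_norm \<beta> (fourier_L2 (\<theta>' t)))"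
        unfolding freq_norm_def integral_mult_right_zero
        using K(2)[OF sq] K(2)[OF s'] by (subst Bochner_Integration.integral_add) auto
      also have "\<dots> \<le> \<bar>\<tau> - t\<bar> * ?L"
      proof (intro mult_left_mono add_right_mono)
        have "freq_norm \<beta> (fourier_L2 q) \<le> K * sobolev_norm ?s q" using K(2)[OF sq] by blast
        also have "\<dots> \<le> K * 1"
          using elim K(1) by (intro mult_left_mono) (auto simp: q_def)
        finally show "freq_norm \<beta> (fourier_L2 q) \<le> K" by simp
      qed simp
      finally show ?case by (simp add: mult.commute)
    qed
  qed
qed

section \<open>Functions with weighted integrable Fourier transform\<close>

lemma norm_cis_diff_le: "norm (cis a - cis b) \<le> \<bar>a - b\<bar>"
proof -
  have "norm (cis (a - b) - 1) \<le> \<bar>a - b\<bar>"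
    using iexp_approx1[of "a - b" 0] by (simp add: cis_conv_exp)
  moreover have "cis a - cis b = cis b * (cis (a - b) - 1)"
    by (simp add: right_diff_distrib cis_mult)
  ultimately show ?thesis by (simp add: norm_mult)
qed

lemma inverse_fourier_integral_measurable [measurable]:
  assumes [measurable]: "f \<in> borel_measurable borel"
  shows "inverse_fourier_integral f \<in> borel_measurable borel"
  unfolding inverse_fourier_integral_def[abs_def] by measurable

lemma norm_inverse_fourier_integral_le:
  "norm (inverse_fourier_integral f x) \<le> (LINT \<xi>|lborel. norm (f \<xi>))"
  unfolding inverse_fourier_integral_def
  by (rule order_trans[OF integral_norm_bound]) (simp add: norm_mult)

text \<open>The exponential kernel is symmetric in its two variables, so by Fubini the same inverse
  transform appears on both sides, with no conjugate. It replaces the Parseval identity for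
  functions that are only integrable.\<close>

lemma inverse_fourier_integral_duality:
  fixes a b :: "real^'n::finite \<Rightarrow> complex"
  assumes a: "integrable lborel a" and b: "integrable lborel b"
  shows "(LINT x|lborel. b x * inverse_fourier_integral a x) = (LINT \<xi>|lborel. a \<xi> * inverse_fourier_integral b \<xi>)"
proof -
  have [measurable]: "a \<in> borel_measurable borel" "b \<in> borel_measurable borel" using a b by auto
  let ?K = "\<lambda>x \<xi>. b x * (cis (2 * pi * (x \<bullet> \<xi>)) * a \<xi>)"
  have "integrable (lborel \<Otimes>\<^sub>M lborel) (case_prod ?K)"
    by (rule integrable_pair_dominated[OF integrable_norm[OF b] integrable_norm[OF a]]) (auto simp: norm_mult)
  then have fub: "(LINT \<xi>|lborel. (LINT x|lborel. ?K x \<xi>)) = (LINT x|lborel. (LINT \<xi>|lborel. ?K x \<xi>))"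
    by (rule lborel_pair.Fubini_integral)
  have e1: "(LINT \<xi>|lborel. ?K x \<xi>) = b x * inverse_fourier_integral a x" for x
    unfolding inverse_fourier_integral_def by (rule integral_mult_right_zero)
  have e2: "(LINT x|lborel. ?K x \<xi>) = a \<xi> * inverse_fourier_integral b \<xi>" for \<xi>
  proof -
    have "?K x \<xi> = a \<xi> * (cis (2 * pi * (\<xi> \<bullet> x)) * b x)" for x by (simp add: inner_commute)
    then show ?thesis unfolding inverse_fourier_integral_def by (simp only: integral_mult_right_zero)
  qed
  show ?thesis using fub unfolding e1 e2 ..
qed

text \<open>The square makes the truncation C^1 across the level, while for l > 0 it stays bounded
  by z^2 and vanishes for z <= l. Its integral therefore measures a superlevel set and is finite for
  square integrable functions.\<close>

definition excess :: "real \<Rightarrow> real \<Rightarrow> real" where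
  "excess l z = (max 0 (z - l))\<^sup>2"

lemma excess_nonneg [simp]: "0 \<le> excess l z"
  by (simp add: excess_def)

lemma excess_eq_0_iff: "excess l z = 0 \<longleftrightarrow> z \<le> l"
  by (auto simp: excess_def)

lemma excess_le_square: "0 \<le> l \<Longrightarrow> excess l z \<le> z\<^sup>2"
  unfolding excess_def by (rule abs_le_square_iff[THEN iffD1]) auto

lemma excess_mono: "l \<le> m \<Longrightarrow> excess m z \<le> excess l z"
  unfolding excess_def by (intro power_mono) auto

lemma excess_ge: "l + d \<le> z \<Longrightarrow> 0 \<le> d \<Longrightarrow> d\<^sup>2 \<le> excess l z"
  unfolding excess_def by (intro power_mono) auto

lemma excess_diff_le:
  assumes "0 \<le> l" "\<bar>a\<bar> \<le> M" "\<bar>b\<bar> \<le> M"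
  shows "\<bar>excess l a - excess l b\<bar> \<le> 2 * M * \<bar>a - b\<bar>"
proof -
  let ?p = "max 0 (a - l)" and ?q = "max 0 (b - l)"
  have "\<bar>excess l a - excess l b\<bar> = (?p + ?q) * \<bar>?p - ?q\<bar>"
    by (simp add: excess_def power2_eq_square square_diff_square_factored abs_mult)
  also have "\<dots> \<le> (2 * M) * \<bar>a - b\<bar>"
    using assms by (intro mult_mono) auto
  finally show ?thesis .
qed

text \<open>The first-order Taylor remainder is at most \<open>h\<^sup>2\<close>, also for steps
  that cross the level \<open>l\<close>, where no second derivative exists.\<close>

lemma DERIV_excess: "(excess l has_real_derivative 2 * max 0 (z - l)) (at z)"
proof -
  have "\<bar>(excess l (z + h) - excess l z) / h - 2 * max 0 (z - l)\<bar> \<le> \<bar>h\<bar>" if "h \<noteq> 0" for h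
  proof -
    let ?p = "max 0 (z + h - l)" and ?q = "max 0 (z - l)"
    have "\<bar>excess l (z + h) - excess l z - 2 * ?q * h\<bar> \<le> h\<^sup>2"
    proof (cases "z \<le> l"; cases "z + h \<le> l")
      assume "z \<le> l" "\<not> z + h \<le> l"
      then show ?thesis by (auto simp: excess_def max_def intro!: power_mono)
    next
      assume a: "\<not> z \<le> l" "z + h \<le> l"
      then have "excess l (z + h) - excess l z - 2 * ?q * h = - (z - l) * (z - l + 2 * h)"
        by (simp add: excess_def power2_eq_square algebra_simps)
      moreover have "\<bar>- (z - l) * (z - l + 2 * h)\<bar> \<le> \<bar>h\<bar> * \<bar>h\<bar>"
      proof -
        have "(z - l) * (z - l + 2 * h) = (z - l + h)\<^sup>2 - h\<^sup>2"
          by (simp add: power2_eq_square algebra_simps)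
        moreover have "(z - l + h)\<^sup>2 \<le> h\<^sup>2"
          using a by (intro abs_le_square_iff[THEN iffD1]) auto
        ultimately have "\<bar>(z - l) * (z - l + 2 * h)\<bar> \<le> h\<^sup>2"
          using zero_le_power2[of "z - l + h"] by linarith
        then show ?thesis by (simp add: abs_mult power2_eq_square abs_minus_commute)
      qed
      ultimately show ?thesis by (simp add: power2_eq_square)
    next
      assume "\<not> z \<le> l" "\<not> z + h \<le> l"
      then have "excess l (z + h) - excess l z - 2 * ?q * h = h\<^sup>2"
        by (simp add: excess_def power2_eq_square algebra_simps)
      then show ?thesis by simp
    qed (simp add: excess_def)
    then have "\<bar>excess l (z + h) - excess l z - 2 * ?q * h\<bar> / \<bar>h\<bar> \<le> h\<^sup>2 / \<bar>h\<bar>"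
      by (rule divide_right_mono) simp
    moreover have "(excess l (z + h) - excess l z) / h - 2 * ?q = (excess l (z + h) - excess l z - 2 * ?q * h) / h"
      using that by (simp add: diff_divide_distrib)
    moreover have "h\<^sup>2 / \<bar>h\<bar> = \<bar>h\<bar>" using that by (simp add: power2_eq_square abs_if)
    ultimately show ?thesis by simp
  qed
  then have "((\<lambda>h. (excess l (z + h) - excess l z) / h - 2 * max 0 (z - l)) \<longlongrightarrow> 0) (at 0)"
    by (intro Lim_null_comparison[OF _ tendsto_rabs_zero[OF tendsto_ident_at]])
       (auto simp: eventually_at_filter)
  then show ?thesis by (simp add: DERIV_def LIM_zero_iff)
qed

lemma excess_measurable [measurable]: "excess l \<in> borel_measurable borel"
  unfolding excess_def[abs_def] by measurable

text \<open>One time slice with a representative of its transform. Sobolev functions are given here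
  as arbitrary Borel representatives; continuity is what makes Fourier inversion, and all bounds
  drawn from it, valid at every point.\<close>

locale fourier_profile =
  fixes f :: "real^'n::finite \<Rightarrow> real" and g :: "real^'n \<Rightarrow> complex" and \<beta> :: real
  assumes fg: "is_fourier_L2 (\<lambda>x. complex_of_real (f x)) g"
    and int_weight_g: "integrable lborel (\<lambda>\<xi>. freq_weight \<beta> \<xi> * norm (g \<xi>))"
    and cont: "\<And>x. isCont f x"
begin

lemma measurable_f [measurable]: "f \<in> borel_measurable borel"
  using cont by (intro borel_measurable_continuous_onI) (simp add: continuous_on_eq_continuous_at)

lemma measurable_g [measurable]: "g \<in> borel_measurable borel"
  using fg by (auto simp: is_fourier_L2_def square_integrable_def)

lemma integrable_f_square: "integrable lborel (\<lambda>x. (f x)\<^sup>2)"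
  using fg by (auto simp: is_fourier_L2_def square_integrable_def)

text \<open>Any operator whose symbol is dominated by the weight can be applied to the profile, at
  the cost of the constant \<open>C\<close>; the sup bound, the Lipschitz bound, the velocity and
  the dissipation are all instances.\<close>

lemma
  fixes m :: "real^'n \<Rightarrow> complex"
  assumes [measurable]: "m \<in> borel_measurable borel" and m: "\<And>\<xi>. norm (m \<xi>) \<le> C * freq_weight \<beta> \<xi>"
  shows integrable_multiplier: "integrable lborel (\<lambda>\<xi>. m \<xi> * g \<xi>)"
    and integral_multiplier_le: "(LINT \<xi>|lborel. norm (m \<xi> * g \<xi>)) \<le> C * freq_norm \<beta> g"
proof -
  have le: "norm (m \<xi> * g \<xi>) \<le> C * (freq_weight \<beta> \<xi> * norm (g \<xi>))" for \<xi>
    using mult_right_mono[OF m[of \<xi>] norm_ge_zero[of "g \<xi>"]] by (simp add: norm_mult)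
  have int: "integrable lborel (\<lambda>\<xi>. C * (freq_weight \<beta> \<xi> * norm (g \<xi>)))"
    by (rule integrable_mult_right[OF int_weight_g])
  show *: "integrable lborel (\<lambda>\<xi>. m \<xi> * g \<xi>)"
    by (rule Bochner_Integration.integrable_bound[OF int]) (auto intro: order_trans[OF le abs_ge_self])
  have "(LINT \<xi>|lborel. norm (m \<xi> * g \<xi>)) \<le> (LINT \<xi>|lborel. C * (freq_weight \<beta> \<xi> * norm (g \<xi>)))"
    by (rule integral_mono[OF integrable_norm[OF *] int le])
  then show "(LINT \<xi>|lborel. norm (m \<xi> * g \<xi>)) \<le> C * freq_norm \<beta> g"
    by (simp add: freq_norm_def)
qed

lemma integrable_g: "integrable lborel g"
  using integrable_multiplier[of "\<lambda>_. 1" 1] by (simp add: freq_weight_ge_1)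

lemma inversion: "inverse_fourier_integral g x = complex_of_real (f x)"
  by (rule fourier_inversion[OF fg integrable_g]) (intro isCont_of_real cont)

lemma bounded_f: "\<bar>f x\<bar> \<le> freq_norm \<beta> g"
  using norm_inverse_fourier_integral_le[of g x] integral_multiplier_le[of "\<lambda>_. 1" 1]
  by (simp add: inversion freq_weight_ge_1)

lemma lipschitz_f: "\<bar>f x - f y\<bar> \<le> 2 * pi * freq_norm \<beta> g * norm (x - y)"
proof -
  let ?m = "\<lambda>\<xi>. cis (2 * pi * (x \<bullet> \<xi>)) - cis (2 * pi * (y \<bullet> \<xi>))"
  have "complex_of_real (f x - f y) = (LINT \<xi>|lborel. ?m \<xi> * g \<xi>)"
    unfolding of_real_diff inversion[symmetric] inverse_fourier_integral_def left_diff_distrib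
    by (rule Bochner_Integration.integral_diff[symmetric]) (intro integrable_cis_mult' integrable_g)+
  then have "\<bar>f x - f y\<bar> = norm (LINT \<xi>|lborel. ?m \<xi> * g \<xi>)"
    by (metis norm_of_real)
  also have "\<dots> \<le> (LINT \<xi>|lborel. norm (?m \<xi> * g \<xi>))"
    by (rule integral_norm_bound)
  also have "\<dots> \<le> (2 * pi * norm (x - y)) * freq_norm \<beta> g"
  proof (rule integral_multiplier_le)
    fix \<xi> :: "real^'n"
    have "norm (?m \<xi>) \<le> \<bar>2 * pi * (x \<bullet> \<xi>) - 2 * pi * (y \<bullet> \<xi>)\<bar>" by (rule norm_cis_diff_le)
    also have "\<dots> = 2 * pi * \<bar>(x - y) \<bullet> \<xi>\<bar>" by (simp add: inner_diff_left abs_mult right_diff_distrib[symmetric])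
    also have "\<dots> \<le> 2 * pi * (norm (x - y) * norm \<xi>)"
      by (intro mult_left_mono Cauchy_Schwarz_ineq2) simp
    also have "\<dots> \<le> 2 * pi * (norm (x - y) * freq_weight \<beta> \<xi>)"
    proof (intro mult_left_mono)
      have "2 * norm \<xi> \<le> 1 + (norm \<xi>)\<^sup>2" using sum_squares_bound[of 1 "norm \<xi>"] by simp
      then show "norm \<xi> \<le> freq_weight \<beta> \<xi>" using freq_weight_ge[of \<xi> \<beta>] norm_ge_zero[of \<xi>] by linarith
    qed auto
    finally show "norm (?m \<xi>) \<le> 2 * pi * norm (x - y) * freq_weight \<beta> \<xi>" by simp
  qed measurable
  finally show ?thesis by (simp add: mult_ac)
qed

lemma integrable_superlevel:
  assumes "0 < c"
  shows "integrable lborel (\<lambda>x. indicator {x. c < f x} x :: real)"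
proof -
  have "integrable lborel (\<lambda>x. (f x)\<^sup>2 / c\<^sup>2)"
    by (intro integrable_divide integrable_f_square)
  then show "integrable lborel (\<lambda>x. indicator {x. c < f x} x :: real)"
  proof (rule Bochner_Integration.integrable_bound)
    show "AE x in lborel. norm (indicator {x. c < f x} x :: real) \<le> norm ((f x)\<^sup>2 / c\<^sup>2)"
      using assms by (intro AE_I2) (auto simp: indicator_def intro!: power_mono less_imp_le)
  qed measurable
qed

lemma integrable_excess: "0 < l \<Longrightarrow> integrable lborel (\<lambda>x. excess l (f x))"
  by (rule Bochner_Integration.integrable_bound[OF integrable_f_square]) (auto simp: excess_le_square)

text \<open>Chebyshev: where \<open>f\<close> exceeds \<open>m\<close>, the integrand
  \<open>excess l\<close> is at least (m - l)^2.\<close>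

lemma measure_superlevel_le:
  assumes "0 < l" "l < m"
  shows "measure lborel {x. m < f x} \<le> (LINT x|lborel. excess l (f x)) / (m - l)\<^sup>2"
proof -
  have "measure lborel {x. m < f x} = (LINT x|lborel. indicator {x. m < f x} x)"
    by simp
  also have "\<dots> \<le> (LINT x|lborel. excess l (f x) / (m - l)\<^sup>2)"
  proof (rule integral_mono)
    show "integrable lborel (\<lambda>x. indicator {x. m < f x} x :: real)"
      by (rule integrable_superlevel) (use assms in auto)
    show "integrable lborel (\<lambda>x. excess l (f x) / (m - l)\<^sup>2)"
      using assms by (intro integrable_divide integrable_excess)
    show "indicator {x. m < f x} x \<le> excess l (f x) / (m - l)\<^sup>2" for x
      using assms excess_ge[of l "m - l" "f x"] by (auto simp: indicator_def field_simps)
  qed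
  finally show ?thesis by simp
qed

end

section \<open>Gradients of truncated squares on the Fourier side\<close>

lemma cis_difference_quotient:
  fixes h :: "nat \<Rightarrow> real"
  assumes h: "h \<longlonglongrightarrow> 0" "\<And>k. h k \<noteq> 0"
  shows "(\<lambda>k. (cis (c * h k) - 1) / h k) \<longlonglongrightarrow> \<i> * c"
proof -
  have "((\<lambda>z::complex. exp (\<i> * c * z)) has_field_derivative \<i> * c) (at 0)"
    by (auto intro!: derivative_eq_intros)
  then have "((\<lambda>z::complex. (exp (\<i> * c * z) - 1) / z) \<longlongrightarrow> \<i> * c) (at 0)"
    by (simp add: DERIV_def)
  moreover have "filterlim (\<lambda>k. complex_of_real (h k)) (at 0) sequentially"
    using h tendsto_of_real[OF h(1), where 'a=complex] by (auto simp: filterlim_at)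
  ultimately have "(\<lambda>k. (exp (\<i> * c * complex_of_real (h k)) - 1) / complex_of_real (h k)) \<longlonglongrightarrow> \<i> * c"
    by (rule filterlim_compose)
  then show ?thesis by (simp add: cis_conv_exp mult.assoc)
qed

lemma GDERIV_direction_tendsto:
  assumes G: "GDERIV f x :> D" and h: "h \<longlonglongrightarrow> 0" "\<And>k. h k \<noteq> 0"
  shows "(\<lambda>k. (f (x + h k *\<^sub>R e) - f x) / h k) \<longlonglongrightarrow> e \<bullet> D"
proof -
  have "((\<lambda>s. x + s *\<^sub>R e) has_derivative (\<lambda>s. s *\<^sub>R e)) (at 0)"
    by (auto intro!: derivative_eq_intros)
  moreover have "(f has_derivative (\<lambda>v. v \<bullet> D)) (at (x + 0 *\<^sub>R e))"
    using G by (simp add: gderiv_def)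
  ultimately have "((\<lambda>s. f (x + s *\<^sub>R e)) has_derivative (\<lambda>s. (s *\<^sub>R e) \<bullet> D)) (at 0)"
    by (rule has_derivative_compose)
  then have "((\<lambda>s. f (x + s *\<^sub>R e)) has_real_derivative e \<bullet> D) (at 0)"
    unfolding has_field_derivative_def by (rule has_derivative_eq_rhs) (auto simp: mult.commute)
  then have "((\<lambda>s. (f (x + s *\<^sub>R e) - f x) / s) \<longlongrightarrow> e \<bullet> D) (at 0)"
    by (simp add: DERIV_def)
  moreover have "filterlim h (at 0) sequentially"
    using h by (auto simp: filterlim_at)
  ultimately show ?thesis by (rule filterlim_compose)
qed

lemma GDERIV_imp_isCont: "GDERIV f x :> D \<Longrightarrow> isCont f x"
  unfolding gderiv_def by (rule has_derivative_continuous)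

lemma GDERIV_excess:
  assumes "GDERIV f x :> D"
  shows "GDERIV (\<lambda>y. excess l (f y)) x :> (2 * max 0 (f x - l)) *\<^sub>R D"
  using GDERIV_DERIV_compose[OF assms DERIV_excess] .

context fourier_profile
begin

text \<open>A translation multiplies the transform by a phase, so the transform of a difference
  quotient of \<open>excess l (f x)\<close> along axis \<open>j\<close> is an explicit factor times
  the transform of the function. Letting the step tend to 0 under dominated convergence gives the
  formula, and also the integrability of the gradient, about which nothing is assumed.\<close>

lemma
  assumes G: "\<And>x. GDERIV f x :> G x" and l: "0 < l"
  defines "wj \<equiv> \<lambda>j x. 2 * max 0 (f x - l) * G x $ j"
  shows integrable_excess_gradient: "integrable lborel (wj j)"
    and inverse_fourier_integral_excess_gradient:
      "inverse_fourier_integral (\<lambda>x. complex_of_real (wj j x)) \<xi>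
        = - (2 * pi * \<i> * \<xi> $ j) * inverse_fourier_integral (\<lambda>x. complex_of_real (excess l (f x))) \<xi>"
proof -
  let ?w = "\<lambda>x. excess l (f x)"
  let ?e = "axis j 1 :: real^'n"
  let ?M = "freq_norm \<beta> g" and ?L = "2 * pi * freq_norm \<beta> g"
  have M: "0 \<le> ?M" by (rule freq_norm_nonneg)
  \<comment> \<open>Steps are made so short that \<open>f\<close>, with Lipschitz constant
    \<open>?L\<close>, changes by less than l / 2. Where \<open>f x\<close> is at most l / 2 both
    values then lie below \<open>l\<close> and the quotient vanishes, so the dominating function
    lives on a set of finite measure.\<close>
  obtain N :: nat where N: "?L * 2 / l < N" using reals_Archimedean2 by blast
  define h where "h k = 1 / real (Suc (k + N))" for k
  have h0: "h k > 0" for k by (simp add: h_def)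
  have hlim: "h \<longlonglongrightarrow> 0"
    unfolding h_def by (rule LIMSEQ_ignore_initial_segment[OF LIMSEQ_Suc[OF lim_1_over_n]])
  have hL: "?L * h k < l / 2" for k
  proof -
    have "?L * 2 / l < real (Suc (k + N))" using N by simp
    then show ?thesis using l by (simp add: h_def field_simps)
  qed
  define D where "D k x = (?w (x + h k *\<^sub>R ?e) - ?w x) / h k" for k x
  have ne: "norm ?e = 1" by simp
  have [measurable]: "D k \<in> borel_measurable borel" for k
    unfolding D_def[abs_def] by measurable
  have Dlim: "(\<lambda>k. D k x) \<longlonglongrightarrow> wj j x" for x
    using GDERIV_direction_tendsto[OF GDERIV_excess[OF G], OF hlim, of l x ?e] h0
    unfolding D_def wj_def by (simp add: less_imp_neq[THEN not_sym] inner_axis' )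
  have [measurable]: "wj j \<in> borel_measurable borel"
    by (rule borel_measurable_LIMSEQ_real[OF Dlim]) measurable
  let ?B = "\<lambda>x. 2 * ?M * ?L * indicator {x. l / 2 < f x} x"
  have intB: "integrable lborel ?B"
    by (intro integrable_mult_right integrable_superlevel) (use l in auto)
  have Dle: "\<bar>D k x\<bar> \<le> ?B x" for k x
  proof -
    have d: "\<bar>f (x + h k *\<^sub>R ?e) - f x\<bar> \<le> ?L * h k"
      using lipschitz_f[of "x + h k *\<^sub>R ?e" x] h0[of k] by (simp add: ne)
    show ?thesis
    proof (cases "l / 2 < f x")
      case True
      have "\<bar>?w (x + h k *\<^sub>R ?e) - ?w x\<bar> \<le> 2 * ?M * \<bar>f (x + h k *\<^sub>R ?e) - f x\<bar>"
        by (rule excess_diff_le) (use l bounded_f in auto)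
      also have "\<dots> \<le> 2 * ?M * (?L * h k)"
        by (rule mult_left_mono[OF d]) (use M in simp)
      finally show ?thesis
        using True h0[of k] by (simp add: D_def field_simps)
    next
      case False
      then have "f x \<le> l" "f (x + h k *\<^sub>R ?e) \<le> l" using d hL[of k] l by linarith+
      then show ?thesis using False by (simp add: D_def excess_eq_0_iff[THEN iffD2])
    qed
  qed
  have "integrable lborel (wj j)"
    by (rule integrable_dominated_convergence[where s=D and w="?B"]) (use intB Dle Dlim in auto)
  then show "integrable lborel (wj j)" .
  have lim1: "(\<lambda>k. LINT x|lborel. cis (2 * pi * (\<xi> \<bullet> x)) * complex_of_real (D k x))
     \<longlonglongrightarrow> (LINT x|lborel. cis (2 * pi * (\<xi> \<bullet> x)) * complex_of_real (wj j x))"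
  proof (rule integral_dominated_convergence[where w="?B"])
    show "AE x in lborel. (\<lambda>k. cis (2 * pi * (\<xi> \<bullet> x)) * complex_of_real (D k x))
        \<longlonglongrightarrow> cis (2 * pi * (\<xi> \<bullet> x)) * complex_of_real (wj j x)"
      by (intro AE_I2 tendsto_intros Dlim)
    show "AE x in lborel. norm (cis (2 * pi * (\<xi> \<bullet> x)) * complex_of_real (D k x)) \<le> ?B x" for k
      using Dle by (intro AE_I2) (simp add: norm_mult)
  qed (use intB in measurable)
  let ?W = "inverse_fourier_integral (\<lambda>x. complex_of_real (?w x)) \<xi>"
  have intw: "integrable lborel (\<lambda>x. cis (2 * pi * (\<xi> \<bullet> x)) * complex_of_real (?w x))"
    by (rule integrable_cis_mult') (intro integrable_of_real integrable_excess l)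
  \<comment> \<open>Both terms of the quotient have the same inverse transform up to the phase
    \<open>?c\<close>, by translation invariance of the integral.\<close>
  have eq: "(LINT x|lborel. cis (2 * pi * (\<xi> \<bullet> x)) * complex_of_real (D k x))
      = (cis (- (2 * pi * \<xi> $ j) * h k) - 1) / h k * ?W" for k
  proof -
    let ?F = "\<lambda>x. cis (2 * pi * (\<xi> \<bullet> x)) * complex_of_real (?w x)"
    let ?c = "cis (- (2 * pi * \<xi> $ j) * h k)"
    have p: "cis (2 * pi * (\<xi> \<bullet> x)) * complex_of_real (D k x)
       = (1 / h k) * (?c * ?F (x + h k *\<^sub>R ?e) - ?F x)" for x
    proof -
      have "?c * cis (2 * pi * (\<xi> \<bullet> (x + h k *\<^sub>R ?e))) = cis (2 * pi * (\<xi> \<bullet> x))"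
        by (simp add: cis_mult inner_add_right inner_axis algebra_simps)
      then have eqF: "?c * ?F (x + h k *\<^sub>R ?e) = cis (2 * pi * (\<xi> \<bullet> x)) * ?w (x + h k *\<^sub>R ?e)"
        by (simp only: mult.assoc[symmetric])
      show ?thesis
        unfolding eqF by (simp add: D_def diff_divide_distrib right_diff_distrib)
    qed
    have tr: "(LINT x|lborel. ?F (x + h k *\<^sub>R ?e)) = ?W"
      unfolding inverse_fourier_integral_def by (rule integral_lborel_translate)
    have "(LINT x|lborel. (1 / h k) * (?c * ?F (x + h k *\<^sub>R ?e) - ?F x))
       = (1 / h k) * (?c * (LINT x|lborel. ?F (x + h k *\<^sub>R ?e)) - (LINT x|lborel. ?F x))"
      by (subst integral_mult_right_zero, subst Bochner_Integration.integral_diff)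
         (auto intro!: integrable_mult_right integrable_lborel_translate intw simp only: integral_mult_right_zero)
    then show ?thesis
      unfolding p tr by (simp add: inverse_fourier_integral_def field_simps)
  qed
  have lim2: "(\<lambda>k. (cis (- (2 * pi * \<xi> $ j) * h k) - 1) / h k * ?W) \<longlonglongrightarrow> \<i> * complex_of_real (- (2 * pi * \<xi> $ j)) * ?W"
    by (intro tendsto_mult tendsto_const cis_difference_quotient hlim) (use h0 in \<open>auto simp: less_imp_neq[THEN not_sym]\<close>)
  show "inverse_fourier_integral (\<lambda>x. complex_of_real (wj j x)) \<xi>
        = - (2 * pi * \<i> * \<xi> $ j) * inverse_fourier_integral (\<lambda>x. complex_of_real (excess l (f x))) \<xi>"
    using LIMSEQ_unique[OF lim1[unfolded eq] lim2] by (simp add: inverse_fourier_integral_def mult_ac)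
qed

end

section \<open>Symbol bounds and the transport identity\<close>

lemma powr_le_freq_weight:
  assumes "- \<beta> \<le> a" "a \<le> 2" "\<xi> \<noteq> 0"
  shows "norm \<xi> powr a \<le> freq_weight \<beta> \<xi>"
proof (cases "norm \<xi> \<le> 1")
  case True
  have "norm \<xi> powr a \<le> norm \<xi> powr (- \<beta>)"
    using True assms by (intro powr_mono') auto
  also have "\<dots> \<le> 1 * (1 + norm \<xi> powr (- \<beta>))" by simp
  also have "\<dots> \<le> freq_weight \<beta> \<xi>"
    unfolding freq_weight_def by (intro mult_right_mono) auto
  finally show ?thesis .
next
  case False
  have "norm \<xi> powr a \<le> norm \<xi> powr 2"
    using False assms by (intro powr_mono) auto
  also have "\<dots> = (norm \<xi>)\<^sup>2" using assms by simp
  also have "\<dots> \<le> freq_weight \<beta> \<xi>" using freq_weight_ge[of \<xi> \<beta>] by simp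
  finally show ?thesis .
qed

lemma laplacian_symbol_le:
  assumes "0 < \<alpha>" "\<alpha> < 1"
  shows "(2 * pi * norm \<xi>) powr (2 * \<alpha>) \<le> (2 * pi) powr (2 * \<alpha>) * freq_weight \<bar>1 - 2 * \<alpha>\<bar> \<xi>"
proof (cases "\<xi> = 0")
  case False
  then show ?thesis
    using assms by (auto simp: powr_mult intro!: mult_left_mono powr_le_freq_weight)
qed simp

text \<open>The symbol has order 2 \<alpha> - 1, which is negative for \<alpha> < 1/2 and then
  singular at 0; the choice \<beta> = |1 - 2 \<alpha>| covers this singularity.\<close>

lemma velocity_symbol_le:
  assumes "0 < \<alpha>" "\<alpha> < 1"
  shows "norm (2 * pi * \<i> * complex_of_real (\<xi> $ j) * complex_of_real ((2 * pi * norm \<xi>) powr (- 2 + 2 * \<alpha>)))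
    \<le> (2 * pi) powr (2 * \<alpha> - 1) * freq_weight \<bar>1 - 2 * \<alpha>\<bar> \<xi>"
proof (cases "\<xi> = 0")
  case False
  then have pos: "2 * pi * norm \<xi> > 0" by simp
  have "norm (2 * pi * \<i> * complex_of_real (\<xi> $ j) * complex_of_real ((2 * pi * norm \<xi>) powr (- 2 + 2 * \<alpha>)))
      = 2 * pi * \<bar>\<xi> $ j\<bar> * (2 * pi * norm \<xi>) powr (- 2 + 2 * \<alpha>)"
    by (simp add: norm_mult)
  also have "\<dots> \<le> (2 * pi * norm \<xi>) * (2 * pi * norm \<xi>) powr (- 2 + 2 * \<alpha>)"
    using component_le_norm_cart[of \<xi> j] by (intro mult_right_mono mult_left_mono) auto
  also have "\<dots> = (2 * pi * norm \<xi>) powr (1 + (- 2 + 2 * \<alpha>))"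
    unfolding powr_add using pos by simp
  also have "\<dots> = (2 * pi) powr (2 * \<alpha> - 1) * norm \<xi> powr (2 * \<alpha> - 1)"
    by (simp add: powr_mult)
  also have "\<dots> \<le> (2 * pi) powr (2 * \<alpha> - 1) * freq_weight \<bar>1 - 2 * \<alpha>\<bar> \<xi>"
    using assms False by (intro mult_left_mono powr_le_freq_weight) auto
  finally show ?thesis .
qed simp

lemma symbol_square:
  "(2 * pi)\<^sup>2 * (norm \<xi>)\<^sup>2 * (2 * pi * norm \<xi>) powr (- 2 + 2 * \<alpha>) = (2 * pi * norm \<xi>) powr (2 * \<alpha>)"
proof (cases "\<xi> = 0")
  case False
  then have "(2 * pi)\<^sup>2 * (norm \<xi>)\<^sup>2 = (2 * pi * norm \<xi>) powr 2"
    by (simp add: power_mult_distrib)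
  then show ?thesis by (simp only: powr_add[symmetric]) simp
qed simp

lemma integrable_mult_bounded:
  fixes a u :: "'a \<Rightarrow> complex"
  assumes a: "integrable M a" and [measurable]: "u \<in> borel_measurable M" and C: "\<And>x. norm (u x) \<le> C"
  shows "integrable M (\<lambda>x. a x * u x)"
proof (rule Bochner_Integration.integrable_bound[OF integrable_mult_right[OF integrable_norm[OF a], of C]])
  show "AE x in M. norm (a x * u x) \<le> norm (C * norm (a x))"
    using mult_right_mono[OF C norm_ge_zero[of "a _"]]
    by (intro AE_I2) (auto simp: norm_mult mult.commute intro: order_trans[OF _ abs_ge_self])
qed (use a in measurable)

text \<open>By duality this is the integral of \<open>w\<close> times Lambda^(2 \<alpha>) of the
  function with transform \<open>g\<close>; for real \<open>w\<close> the inverse transform is the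
  conjugate of the Fourier transform.\<close>

definition dissipation :: "real \<Rightarrow> (real^'n::finite \<Rightarrow> complex) \<Rightarrow> (real^'n \<Rightarrow> real) \<Rightarrow> real" where
  "dissipation \<alpha> g w = Re (LINT \<xi>|lborel. complex_of_real ((2 * pi * norm \<xi>) powr (2 * \<alpha>)) * g \<xi>
      * inverse_fourier_integral (\<lambda>x. complex_of_real (w x)) \<xi>)"

text \<open>The gradient of \<open>excess l (f x)\<close> contributes the factor -2 pi i \<xi>_j and
  the velocity the factor 2 pi i \<xi>_j; summed over \<open>j\<close>, their product with the
  remaining symbol is that of Lambda^(2 \<alpha>). The velocity is bounded and the gradient
  integrable, so all integrals converge absolutely and no boundary terms arise.\<close>

lemma transport_integral:
  fixes f :: "real^'n::finite \<Rightarrow> real"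
  assumes \<alpha>: "0 < \<alpha>" "\<alpha> < 1" and profile: "fourier_profile f (fourier_L2 f) \<bar>1 - 2 * \<alpha>\<bar>"
    and G: "\<And>x. GDERIV f x :> G x" and l: "0 < l"
  shows "(LINT x|lborel. 2 * max 0 (f x - l) * (velocity \<alpha> f x \<bullet> G x))
      = dissipation \<alpha> (fourier_L2 f) (\<lambda>x. excess l (f x))"
proof -
  interpret fourier_profile f "fourier_L2 f" "\<bar>1 - 2 * \<alpha>\<bar>" by (rule profile)
  let ?g = "fourier_L2 f"
  let ?s = "\<lambda>j \<xi>. 2 * pi * \<i> * complex_of_real (\<xi> $ j) * complex_of_real ((2 * pi * norm \<xi>) powr (- 2 + 2 * \<alpha>))"
  let ?U = "\<lambda>j. inverse_fourier_integral (\<lambda>\<xi>. ?s j \<xi> * ?g \<xi>)"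
  let ?wj = "\<lambda>j x. 2 * max 0 (f x - l) * G x $ j"
  let ?W = "inverse_fourier_integral (\<lambda>x. complex_of_real (excess l (f x)))"
  have sg: "integrable lborel (\<lambda>\<xi>. ?s j \<xi> * ?g \<xi>)" for j
    by (rule integrable_multiplier[OF _ velocity_symbol_le[OF \<alpha>]]) measurable
  have [measurable]: "?U j \<in> borel_measurable borel" for j by measurable
  have wj: "integrable lborel (?wj j)" for j by (rule integrable_excess_gradient[OF G l])
  have wjc: "integrable lborel (\<lambda>x. complex_of_real (?wj j x))" for j by (rule integrable_of_real[OF wj])
  have [measurable]: "?wj j \<in> borel_measurable borel" for j using borel_measurable_integrable[OF wj[of j]] by simp
  have Uw: "integrable lborel (\<lambda>x. complex_of_real (?wj j x) * ?U j x)" for j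
    by (rule integrable_mult_bounded[OF wjc _ norm_inverse_fourier_integral_le]) measurable
  have W: "integrable lborel (\<lambda>\<xi>. ?s j \<xi> * ?g \<xi> * (- (2 * pi * \<i> * \<xi> $ j) * ?W \<xi>))" for j
  proof -
    let ?m = "\<lambda>\<xi>. ?s j \<xi> * (- (2 * pi * \<i> * \<xi> $ j))"
    have "norm (?m \<xi>) \<le> (2 * pi) powr (2 * \<alpha>) * freq_weight \<bar>1 - 2 * \<alpha>\<bar> \<xi>" for \<xi>
    proof -
      have "norm (?m \<xi>) = (2 * pi)\<^sup>2 * (\<xi> $ j)\<^sup>2 * (2 * pi * norm \<xi>) powr (- 2 + 2 * \<alpha>)"
        by (simp add: norm_mult power2_eq_square)
      also have "\<dots> \<le> (2 * pi)\<^sup>2 * (norm \<xi>)\<^sup>2 * (2 * pi * norm \<xi>) powr (- 2 + 2 * \<alpha>)"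
        using component_le_norm_cart[of \<xi> j]
        by (intro mult_right_mono mult_left_mono abs_le_square_iff[THEN iffD1]) auto
      also have "\<dots> \<le> (2 * pi) powr (2 * \<alpha>) * freq_weight \<bar>1 - 2 * \<alpha>\<bar> \<xi>"
        unfolding symbol_square using laplacian_symbol_le[OF \<alpha>] .
      finally show ?thesis .
    qed
    then have "integrable lborel (\<lambda>\<xi>. ?m \<xi> * ?g \<xi>)"
      by (intro integrable_multiplier) measurable
    then have "integrable lborel (\<lambda>\<xi>. (?m \<xi> * ?g \<xi>) * ?W \<xi>)"
      by (rule integrable_mult_bounded[OF _ _ norm_inverse_fourier_integral_le]) measurable
    then show ?thesis by (simp only: mult_ac)
  qed
  have "2 * max 0 (f x - l) * (velocity \<alpha> f x \<bullet> G x) = (\<Sum>j\<in>UNIV. Re (complex_of_real (?wj j x) * ?U j x))" for x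
    by (simp add: velocity_def inner_vec_def sum_distrib_left mult_ac)
  then have "(LINT x|lborel. 2 * max 0 (f x - l) * (velocity \<alpha> f x \<bullet> G x))
      = (\<Sum>j\<in>UNIV. (LINT x|lborel. Re (complex_of_real (?wj j x) * ?U j x)))"
    by (simp only:) (rule Bochner_Integration.integral_sum, intro integrable_Re Uw)
  also have "\<dots> = (\<Sum>j\<in>UNIV. Re (LINT x|lborel. complex_of_real (?wj j x) * ?U j x))"
    by (simp only: integral_Re[OF Uw])
  \<comment> \<open>Duality moves the inverse transform from the velocity component to the gradient
    component, where \<open>inverse_fourier_integral_excess_gradient\<close> evaluates it.\<close>
  also have "\<dots> = (\<Sum>j\<in>UNIV. Re (LINT \<xi>|lborel. ?s j \<xi> * ?g \<xi> * (- (2 * pi * \<i> * \<xi> $ j) * ?W \<xi>)))"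
    unfolding inverse_fourier_integral_duality[OF sg wjc] inverse_fourier_integral_excess_gradient[OF G l] ..
  also have "\<dots> = Re (LINT \<xi>|lborel. (\<Sum>j\<in>UNIV. ?s j \<xi> * ?g \<xi> * (- (2 * pi * \<i> * \<xi> $ j) * ?W \<xi>)))"
    by (subst Bochner_Integration.integral_sum) (simp_all only: W Re_sum)
  also have "(\<lambda>\<xi>. \<Sum>j\<in>UNIV. ?s j \<xi> * ?g \<xi> * (- (2 * pi * \<i> * \<xi> $ j) * ?W \<xi>))
      = (\<lambda>\<xi>. complex_of_real ((2 * pi * norm \<xi>) powr (2 * \<alpha>)) * ?g \<xi> * ?W \<xi>)"
  proof
    fix \<xi> :: "real^'n"
    let ?p = "(2 * pi * norm \<xi>) powr (- 2 + 2 * \<alpha>)"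
    have "(\<Sum>j\<in>UNIV. ?s j \<xi> * ?g \<xi> * (- (2 * pi * \<i> * \<xi> $ j) * ?W \<xi>))
       = (\<Sum>j\<in>UNIV. complex_of_real ((2 * pi)\<^sup>2 * (\<xi> $ j)\<^sup>2 * ?p) * (?g \<xi> * ?W \<xi>))"
      by (intro sum.cong refl) (simp add: power2_eq_square algebra_simps)
    also have "\<dots> = complex_of_real ((2 * pi)\<^sup>2 * (norm \<xi>)\<^sup>2 * ?p) * (?g \<xi> * ?W \<xi>)"
      by (simp only: norm_vec_square sum_distrib_left sum_distrib_right of_real_sum)
    also have "(2 * pi)\<^sup>2 * (norm \<xi>)\<^sup>2 * ?p = (2 * pi * norm \<xi>) powr (2 * \<alpha>)"
      by (rule symbol_square)
    finally show "(\<Sum>j\<in>UNIV. ?s j \<xi> * ?g \<xi> * (- (2 * pi * \<i> * \<xi> $ j) * ?W \<xi>))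
      = complex_of_real ((2 * pi * norm \<xi>) powr (2 * \<alpha>)) * ?g \<xi> * ?W \<xi>"
      by (simp only: mult.assoc)
  qed
  finally show ?thesis unfolding dissipation_def .
qed

section \<open>Heat forms and subordination\<close>

text \<open>Its value is Gamma(1 - \<alpha>)/\<alpha>; only its positivity and its role as
  normalising constant matter.\<close>

definition subordination_const :: "real \<Rightarrow> real" where
  "subordination_const \<alpha> = (LINT t|lborel. indicator {0<..} t * (1 - exp (- t)) * t powr (- 1 - \<alpha>))"

lemma
  assumes \<alpha>: "0 < \<alpha>" "\<alpha> < 1"
  shows subordination_const_pos: "0 < subordination_const \<alpha>"
    and integrable_subordination: "0 \<le> s \<Longrightarrow>
      integrable lborel (\<lambda>t. indicator {0<..} t * (1 - exp (- (t * s))) * t powr (- 1 - \<alpha>))"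
    and integral_subordination: "0 \<le> s \<Longrightarrow>
      (LINT t|lborel. indicator {0<..} t * (1 - exp (- (t * s))) * t powr (- 1 - \<alpha>)) = subordination_const \<alpha> * s powr \<alpha>"
proof -
  define F where "F t = indicator {0<..} t * (1 - exp (- t)) * t powr (- 1 - \<alpha>)" for t :: real
  have F0: "0 \<le> F t" for t by (auto simp: F_def indicator_def)
  have F: "integrable lborel F"
  proof (rule Bochner_Integration.integrable_bound)
    show "integrable lborel (\<lambda>t. indicator {0..1} t * t powr (- \<alpha>) + indicator {1..} t * t powr (- 1 - \<alpha>))"
      by (intro Bochner_Integration.integrable_add integrable_powr_from_0 integrable_powr_to_inf) (use \<alpha> in auto)
    show "AE t in lborel. norm (F t) \<le> norm (indicator {0..1} t * t powr (- \<alpha>) + indicator {1..} t * t powr (- 1 - \<alpha>))"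
    proof (rule AE_I2)
      fix t :: real
      have "F t \<le> indicator {0..1} t * t powr (- \<alpha>) + indicator {1..} t * t powr (- 1 - \<alpha>)"
      proof (cases "0 < t")
        case True
        show ?thesis
        proof (cases "t \<le> 1")
          case t1: True
          have "1 - exp (- t) \<le> t" using exp_ge_add_one_self[of "- t"] by simp
          then have "(1 - exp (- t)) * t powr (- 1 - \<alpha>) \<le> t * t powr (- 1 - \<alpha>)" by (rule mult_right_mono) simp
          also have "\<dots> = t powr (- \<alpha>)" using True powr_add[of t 1 "- 1 - \<alpha>"] by simp
          moreover have "- 1 \<le> exp (- 1 :: real)" by (rule order_trans[OF _ exp_ge_zero]) simp
          ultimately show ?thesis using True t1 by (simp add: F_def indicator_def)
        next
          case False
          have "(1 - exp (- t)) * t powr (- 1 - \<alpha>) \<le> 1 * t powr (- 1 - \<alpha>)" by (rule mult_right_mono) simp_all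
          then show ?thesis using True False by (simp add: F_def indicator_def)
        qed
      qed (auto simp: F_def indicator_def)
      then show "norm (F t) \<le> norm (indicator {0..1} t * t powr (- \<alpha>) + indicator {1..} t * t powr (- 1 - \<alpha>))"
        using F0[of t] by simp
    qed
    show "F \<in> borel_measurable lborel" unfolding F_def[abs_def] by measurable
  qed
  have cF: "subordination_const \<alpha> = (LINT t|lborel. F t)"
    by (simp add: subordination_const_def F_def)
  \<comment> \<open>Lower bound from t >= 1 alone, where 1 - exp(-t) is at least 1 - exp(-1) and the
    power integrates to 1/\<alpha>.\<close>
  have "0 < (1 - exp (- 1)) * (1 / \<alpha>)" using \<alpha> by simp
  also have "\<dots> = (LINT t|lborel. (1 - exp (- 1)) * (indicator {1..} t * t powr (- 1 - \<alpha>)))"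
    using integral_powr_to_inf[of "- 1 - \<alpha>" 1] \<alpha> by simp
  also have "\<dots> \<le> (LINT t|lborel. F t)"
  proof (rule integral_mono[OF _ F])
    show "integrable lborel (\<lambda>t. (1 - exp (- 1)) * (indicator {1..} t * t powr (- 1 - \<alpha>)))"
      by (intro integrable_mult_right integrable_powr_to_inf) (use \<alpha> in auto)
    show "(1 - exp (- 1)) * (indicator {1..} t * t powr (- 1 - \<alpha>)) \<le> F t" for t
      using F0[of t] by (cases "1 \<le> t") (auto simp: F_def intro!: mult_right_mono)
  qed
  finally show "0 < subordination_const \<alpha>" unfolding cF .
  assume s: "0 \<le> s"
  \<comment> \<open>Substituting s t for t: the power weight yields s^(1 + \<alpha>), the Jacobian
    removes one factor s, and s^\<alpha> remains.\<close>
  have scale: "indicator {0<..} t * (1 - exp (- (t * s))) * t powr (- 1 - \<alpha>) = s powr (1 + \<alpha>) * F (0 + s * t)" if "0 < s" for t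
  proof (cases "0 < t")
    case True
    have "s powr (1 + \<alpha>) * s powr (- 1 - \<alpha>) = 1" using that by (simp add: powr_add[symmetric])
    then show ?thesis using True that by (simp add: F_def powr_mult mult_ac)
  next
    case False
    then show ?thesis using that by (simp add: F_def indicator_def zero_less_mult_iff)
  qed
  show "integrable lborel (\<lambda>t. indicator {0<..} t * (1 - exp (- (t * s))) * t powr (- 1 - \<alpha>))"
  proof (cases "s = 0")
    case False
    then have "s > 0" using s by simp
    then show ?thesis unfolding scale[OF \<open>s > 0\<close>]
      by (intro integrable_mult_right lborel_integrable_real_affine F) simp
  qed simp
  show "(LINT t|lborel. indicator {0<..} t * (1 - exp (- (t * s))) * t powr (- 1 - \<alpha>)) = subordination_const \<alpha> * s powr \<alpha>"
  proof (cases "s = 0")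
    case False
    then have s: "s > 0" using s by simp
    have "(LINT t|lborel. F (0 + s * t)) = subordination_const \<alpha> / s"
      using lborel_integral_real_affine[of s F 0] s by (simp add: cF field_simps)
    moreover have "s powr (1 + \<alpha>) = s * s powr \<alpha>" using s by (simp add: powr_add)
    ultimately show ?thesis unfolding scale[OF s] integral_mult_right_zero using s by simp
  qed simp
qed

lemma integrable_pair_heat_kernel:
  fixes a :: "real^'n::finite \<Rightarrow> real"
  assumes a: "integrable lborel a" and t: "0 < t"
  shows "integrable (lborel \<Otimes>\<^sub>M lborel) (\<lambda>(x, y). a x * heat_kernel t (x - y))"
proof -
  have [measurable]: "a \<in> borel_measurable borel" using a by auto
  have "(LINT y|lborel. norm (a x * heat_kernel t (x - y))) = \<bar>a x\<bar>" for x
    by (simp add: abs_mult integrable_heat_kernel_diff(2)[OF t])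
  then show ?thesis
    by (intro lborel_pair.Fubini_integrable)
       (use a integrable_heat_kernel_diff(1)[OF t] in auto)
qed

context fourier_profile
begin

text \<open>The pairing of \<open>w\<close> with f - exp(t Laplacian) f. Averaged in
  \<open>t\<close> against t^(-1-\<alpha>) it yields the dissipation, but for fixed \<open>t\<close>
  it has an integrable kernel, so no singular integral is needed.\<close>

definition heat_form :: "(real^'n \<Rightarrow> real) \<Rightarrow> real \<Rightarrow> real" where
  "heat_form w t = Re (LINT \<xi>|lborel. complex_of_real (1 - heat_symbol t \<xi>) * (g \<xi> * inverse_fourier_integral (\<lambda>x. complex_of_real (w x)) \<xi>))"

lemma integrable_f_heat_kernel:
  assumes "0 < t" shows "integrable lborel (\<lambda>y. f y * heat_kernel t (x - y))"
  by (rule Bochner_Integration.integrable_bound[OF integrable_mult_right[OF integrable_heat_kernel_diff(1)[OF assms, of x], of "freq_norm \<beta> g"]])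
     (use bounded_f freq_norm_nonneg[of \<beta> g] in \<open>auto simp: abs_mult intro!: mult_right_mono\<close>)

text \<open>The multiplication formula identifies the damped transform with a convolution, and unit
  mass of the kernel writes \<open>f x\<close> as an average over \<open>y\<close>.\<close>

lemma heat_form_eq:
  assumes w: "integrable lborel w" and t: "0 < t"
  shows "heat_form w t = (LINT x|lborel. (LINT y|lborel. w x * (f x - f y) * heat_kernel t (x - y)))"
proof -
  let ?W = "inverse_fourier_integral (\<lambda>x. complex_of_real (w x))"
  have [measurable]: "w \<in> borel_measurable borel" using w by auto
  have wc: "integrable lborel (\<lambda>x. complex_of_real (w x))" by (rule integrable_of_real[OF w])
  have gW: "integrable lborel (\<lambda>\<xi>. g \<xi> * ?W \<xi>)"
    by (rule integrable_mult_bounded[OF integrable_g _ norm_inverse_fourier_integral_le]) measurable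
  have gg: "integrable lborel (\<lambda>\<xi>. complex_of_real (heat_symbol t \<xi>) * g \<xi>)"
    by (rule integrable_multiplier[of _ 1])
       (use heat_symbol_le_1[of t] t freq_weight_ge_1 in \<open>auto intro: order_trans\<close>)
  have ggW: "integrable lborel (\<lambda>\<xi>. complex_of_real (heat_symbol t \<xi>) * g \<xi> * ?W \<xi>)"
    by (rule integrable_mult_bounded[OF gg _ norm_inverse_fourier_integral_le]) measurable
  have inv: "inverse_fourier_integral (\<lambda>\<xi>. complex_of_real (heat_symbol t \<xi>) * g \<xi>) x
      = complex_of_real (LINT y|lborel. f y * heat_kernel t (x - y))" for x
    using multiplication_formula[OF fg t, of x]
    by (simp add: inverse_fourier_integral_def mult_ac flip: of_real_mult integral_of_real)
  have e1: "(LINT \<xi>|lborel. g \<xi> * ?W \<xi>) = complex_of_real (LINT x|lborel. w x * f x)"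
    using inverse_fourier_integral_duality[OF integrable_g wc]
    by (simp add: inversion flip: of_real_mult integral_of_real)
  have e2: "(LINT \<xi>|lborel. complex_of_real (heat_symbol t \<xi>) * g \<xi> * ?W \<xi>)
      = complex_of_real (LINT x|lborel. w x * (LINT y|lborel. f y * heat_kernel t (x - y)))"
    using inverse_fourier_integral_duality[OF gg wc]
    by (simp add: inv flip: of_real_mult integral_of_real)
  have bd: "\<bar>LINT y|lborel. f y * heat_kernel t (x - y)\<bar> \<le> freq_norm \<beta> g" for x
  proof -
    have "\<bar>LINT y|lborel. f y * heat_kernel t (x - y)\<bar> \<le> (LINT y|lborel. freq_norm \<beta> g * heat_kernel t (x - y))"
      unfolding real_norm_def[symmetric]
      by (rule Bochner_Integration.integral_norm_bound_integral)
         (use t bounded_f in \<open>auto simp: abs_mult intro!: integrable_f_heat_kernel integrable_heat_kernel_diff mult_right_mono\<close>)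
    then show ?thesis by (simp add: integrable_heat_kernel_diff(2)[OF t])
  qed
  have int1: "integrable lborel (\<lambda>x. w x * f x)"
    by (rule Bochner_Integration.integrable_bound[OF integrable_mult_right[OF w, of "freq_norm \<beta> g"]])
       (use bounded_f freq_norm_nonneg[of \<beta> g] in \<open>auto simp: abs_mult mult.commute[of "freq_norm \<beta> g"] intro!: AE_I2 mult_left_mono\<close>)
  have int2: "integrable lborel (\<lambda>x. w x * (LINT y|lborel. f y * heat_kernel t (x - y)))"
    by (rule Bochner_Integration.integrable_bound[OF integrable_mult_right[OF w, of "freq_norm \<beta> g"]])
       (use bd freq_norm_nonneg[of \<beta> g] in \<open>auto simp: abs_mult mult.commute[of "freq_norm \<beta> g"] intro!: AE_I2 mult_left_mono\<close>)
  have "(LINT \<xi>|lborel. complex_of_real (1 - heat_symbol t \<xi>) * (g \<xi> * ?W \<xi>))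
     = (LINT \<xi>|lborel. g \<xi> * ?W \<xi> - complex_of_real (heat_symbol t \<xi>) * g \<xi> * ?W \<xi>)"
    by (simp add: algebra_simps)
  also have "\<dots> = complex_of_real (LINT x|lborel. w x * f x)
      - complex_of_real (LINT x|lborel. w x * (LINT y|lborel. f y * heat_kernel t (x - y)))"
    by (subst Bochner_Integration.integral_diff[OF gW ggW]) (simp only: e1 e2)
  finally have "heat_form w t = (LINT x|lborel. w x * f x) - (LINT x|lborel. w x * (LINT y|lborel. f y * heat_kernel t (x - y)))"
    by (simp add: heat_form_def)
  also have "\<dots> = (LINT x|lborel. w x * f x - w x * (LINT y|lborel. f y * heat_kernel t (x - y)))"
    by (rule Bochner_Integration.integral_diff[symmetric, OF int1 int2])
  also have "\<dots> = (LINT x|lborel. (LINT y|lborel. w x * (f x - f y) * heat_kernel t (x - y)))"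
  proof (rule Bochner_Integration.integral_cong[OF refl])
    fix x
    have "(LINT y|lborel. w x * (f x - f y) * heat_kernel t (x - y))
      = (LINT y|lborel. w x * (f x * heat_kernel t (x - y) - f y * heat_kernel t (x - y)))"
      by (simp add: algebra_simps)
    also have "\<dots> = w x * (f x - (LINT y|lborel. f y * heat_kernel t (x - y)))"
      using integrable_heat_kernel_diff[OF t, of x]
      by (subst integral_mult_right_zero, subst Bochner_Integration.integral_diff)
         (auto intro: integrable_f_heat_kernel[OF t])
    finally show "w x * f x - w x * (LINT y|lborel. f y * heat_kernel t (x - y))
        = (LINT y|lborel. w x * (f x - f y) * heat_kernel t (x - y))"
      by (simp add: right_diff_distrib)
  qed
  finally show ?thesis .
qed

text \<open>The integrand of the heat form has no sign before its values at (x, y) and (y, x) are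
  added.\<close>

lemma integral_swap_pair:
  fixes H :: "real^'n \<Rightarrow> real^'n \<Rightarrow> real"
  assumes "integrable (lborel \<Otimes>\<^sub>M lborel) (case_prod H)"
  shows "integrable (lborel \<Otimes>\<^sub>M lborel) (\<lambda>(x, y). H x y + H y x)"
    and "integral\<^sup>L (lborel \<Otimes>\<^sub>M lborel) (\<lambda>(x, y). H x y + H y x) = 2 * (LINT x|lborel. (LINT y|lborel. H x y))"
proof -
  have sw: "integrable (lborel \<Otimes>\<^sub>M lborel) (\<lambda>(x, y). H y x)"
    using lborel_pair.integrable_product_swap[OF assms] by (simp add: case_prod_beta')
  show "integrable (lborel \<Otimes>\<^sub>M lborel) (\<lambda>(x, y). H x y + H y x)"
    using Bochner_Integration.integrable_add[OF assms sw] by (simp add: case_prod_beta')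
  have "integral\<^sup>L (lborel \<Otimes>\<^sub>M lborel) (\<lambda>(x, y). H x y + H y x)
     = integral\<^sup>L (lborel \<Otimes>\<^sub>M lborel) (case_prod H) + integral\<^sup>L (lborel \<Otimes>\<^sub>M lborel) (\<lambda>(x, y). H y x)"
    using Bochner_Integration.integral_add[OF assms sw] by (simp add: case_prod_beta')
  also have "integral\<^sup>L (lborel \<Otimes>\<^sub>M lborel) (case_prod H) = (LINT x|lborel. (LINT y|lborel. H x y))"
    using lborel_pair.integral_fst[OF assms] by simp
  also have "integral\<^sup>L (lborel \<Otimes>\<^sub>M lborel) (\<lambda>(x, y). H y x) = (LINT x|lborel. (LINT y|lborel. H x y))"
    using lborel_pair.integral_snd[OF sw] by simp
  finally show "integral\<^sup>L (lborel \<Otimes>\<^sub>M lborel) (\<lambda>(x, y). H x y + H y x) = 2 * (LINT x|lborel. (LINT y|lborel. H x y))"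
    by simp
qed

text \<open>The symmetrised form is bounded below by the interaction \<open>?Q\<close> of the region
  above \<open>m\<close> with the region at most \<open>l\<close>, across which \<open>f\<close>
  drops by at least m - l. The bracket estimates the fraction of heat landing in the lower region;
  it may be negative for small \<open>t\<close>, where only nonnegativity is of use.\<close>

lemma
  assumes l: "0 < l" "l < m" and t: "0 < t"
    and a: "measure lborel {x. l < f x} \<le> a"
  shows heat_form_nonneg: "0 \<le> heat_form (\<lambda>x. excess m (f x)) t"
    and heat_form_ge: "(m - l) * (1 - a * (4 * pi * t) powr (- (real CARD('n) / 2))) * (LINT x|lborel. excess m (f x))
      \<le> heat_form (\<lambda>x. excess m (f x)) t"
proof -
  let ?w = "\<lambda>x. excess m (f x)" and ?M = "freq_norm \<beta> g"
  let ?H = "\<lambda>x y. ?w x * (f x - f y) * heat_kernel t (x - y)"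
  let ?Q = "\<lambda>x y. (m - l) * ?w x * indicator {y. f y \<le> l} y * heat_kernel t (x - y)"
  have M: "0 \<le> ?M" by (rule freq_norm_nonneg)
  have w: "integrable lborel ?w" by (rule integrable_excess) (use l in simp)
  have dom: "integrable (lborel \<Otimes>\<^sub>M lborel) (\<lambda>(x, y). (2 * ?M + (m - l)) * ?w x * heat_kernel t (x - y))"
    by (rule integrable_pair_heat_kernel[OF _ t]) (intro integrable_mult_right w)
  have H: "integrable (lborel \<Otimes>\<^sub>M lborel) (case_prod ?H)"
  proof (rule Bochner_Integration.integrable_bound[OF dom])
    have "norm (?H x y) \<le> norm ((2 * ?M + (m - l)) * ?w x * heat_kernel t (x - y))" for x y
    proof -
      have "\<bar>f x - f y\<bar> \<le> 2 * ?M + (m - l)" using bounded_f[of x] bounded_f[of y] l by linarith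
      then have "?w x * \<bar>f x - f y\<bar> * heat_kernel t (x - y) \<le> ?w x * (2 * ?M + (m - l)) * heat_kernel t (x - y)"
        by (intro mult_right_mono mult_left_mono) auto
      then show ?thesis using M l by (simp add: abs_mult mult_ac)
    qed
    then show "AE z in lborel \<Otimes>\<^sub>M lborel. norm (case_prod ?H z) \<le> norm (case z of (x, y) \<Rightarrow> (2 * ?M + (m - l)) * ?w x * heat_kernel t (x - y))"
      by (intro AE_I2) (simp add: case_prod_beta')
  qed measurable
  have Q: "integrable (lborel \<Otimes>\<^sub>M lborel) (case_prod ?Q)"
  proof (rule Bochner_Integration.integrable_bound[OF dom])
    have "norm (?Q x y) \<le> norm ((2 * ?M + (m - l)) * ?w x * heat_kernel t (x - y))" for x y
    proof -
      have "(m - l) * ?w x * indicator {y. f y \<le> l} y * heat_kernel t (x - y) \<le> (2 * ?M + (m - l)) * ?w x * 1 * heat_kernel t (x - y)"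
        using M l by (intro mult_right_mono mult_mono) (auto simp: indicator_def)
      then show ?thesis using M l by (simp add: abs_mult)
    qed
    then show "AE z in lborel \<Otimes>\<^sub>M lborel. norm (case_prod ?Q z) \<le> norm (case z of (x, y) \<Rightarrow> (2 * ?M + (m - l)) * ?w x * heat_kernel t (x - y))"
      by (intro AE_I2) (simp add: case_prod_beta')
  qed measurable
  \<comment> \<open>If both values are at most \<open>m\<close>, all terms vanish; if one exceeds
    \<open>m\<close> and the other is at most \<open>l\<close>, the drop is at least m - l; if both
    exceed \<open>l\<close>, then \<open>?Q\<close> vanishes and the right side is nonnegative
    because \<open>excess m\<close> is monotone.\<close>
  have le: "?Q x y + ?Q y x \<le> ?H x y + ?H y x" for x y
  proof -
    have "(m - l) * ?w x * indicator {y. f y \<le> l} y + (m - l) * ?w y * indicator {y. f y \<le> l} x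
       \<le> ?w x * (f x - f y) + ?w y * (f y - f x)"
    proof -
      consider "f x \<le> m" "f y \<le> m" | "f x > m" "f y \<le> l" | "f y > m" "f x \<le> l" | "f x > l" "f y > l" by linarith
      then show ?thesis
      proof cases
        case 1
        then show ?thesis by (simp add: excess_eq_0_iff[THEN iffD2])
      next
        case 2
        then have "(m - l) * ?w x \<le> ?w x * (f x - f y)" by (simp add: mult.commute[of "m - l"] mult_left_mono)
        then show ?thesis using 2 l by (simp add: excess_eq_0_iff[THEN iffD2])
      next
        case 3
        then have "(m - l) * ?w y \<le> ?w y * (f y - f x)" by (simp add: mult.commute[of "m - l"] mult_left_mono)
        then show ?thesis using 3 l by (simp add: excess_eq_0_iff[THEN iffD2])
      next
        case 4
        have "0 \<le> (?w x - ?w y) * (f x - f y)"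
        proof (cases "f x \<le> f y")
          case True
          then have "?w x \<le> ?w y" unfolding excess_def by (intro power_mono) auto
          then show ?thesis using True by (simp add: mult_nonpos_nonpos)
        next
          case False
          then have "?w y \<le> ?w x" unfolding excess_def by (intro power_mono) auto
          then show ?thesis using False by simp
        qed
        then show ?thesis using 4 by (simp add: algebra_simps)
      qed
    qed
    from mult_right_mono[OF this heat_kernel_nonneg[of t "x - y"]]
    show ?thesis by (simp add: heat_kernel_minus[of t y x] distrib_right)
  qed
  have "2 * (LINT x|lborel. (LINT y|lborel. ?Q x y)) \<le> 2 * (LINT x|lborel. (LINT y|lborel. ?H x y))"
    unfolding integral_swap_pair(2)[OF H, symmetric] integral_swap_pair(2)[OF Q, symmetric]
    by (rule integral_mono[OF integral_swap_pair(1)[OF Q] integral_swap_pair(1)[OF H]])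
       (use le in \<open>auto simp only: split: prod.split\<close>)
  then have QH: "(LINT x|lborel. (LINT y|lborel. ?Q x y)) \<le> heat_form ?w t"
    unfolding heat_form_eq[OF w t] by simp
  have "0 \<le> (LINT x|lborel. (LINT y|lborel. ?Q x y))"
    using l by (intro Bochner_Integration.integral_nonneg) auto
  with QH show "0 \<le> heat_form ?w t" by simp
  let ?C = "(4 * pi * t) powr (- (real CARD('n) / 2))"
  \<comment> \<open>The mass lost to the set above \<open>l\<close> is at most the maximum of the
    kernel times the measure of that set.\<close>
  have inner: "1 - a * ?C \<le> (LINT y|lborel. indicator {y. f y \<le> l} y * heat_kernel t (x - y))" for x
  proof -
    have i1: "integrable lborel (\<lambda>y. indicator {y. l < f y} y * heat_kernel t (x - y))"
      by (rule Bochner_Integration.integrable_bound[OF integrable_heat_kernel_diff(1)[OF t, of x]])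
         (auto simp: indicator_def)
    have i2: "integrable lborel (\<lambda>y. ?C * indicator {y. l < f y} y :: real)"
      by (intro integrable_mult_right integrable_superlevel l)
    have "(LINT y|lborel. indicator {y. l < f y} y * heat_kernel t (x - y)) \<le> (LINT y|lborel. ?C * indicator {y. l < f y} y)"
      by (rule integral_mono[OF i1 i2]) (auto simp: indicator_def heat_kernel_le[OF t])
    also have "\<dots> = ?C * measure lborel {y. l < f y}" by simp
    also have "\<dots> \<le> a * ?C" using a by (simp add: mult.commute[of a] mult_left_mono)
    finally have *: "(LINT y|lborel. indicator {y. l < f y} y * heat_kernel t (x - y)) \<le> a * ?C" .
    have "(LINT y|lborel. indicator {y. f y \<le> l} y * heat_kernel t (x - y))
       = (LINT y|lborel. heat_kernel t (x - y) - indicator {y. l < f y} y * heat_kernel t (x - y))"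
      by (intro Bochner_Integration.integral_cong refl) (auto simp: indicator_def)
    also have "\<dots> = 1 - (LINT y|lborel. indicator {y. l < f y} y * heat_kernel t (x - y))"
      by (subst Bochner_Integration.integral_diff[OF integrable_heat_kernel_diff(1)[OF t] i1])
         (simp add: integrable_heat_kernel_diff(2)[OF t])
    finally show ?thesis using * by simp
  qed
  have "(m - l) * (1 - a * ?C) * (LINT x|lborel. ?w x) = (LINT x|lborel. (m - l) * (1 - a * ?C) * ?w x)"
    by simp
  also have "\<dots> \<le> (LINT x|lborel. (LINT y|lborel. ?Q x y))"
  proof (rule integral_mono)
    show "integrable lborel (\<lambda>x. (m - l) * (1 - a * ?C) * ?w x)" by (intro integrable_mult_right w)
    show "integrable lborel (\<lambda>x. LINT y|lborel. ?Q x y)" using lborel_pair.integrable_fst[OF Q] by simp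
    fix x
    have "(m - l) * ?w x * (1 - a * ?C) \<le> (m - l) * ?w x * (LINT y|lborel. indicator {y. f y \<le> l} y * heat_kernel t (x - y))"
      by (rule mult_left_mono[OF inner]) (use l in simp)
    also have "\<dots> = (LINT y|lborel. ?Q x y)"
      by (simp only: integral_mult_right_zero[symmetric] mult.assoc)
    finally show "(m - l) * (1 - a * ?C) * ?w x \<le> (LINT y|lborel. ?Q x y)" by (simp only: mult_ac)
  qed
  also note QH
  finally show "(m - l) * (1 - a * ?C) * (LINT x|lborel. ?w x) \<le> heat_form ?w t" .
qed

end

section \<open>Dissipation as an average of heat forms\<close>

context fourier_profile
begin

text \<open>A sup bound on Lambda^(2 \<alpha>) of the profile against the L1 norm of
  \<open>w\<close>; applied to the truncated square, it gives the upper bound on the loss that keeps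
  energies positive.\<close>

lemma
  fixes \<alpha> :: real
  assumes \<alpha>: "0 < \<alpha>" "\<alpha> < 1" and \<beta>: "\<beta> = \<bar>1 - 2 * \<alpha>\<bar>" and w: "integrable lborel w"
  shows integrable_laplacian_pairing: "integrable lborel (\<lambda>\<xi>. complex_of_real ((2 * pi * norm \<xi>) powr (2 * \<alpha>)) * g \<xi>
      * inverse_fourier_integral (\<lambda>x. complex_of_real (w x)) \<xi>)"
    and abs_dissipation_le: "\<bar>dissipation \<alpha> g w\<bar> \<le> (2 * pi) powr (2 * \<alpha>) * freq_norm \<beta> g * (LINT x|lborel. \<bar>w x\<bar>)"
proof -
  let ?W = "inverse_fourier_integral (\<lambda>x. complex_of_real (w x))"
  let ?m = "\<lambda>\<xi>. complex_of_real ((2 * pi * norm \<xi>) powr (2 * \<alpha>))"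
  have [measurable]: "w \<in> borel_measurable borel" using w by auto
  have m: "norm (?m \<xi>) \<le> (2 * pi) powr (2 * \<alpha>) * freq_weight \<beta> \<xi>" for \<xi> :: "real^'n"
    using laplacian_symbol_le[OF \<alpha>, of \<xi>] by (simp add: \<beta>)
  have W: "norm (?W \<xi>) \<le> (LINT x|lborel. \<bar>w x\<bar>)" for \<xi>
    using norm_inverse_fourier_integral_le[of "\<lambda>x. complex_of_real (w x)" \<xi>] by simp
  have mg: "integrable lborel (\<lambda>\<xi>. ?m \<xi> * g \<xi>)"
    by (rule integrable_multiplier[OF _ m]) measurable
  show int: "integrable lborel (\<lambda>\<xi>. ?m \<xi> * g \<xi> * ?W \<xi>)"
    by (rule integrable_mult_bounded[OF mg _ W]) measurable
  have "\<bar>dissipation \<alpha> g w\<bar> \<le> norm (LINT \<xi>|lborel. ?m \<xi> * g \<xi> * ?W \<xi>)"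
    unfolding dissipation_def by (rule abs_Re_le_cmod)
  also have "\<dots> \<le> (LINT \<xi>|lborel. norm (?m \<xi> * g \<xi>) * (LINT x|lborel. \<bar>w x\<bar>))"
  proof (rule Bochner_Integration.integral_norm_bound_integral[OF int])
    show "integrable lborel (\<lambda>\<xi>. norm (?m \<xi> * g \<xi>) * (LINT x|lborel. \<bar>w x\<bar>))"
      by (intro integrable_mult_left integrable_norm mg)
    show "norm (?m \<xi> * g \<xi> * ?W \<xi>) \<le> norm (?m \<xi> * g \<xi>) * (LINT x|lborel. \<bar>w x\<bar>)" for \<xi>
      unfolding norm_mult[of "?m \<xi> * g \<xi>"] by (rule mult_left_mono[OF W]) simp
  qed
  also have "\<dots> = (LINT \<xi>|lborel. norm (?m \<xi> * g \<xi>)) * (LINT x|lborel. \<bar>w x\<bar>)"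
    by (rule integral_mult_left_zero)
  also have "\<dots> \<le> (2 * pi) powr (2 * \<alpha>) * freq_norm \<beta> g * (LINT x|lborel. \<bar>w x\<bar>)"
    by (intro mult_right_mono integral_multiplier_le[OF _ m] Bochner_Integration.integral_nonneg; (measurable; fail | simp))
  finally show "\<bar>dissipation \<alpha> g w\<bar> \<le> (2 * pi) powr (2 * \<alpha>) * freq_norm \<beta> g * (LINT x|lborel. \<bar>w x\<bar>)" .
qed

text \<open>Fubini in frequency and time: for each \<xi> the time integral of (1 - heat symbol)
  t^(-1-\<alpha>) is the subordination constant times (2 pi |\<xi>|)^(2 \<alpha>), by
  \<open>integral_subordination\<close> with s = (2 pi |\<xi>|)^2.\<close>

lemma
  fixes \<alpha> :: real
  assumes \<alpha>: "0 < \<alpha>" "\<alpha> < 1" and \<beta>: "\<beta> = \<bar>1 - 2 * \<alpha>\<bar>" and w: "integrable lborel w"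
  shows integrable_heat_form: "integrable lborel (\<lambda>t. indicator {0<..} t * t powr (- 1 - \<alpha>) * heat_form w t)"
    and dissipation_eq_heat_form: "subordination_const \<alpha> * dissipation \<alpha> g w
      = (LINT t|lborel. indicator {0<..} t * t powr (- 1 - \<alpha>) * heat_form w t)"
proof -
  let ?W = "inverse_fourier_integral (\<lambda>x. complex_of_real (w x))"
  let ?k = "\<lambda>(\<xi>::real^'n) t. indicator {0<..} t * (1 - exp (- (t * (2 * pi * norm \<xi>)\<^sup>2))) * t powr (- 1 - \<alpha>) :: real"
  let ?K = "\<lambda>\<xi> t. complex_of_real (?k \<xi> t) * (g \<xi> * ?W \<xi>)"
  let ?p = "\<lambda>\<xi>::real^'n. (2 * pi * norm \<xi>) powr (2 * \<alpha>)"
  have [measurable]: "w \<in> borel_measurable borel" using w by auto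
  have Re_mult: "Re (complex_of_real r * z) = r * Re z" for r z by simp
  have k0: "0 \<le> ?k \<xi> t" for \<xi> t by (auto simp: indicator_def)
  have p: "((2 * pi * norm \<xi>)\<^sup>2) powr \<alpha> = ?p \<xi>" for \<xi> :: "real^'n"
  proof (cases "\<xi> = 0")
    case False
    then have "(2 * pi * norm \<xi>)\<^sup>2 = (2 * pi * norm \<xi>) powr 2" by simp
    then show ?thesis by (simp only: powr_powr)
  qed simp
  have k: "integrable lborel (?k \<xi>)" "(LINT t|lborel. ?k \<xi> t) = subordination_const \<alpha> * ?p \<xi>" for \<xi>
    using integrable_subordination[OF \<alpha>, of "(2 * pi * norm \<xi>)\<^sup>2"] integral_subordination[OF \<alpha>, of "(2 * pi * norm \<xi>)\<^sup>2"]
    by (simp_all only: p zero_le_power2)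
  have pgW: "integrable lborel (\<lambda>\<xi>. complex_of_real (?p \<xi>) * (g \<xi> * ?W \<xi>))"
    using integrable_laplacian_pairing[OF \<alpha> \<beta> w] by (simp only: mult.assoc)
  have K: "integrable (lborel \<Otimes>\<^sub>M lborel) (case_prod ?K)"
  proof (rule lborel_pair.Fubini_integrable)
    show "case_prod ?K \<in> borel_measurable (lborel \<Otimes>\<^sub>M lborel)" by measurable
    have "(LINT t|lborel. norm (case_prod ?K (\<xi>, t))) = subordination_const \<alpha> * norm (complex_of_real (?p \<xi>) * (g \<xi> * ?W \<xi>))" for \<xi>
    proof -
      have "norm (case_prod ?K (\<xi>, t)) = ?k \<xi> t * norm (g \<xi> * ?W \<xi>)" for t
        using k0[of t \<xi>] by (simp only: prod.case norm_mult norm_of_real abs_of_nonneg)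
      then show ?thesis by (simp only: integral_mult_left_zero k) (simp add: norm_mult)
    qed
    then show "integrable lborel (\<lambda>\<xi>. LINT t|lborel. norm (case_prod ?K (\<xi>, t)))"
      by (simp only:) (intro integrable_mult_right integrable_norm pgW)
    show "AE \<xi> in lborel. integrable lborel (\<lambda>t. case_prod ?K (\<xi>, t))"
      unfolding prod.case by (intro AE_I2 integrable_mult_left integrable_of_real k)
  qed
  have inner: "(LINT \<xi>|lborel. ?K \<xi> t) = complex_of_real (indicator {0<..} t * t powr (- 1 - \<alpha>))
      * (LINT \<xi>|lborel. complex_of_real (1 - heat_symbol t \<xi>) * (g \<xi> * ?W \<xi>))" for t
  proof -
    have "?K \<xi> t = complex_of_real (indicator {0<..} t * t powr (- 1 - \<alpha>)) * (complex_of_real (1 - heat_symbol t \<xi>) * (g \<xi> * ?W \<xi>))" for \<xi>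
      by (simp add: heat_symbol_def)
    then show ?thesis by (simp only: integral_mult_right_zero)
  qed
  have Re_inner: "Re (LINT \<xi>|lborel. ?K \<xi> t) = indicator {0<..} t * t powr (- 1 - \<alpha>) * heat_form w t" for t
    unfolding inner heat_form_def by (simp only: Re_mult)
  have int: "integrable lborel (\<lambda>t. LINT \<xi>|lborel. ?K \<xi> t)"
    by (rule lborel_pair.integrable_snd[OF K])
  show "integrable lborel (\<lambda>t. indicator {0<..} t * t powr (- 1 - \<alpha>) * heat_form w t)"
    using integrable_Re[OF int] unfolding Re_inner .
  have "complex_of_real (subordination_const \<alpha>) * (LINT \<xi>|lborel. complex_of_real (?p \<xi>) * (g \<xi> * ?W \<xi>))
      = (LINT \<xi>|lborel. complex_of_real (subordination_const \<alpha> * ?p \<xi>) * (g \<xi> * ?W \<xi>))"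
    by (simp only: integral_mult_right_zero[symmetric] of_real_mult mult.assoc)
  also have "\<dots> = (LINT \<xi>|lborel. (LINT t|lborel. ?K \<xi> t))"
    unfolding k(2)[symmetric] by (simp only: integral_mult_left_zero integral_complex_of_real)
  also have "\<dots> = (LINT t|lborel. (LINT \<xi>|lborel. ?K \<xi> t))"
    by (rule lborel_pair.Fubini_integral[OF K, symmetric])
  finally have "Re (complex_of_real (subordination_const \<alpha>) * (LINT \<xi>|lborel. complex_of_real (?p \<xi>) * (g \<xi> * ?W \<xi>)))
     = (LINT t|lborel. Re (LINT \<xi>|lborel. ?K \<xi> t))"
    by (simp only: integral_Re[OF int])
  then show "subordination_const \<alpha> * dissipation \<alpha> g w
      = (LINT t|lborel. indicator {0<..} t * t powr (- 1 - \<alpha>) * heat_form w t)"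
    unfolding Re_inner dissipation_def by (simp only: Re_mult mult.assoc)
qed

lemma dissipation_ge:
  fixes \<alpha> :: real
  assumes \<alpha>: "0 < \<alpha>" "\<alpha> < 1" and \<beta>: "\<beta> = \<bar>1 - 2 * \<alpha>\<bar>"
    and l: "0 < l" "l < m" and a: "0 < a" "measure lborel {x. l < f x} \<le> a"
  shows "(4 * pi) powr \<alpha> * 2 powr (- (2 * \<alpha> / real CARD('n))) / (2 * \<alpha> * subordination_const \<alpha>)
      * (m - l) * a powr (- (2 * \<alpha> / real CARD('n))) * (LINT x|lborel. excess m (f x))
    \<le> dissipation \<alpha> g (\<lambda>x. excess m (f x))"
proof -
  let ?n = "real CARD('n)" and ?c = "subordination_const \<alpha>"
  let ?w = "\<lambda>x. excess m (f x)" and ?E = "LINT x|lborel. excess m (f x)"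
  have n: "?n > 0" by simp
  have c: "0 < ?c" by (rule subordination_const_pos[OF \<alpha>])
  have w: "integrable lborel ?w" by (rule integrable_excess) (use l in simp)
  have E: "0 \<le> ?E" by (intro Bochner_Integration.integral_nonneg) simp
  \<comment> \<open>The time at which a (4 pi t)^(-n/2) equals 1/2. From then on at least half of
    the heat reaches the region at most \<open>l\<close>; earlier times contribute something
    nonnegative. Integrating t^(-1-\<alpha>) from \<open>t0\<close> gives t0^(-\<alpha>)/\<alpha>,
    the source of the power a^(-2 \<alpha>/n).\<close>
  define t0 where "t0 = (2 * a) powr (2 / ?n) / (4 * pi)"
  have t0: "t0 > 0" using a by (simp add: t0_def)
  have half: "(m - l) * (1 / 2) * ?E \<le> heat_form ?w t" if "t0 \<le> t" for t
  proof -
    have t: "0 < t" using t0 that by simp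
    have "(4 * pi * t) powr (- (?n / 2)) \<le> (4 * pi * t0) powr (- (?n / 2))"
      using that t0 by (intro powr_mono2') auto
    also have "4 * pi * t0 = (2 * a) powr (2 / ?n)" by (simp add: t0_def)
    also have "((2 * a) powr (2 / ?n)) powr (- (?n / 2)) = (2 * a) powr (-1)"
      using n by (simp add: powr_powr)
    also have "\<dots> = 1 / (2 * a)" using a by (simp add: powr_minus_divide)
    finally have "a * (4 * pi * t) powr (- (?n / 2)) \<le> a * (1 / (2 * a))"
      using a by (intro mult_left_mono) auto
    then have "1 / 2 \<le> 1 - a * (4 * pi * t) powr (- (?n / 2))" using a by simp
    then have "(m - l) * (1 / 2) * ?E \<le> (m - l) * (1 - a * (4 * pi * t) powr (- (?n / 2))) * ?E"
      using l E by (intro mult_right_mono mult_left_mono) auto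
    also have "\<dots> \<le> heat_form ?w t" by (rule heat_form_ge[OF l t a(2)])
    finally show ?thesis .
  qed
  have "(m - l) * (1 / 2) * ?E * (t0 powr (- \<alpha>) / \<alpha>)
      = (LINT t|lborel. (m - l) * (1 / 2) * ?E * (indicator {t0..} t * t powr (- 1 - \<alpha>)))"
    using integral_powr_to_inf[of "- 1 - \<alpha>" t0] \<alpha> t0 by simp
  also have "\<dots> \<le> (LINT t|lborel. indicator {0<..} t * t powr (- 1 - \<alpha>) * heat_form ?w t)"
  proof (rule integral_mono[OF _ integrable_heat_form[OF \<alpha> \<beta> w]])
    show "integrable lborel (\<lambda>t. (m - l) * (1 / 2) * ?E * (indicator {t0..} t * t powr (- 1 - \<alpha>)))"
      by (intro integrable_mult_right integrable_powr_to_inf t0) (use \<alpha> in simp)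
    fix t
    show "(m - l) * (1 / 2) * ?E * (indicator {t0..} t * t powr (- 1 - \<alpha>)) \<le> indicator {0<..} t * t powr (- 1 - \<alpha>) * heat_form ?w t"
    proof (cases "t0 \<le> t")
      case True
      from mult_right_mono[OF half[OF this], of "t powr (- 1 - \<alpha>)"]
      show ?thesis using True t0 by (simp add: mult_ac)
    next
      case False
      show ?thesis
      proof (cases "0 < t")
        case True
        with heat_form_nonneg[OF l this a(2)] show ?thesis using \<open>\<not> t0 \<le> t\<close> by simp
      qed (use False in simp)
    qed
  qed
  also have "\<dots> = ?c * dissipation \<alpha> g ?w" by (rule dissipation_eq_heat_form[OF \<alpha> \<beta> w, symmetric])
  finally have *: "(m - l) * (1 / 2) * ?E * (t0 powr (- \<alpha>) / \<alpha>) / ?c \<le> dissipation \<alpha> g ?w"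
    by (simp only: pos_divide_le_eq[OF c] mult.commute)
  have "t0 powr (- \<alpha>) = ((2 * a) powr (2 / ?n)) powr (- \<alpha>) / (4 * pi) powr (- \<alpha>)"
    unfolding t0_def by (rule powr_divide)
  also have "\<dots> = (4 * pi) powr \<alpha> * (2 * a) powr (- (2 * \<alpha> / ?n))"
    by (simp add: powr_powr powr_minus field_simps)
  also have "(2 * a) powr (- (2 * \<alpha> / ?n)) = 2 powr (- (2 * \<alpha> / ?n)) * a powr (- (2 * \<alpha> / ?n))"
    by (rule powr_mult)
  finally have t0_eq: "t0 powr (- \<alpha>) = (4 * pi) powr \<alpha> * (2 powr (- (2 * \<alpha> / ?n)) * a powr (- (2 * \<alpha> / ?n)))" .
  show ?thesis using * unfolding t0_eq by (simp add: mult_ac)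
qed

end

section \<open>Monotonicity from one-sided derivatives, and the iteration over levels\<close>

lemma nonincreasing_within:
  fixes F :: "real \<Rightarrow> real"
  assumes F: "\<And>T t. 0 < T \<Longrightarrow> t \<in> {0..T} \<Longrightarrow> (F has_real_derivative F' t) (at t within {0..T})"
    and le: "\<And>t. s \<le> t \<Longrightarrow> t \<le> r \<Longrightarrow> F' t \<le> 0" and s: "0 \<le> s" "s \<le> r"
  shows "F r \<le> F s"
proof (rule DERIV_nonpos_imp_decreasing_open[OF s(2)])
  show "\<exists>y. (F has_real_derivative y) (at x) \<and> y \<le> 0" if "s < x" "x < r" for x
  proof -
    have "(F has_real_derivative F' x) (at x within {0..r})"
      by (rule F) (use that s in auto)
    moreover have "at x within {0..r} = at x"
      using that s by (intro at_within_interior) (auto simp: interior_atLeastAtMost_real)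
    ultimately show ?thesis using le[of x] that by auto
  qed
  show "continuous_on {s..r} F"
    unfolding continuous_on_eq_continuous_within
  proof
    fix x assume x: "x \<in> {s..r}"
    \<comment> \<open>The interval is extended to r + 1 because the hypothesis needs a positive
      length and \<open>r\<close> may be 0.\<close>
    have "(F has_real_derivative F' x) (at x within {0..r + 1})"
      by (rule F) (use x s in auto)
    then have "(F has_real_derivative F' x) (at x within {s..r})"
      by (rule DERIV_subset) (use s in auto)
    then show "continuous (at x within {s..r}) F" by (rule DERIV_continuous)
  qed
qed

text \<open>A De Giorgi iteration: along levels increasing to \<open>M\<close> and times increasing to \<open>\<tau>\<close>, the
  value of \<open>F\<close> at each level is damped at a rate set by its value at the previous level; it decays
  geometrically once \<open>\<tau>\<close> is large, so that \<open>F M \<tau>\<close> vanishes.\<close>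

lemma level_cascade_contradiction:
  fixes F D :: "real \<Rightarrow> real \<Rightarrow> real"
  assumes pos: "0 < k" "0 < p" "0 < b" "0 < M"
    and F: "\<And>m T t. 0 < m \<Longrightarrow> m \<le> M \<Longrightarrow> 0 < T \<Longrightarrow> t \<in> {0..T} \<Longrightarrow> (F m has_real_derivative - D m t) (at t within {0..T})"
    and D: "\<And>l m t. 0 < l \<Longrightarrow> l < m \<Longrightarrow> m \<le> M \<Longrightarrow> 0 \<le> t \<Longrightarrow> k * (m - l) powr p * F l t powr (- b) * F m t \<le> D m t"
    and F_pos: "\<And>m t. 0 < m \<Longrightarrow> m \<le> M \<Longrightarrow> 0 \<le> t \<Longrightarrow> 0 < F m t"
    and F_mono: "\<And>l m t. 0 < l \<Longrightarrow> l \<le> m \<Longrightarrow> m \<le> M \<Longrightarrow> 0 \<le> t \<Longrightarrow> F m t \<le> F l t"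
  shows False
proof -
  have D0: "0 \<le> D m t" if "0 < m" "m \<le> M" "0 \<le> t" for m t
  proof -
    have "0 \<le> k * (m - m / 2) powr p * F (m / 2) t powr (- b) * F m t"
      using pos that F_pos[of m t] by (intro mult_nonneg_nonneg) auto
    also have "\<dots> \<le> D m t" by (rule D) (use that in auto)
    finally show ?thesis .
  qed
  have antimono: "F m t \<le> F m s" if "0 < m" "m \<le> M" "0 \<le> s" "s \<le> t" for m s t
    by (rule nonincreasing_within[of "F m" "\<lambda>t. - D m t"]) (use that F D0 in auto)
  \<comment> \<open>Since F l is nonincreasing in time, its negative power is nondecreasing, so the
    damping rate can be frozen at its value at time \<open>s\<close>; the integrating factor exp(r
    t) then gives exponential decay.\<close>
  have decay: "F m t \<le> F l s * exp (- (k * (m - l) powr p * F l s powr (- b) * (t - s)))"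
    if lm: "0 < l" "l < m" "m \<le> M" and st: "0 \<le> s" "s \<le> t" for l m s t
  proof -
    define r where "r = k * (m - l) powr p * F l s powr (- b)"
    have "F m t * exp (r * t) \<le> F m s * exp (r * s)"
    proof (rule nonincreasing_within[of "\<lambda>t. F m t * exp (r * t)" "\<lambda>t. (r * F m t - D m t) * exp (r * t)"])
      show "((\<lambda>t. F m t * exp (r * t)) has_real_derivative (r * F m u - D m u) * exp (r * u)) (at u within {0..T})"
        if "0 < T" "u \<in> {0..T}" for T u
        by (rule derivative_eq_intros F refl | use lm that in \<open>force\<close>)+ (simp add: algebra_simps)
      fix u assume u: "s \<le> u" "u \<le> t"
      have "F l s powr (- b) \<le> F l u powr (- b)"
        by (rule powr_mono2') (use pos lm st u antimono[of l s u] F_pos[of l u] in auto)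
      then have "r \<le> k * (m - l) powr p * F l u powr (- b)"
        unfolding r_def using pos by (intro mult_left_mono) auto
      then have "r * F m u \<le> k * (m - l) powr p * F l u powr (- b) * F m u"
        using F_pos[of m u] lm st u by (intro mult_right_mono) auto
      also have "\<dots> \<le> D m u" by (rule D) (use lm st u in auto)
      finally show "(r * F m u - D m u) * exp (r * u) \<le> 0" by (simp add: mult_nonpos_nonneg)
    qed (use st in auto)
    then have "F m t * exp (r * t) * exp (- (r * t)) \<le> F m s * exp (r * s) * exp (- (r * t))"
      by (rule mult_right_mono) simp
    then have "F m t \<le> F m s * exp (- (r * (t - s)))"
      by (simp add: mult.assoc exp_add[symmetric] right_diff_distrib)
    also have "\<dots> \<le> F l s * exp (- (r * (t - s)))"
      using F_mono[of l m s] lm st by (intro mult_right_mono) auto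
    finally show ?thesis unfolding r_def .
  qed
  \<comment> \<open>The factor gained per step. Since B^b = 2^(p + 1), the gain in the damping rate
    makes up exactly for the loss 2^(-p) in the level gap and 1/2 in the time gap.\<close>
  define B where "B = 2 powr ((p + 1) / b)"
  have B: "B > 1" using pos by (simp add: B_def gr_one_powr)
  \<comment> \<open>The start at \<open>M / 2\<close> keeps every level positive, as the estimate of
    \<open>D\<close> requires.\<close>
  define lev where "lev j = M * (1 - 2 powr (- real (Suc j)))" for j
  define \<epsilon>0 where "\<epsilon>0 = F (M / 2) 0"
  have \<epsilon>0: "\<epsilon>0 > 0" unfolding \<epsilon>0_def by (rule F_pos) (use pos in auto)
  \<comment> \<open>The exponent in \<open>decay\<close>, with \<open>F\<close> replaced by its
    inductive bound, is q times the total time \<tau>: the powers of 2 multiply to 2^(-(j+2)p)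
    2^(j(p+1)) 2^(-(j+1)) = 2^(-(2p+1)) for every j. With \<tau> = ln B / q each step therefore
    divides the bound by at least \<open>B\<close>.\<close>
  define q where "q = k * M powr p * \<epsilon>0 powr (- b) * 2 powr (- (2 * p + 1))"
  have q: "q > 0" using pos \<epsilon>0 by (simp add: q_def)
  define \<tau> where "\<tau> = ln B / q"
  have \<tau>: "\<tau> > 0" using B q by (simp add: \<tau>_def)
  define tm where "tm j = \<tau> * (1 - 2 powr (- real j))" for j
  have two: "2 powr (- real (Suc j)) = 2 powr (- real j) / 2" for j
  proof -
    have "- real (Suc j) = - real j - 1" by simp
    then show ?thesis by (simp only: powr_diff) simp
  qed
  have twole: "2 powr (- real j) \<le> 1" for j
    using powr_mono[of "- real j" 0 "2::real"] by simp
  have lev: "0 < lev j" "lev j < M" "lev j < lev (Suc j)" "lev (Suc j) - lev j = M * 2 powr (- real (j + 2))" for j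
    using pos twole[of j] two[of j] two[of "Suc j"]
    by (auto simp: lev_def algebra_simps)
  have tm: "0 \<le> tm j" "tm j \<le> \<tau>" "tm j \<le> tm (Suc j)" "tm (Suc j) - tm j = \<tau> * 2 powr (- real (Suc j))" for j
    using \<tau> twole[of j] two[of j] by (auto simp: tm_def algebra_simps)
  have bound: "F (lev j) (tm j) \<le> \<epsilon>0 * B powr (- real j)" for j
  proof (induction j)
    case 0
    then show ?case using B by (simp add: lev_def tm_def \<epsilon>0_def powr_minus_divide)
  next
    case (Suc j)
    let ?e = "F (lev j) (tm j)"
    have e: "?e > 0" by (rule F_pos) (use lev[of j] tm[of j] in auto)
    have "(\<epsilon>0 * B powr (- real j)) powr (- b) \<le> ?e powr (- b)"
      by (rule powr_mono2') (use pos e Suc in auto)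
    moreover have "(\<epsilon>0 * B powr (- real j)) powr (- b) = \<epsilon>0 powr (- b) * 2 powr (real j * (p + 1))"
      using \<epsilon>0 pos by (simp add: powr_mult B_def powr_powr mult.commute)
    ultimately have eb: "\<epsilon>0 powr (- b) * 2 powr (real j * (p + 1)) \<le> ?e powr (- b)" by simp
    have "ln B = q * \<tau>" using q by (simp add: \<tau>_def)
    also have "\<dots> = k * (M powr p * 2 powr (- (real (j + 2) * p))) * (\<epsilon>0 powr (- b) * 2 powr (real j * (p + 1))) * (\<tau> * 2 powr (- real (Suc j)))"
    proof -
      have "2 powr (- (real (j + 2) * p)) * 2 powr (real j * (p + 1)) * 2 powr (- real (Suc j)) = (2::real) powr (- (2 * p + 1))"
        by (simp add: powr_add[symmetric] algebra_simps)
      then show ?thesis unfolding q_def by (simp add: mult_ac)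
    qed
    also have "M powr p * 2 powr (- (real (j + 2) * p)) = (lev (Suc j) - lev j) powr p"
    proof -
      have "(2 powr (- real (j + 2))) powr p = (2::real) powr (- (real (j + 2) * p))"
        unfolding powr_powr by (simp add: algebra_simps)
      then show ?thesis unfolding lev by (simp only: powr_mult)
    qed
    also have "k * (lev (Suc j) - lev j) powr p * (\<epsilon>0 powr (- b) * 2 powr (real j * (p + 1))) * (\<tau> * 2 powr (- real (Suc j)))
      \<le> k * (lev (Suc j) - lev j) powr p * ?e powr (- b) * (tm (Suc j) - tm j)"
      unfolding tm using eb pos \<tau> by (intro mult_right_mono mult_left_mono) auto
    finally have rate: "ln B \<le> k * (lev (Suc j) - lev j) powr p * ?e powr (- b) * (tm (Suc j) - tm j)" .
    have "F (lev (Suc j)) (tm (Suc j)) \<le> ?e * exp (- (k * (lev (Suc j) - lev j) powr p * ?e powr (- b) * (tm (Suc j) - tm j)))"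
      by (rule decay) (use lev[of j] lev[of "Suc j"] tm[of j] in auto)
    also have "\<dots> \<le> (\<epsilon>0 * B powr (- real j)) * exp (- ln B)"
      using rate Suc e by (intro mult_mono) auto
    also have "exp (- ln B) = B powr (- 1)" using B by (simp add: powr_def)
    also have "(\<epsilon>0 * B powr (- real j)) * B powr (- 1) = \<epsilon>0 * B powr (- real (Suc j))"
    proof -
      have "- real (Suc j) = - real j + - 1" by simp
      then show ?thesis by (simp only: powr_add mult.assoc)
    qed
    finally show ?case .
  qed
  \<comment> \<open>The pair (M, \<tau>) lies above every level and after every time of the
    sequence, so all the bounds apply to it at once.\<close>
  have "F M \<tau> \<le> \<epsilon>0 * B powr (- real j)" for j
  proof -
    have "F M \<tau> \<le> F (lev j) \<tau>" by (rule F_mono) (use lev[of j] \<tau> in auto)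
    also have "\<dots> \<le> F (lev j) (tm j)" by (rule antimono) (use lev[of j] tm[of j] in auto)
    finally show ?thesis using bound[of j] by simp
  qed
  moreover have "(\<lambda>j. \<epsilon>0 * B powr (- real j)) \<longlonglongrightarrow> 0"
    using B by real_asymp
  ultimately have "F M \<tau> \<le> 0"
    by (intro LIMSEQ_le_const[of _ 0]) auto
  with F_pos[of M \<tau>] pos \<tau> show False by simp
qed

section \<open>Energies above a level along a solution\<close>

lemma freq_norm_diff_le:
  assumes [measurable]: "g \<in> borel_measurable borel" "h \<in> borel_measurable borel"
    and g: "integrable lborel (\<lambda>\<xi>. freq_weight \<beta> \<xi> * norm (g \<xi>))"
    and h: "integrable lborel (\<lambda>\<xi>. freq_weight \<beta> \<xi> * norm (h \<xi>))"
  shows "integrable lborel (\<lambda>\<xi>. freq_weight \<beta> \<xi> * norm (g \<xi> - h \<xi>))"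
    and "\<bar>freq_norm \<beta> g - freq_norm \<beta> h\<bar> \<le> freq_norm \<beta> (\<lambda>\<xi>. g \<xi> - h \<xi>)"
proof -
  have le: "freq_weight \<beta> \<xi> * norm (g \<xi> - h \<xi>) \<le> freq_weight \<beta> \<xi> * norm (g \<xi>) + freq_weight \<beta> \<xi> * norm (h \<xi>)" for \<xi>
    using mult_left_mono[OF norm_triangle_ineq4[of "g \<xi>" "h \<xi>"] freq_weight_nonneg[of \<beta> \<xi>]] by (simp add: distrib_left)
  show gh: "integrable lborel (\<lambda>\<xi>. freq_weight \<beta> \<xi> * norm (g \<xi> - h \<xi>))"
    by (rule Bochner_Integration.integrable_bound[OF Bochner_Integration.integrable_add[OF g h]])
       (use le in \<open>auto simp: abs_mult intro: order_trans[OF _ abs_ge_self]\<close>)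
  have "\<bar>freq_norm \<beta> g - freq_norm \<beta> h\<bar> = \<bar>LINT \<xi>|lborel. freq_weight \<beta> \<xi> * norm (g \<xi>) - freq_weight \<beta> \<xi> * norm (h \<xi>)\<bar>"
    unfolding freq_norm_def by (subst Bochner_Integration.integral_diff[OF g h]) simp
  also have "\<dots> \<le> (LINT \<xi>|lborel. \<bar>freq_weight \<beta> \<xi> * norm (g \<xi>) - freq_weight \<beta> \<xi> * norm (h \<xi>)\<bar>)"
    by (rule integral_abs_bound)
  also have "\<dots> \<le> freq_norm \<beta> (\<lambda>\<xi>. g \<xi> - h \<xi>)"
    unfolding freq_norm_def
  proof (rule integral_mono)
    show "integrable lborel (\<lambda>\<xi>. \<bar>freq_weight \<beta> \<xi> * norm (g \<xi>) - freq_weight \<beta> \<xi> * norm (h \<xi>)\<bar>)"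
      by (intro integrable_abs Bochner_Integration.integrable_diff g h)
    show "\<bar>freq_weight \<beta> \<xi> * norm (g \<xi>) - freq_weight \<beta> \<xi> * norm (h \<xi>)\<bar> \<le> freq_weight \<beta> \<xi> * norm (g \<xi> - h \<xi>)" for \<xi>
      unfolding right_diff_distrib[symmetric] abs_mult
      by (simp add: mult_left_mono norm_triangle_ineq3)
  qed (rule gh)
  finally show "\<bar>freq_norm \<beta> g - freq_norm \<beta> h\<bar> \<le> freq_norm \<beta> (\<lambda>\<xi>. g \<xi> - h \<xi>)" .
qed

text \<open>Inversion for the two continuous slices; it converts closeness in time of the transforms
  into uniform closeness in space.\<close>

lemma profile_diff_le:
  assumes "fourier_profile f1 g1 \<beta>" "fourier_profile f2 g2 \<beta>"
  shows "\<bar>f1 x - f2 x\<bar> \<le> freq_norm \<beta> (\<lambda>\<xi>. g1 \<xi> - g2 \<xi>)"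
proof -
  interpret p1: fourier_profile f1 g1 \<beta> by fact
  interpret p2: fourier_profile f2 g2 \<beta> by fact
  have "complex_of_real (f1 x - f2 x) = inverse_fourier_integral (\<lambda>\<xi>. g1 \<xi> - g2 \<xi>) x"
    unfolding of_real_diff p1.inversion[symmetric] p2.inversion[symmetric] inverse_fourier_integral_def right_diff_distrib
    by (rule Bochner_Integration.integral_diff[symmetric]) (intro integrable_cis_mult' p1.integrable_g p2.integrable_g)+
  then have "\<bar>f1 x - f2 x\<bar> = norm (inverse_fourier_integral (\<lambda>\<xi>. g1 \<xi> - g2 \<xi>) x)"
    by (metis norm_of_real)
  also have "\<dots> \<le> (LINT \<xi>|lborel. norm (g1 \<xi> - g2 \<xi>))"
    by (rule norm_inverse_fourier_integral_le)
  also have "\<dots> \<le> freq_norm \<beta> (\<lambda>\<xi>. g1 \<xi> - g2 \<xi>)"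
    unfolding freq_norm_def
  proof (rule integral_mono)
    show "integrable lborel (\<lambda>\<xi>. norm (g1 \<xi> - g2 \<xi>))"
      by (intro integrable_norm Bochner_Integration.integrable_diff p1.integrable_g p2.integrable_g)
    show "integrable lborel (\<lambda>\<xi>. freq_weight \<beta> \<xi> * norm (g1 \<xi> - g2 \<xi>))"
      by (intro freq_norm_diff_le p1.measurable_g p2.measurable_g p1.int_weight_g p2.int_weight_g)
    show "norm (g1 \<xi> - g2 \<xi>) \<le> freq_weight \<beta> \<xi> * norm (g1 \<xi> - g2 \<xi>)" for \<xi>
      using mult_right_mono[OF freq_weight_ge_1[of \<beta> \<xi>] norm_ge_zero[of "g1 \<xi> - g2 \<xi>"]] by simp
  qed
  finally show ?thesis .
qed

locale active_scalar =
  fixes \<alpha> :: real and \<theta>0 :: "real^'n::finite \<Rightarrow> real" and \<theta> :: "real \<Rightarrow> real^'n \<Rightarrow> real"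
  assumes dim: "CARD('n) \<ge> 2" and \<alpha>: "0 < \<alpha>" "\<alpha> < 1"
    and solution: "smooth_global_solution \<alpha> \<theta>0 \<theta>"
begin

abbreviation "\<beta> \<equiv> \<bar>1 - 2 * \<alpha>\<bar>"

text \<open>For 0 < \<alpha> < 1 the number |1 - 2 \<alpha>| is below 1, hence 2 \<beta> < 2 <=
  n.\<close>

lemma \<beta>: "0 \<le> \<beta>" "2 * \<beta> < real CARD('n)"
proof -
  have "real 2 \<le> real CARD('n)" using dim by (simp only: of_nat_le_iff)
  then show "0 \<le> \<beta>" "2 * \<beta> < real CARD('n)" using \<alpha> by (auto simp: abs_if)
qed

lemma C1: "0 < T \<Longrightarrow> C1_sobolev (real CARD('n) + 2) T \<theta>"
  using solution unfolding smooth_global_solution_def smooth_solution_def by auto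

lemma transport:
  assumes "0 < T" "t \<in> {0..T}"
  obtains v G where "\<And>x. ((\<lambda>\<tau>. \<theta> \<tau> x) has_real_derivative v x) (at t within {0..T})"
    "\<And>x. GDERIV (\<theta> t) x :> G x" "\<And>x. v x + velocity \<alpha> (\<theta> t) x \<bullet> G x = 0"
proof -
  have "\<forall>x. \<exists>v G. ((\<lambda>\<tau>. \<theta> \<tau> x) has_real_derivative v) (at t within {0..T}) \<and>
        GDERIV (\<theta> t) x :> G \<and> v + velocity \<alpha> (\<theta> t) x \<bullet> G = 0"
    using solution assms unfolding smooth_global_solution_def smooth_solution_def by blast
  then show ?thesis by (metis that)
qed

lemma in_sobolev: "0 \<le> t \<Longrightarrow> in_sobolev (real CARD('n) + 2) (\<theta> t)"
  using C1[of "t + 1"] unfolding C1_sobolev_def by auto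

lemma profile:
  assumes "0 \<le> t"
  shows "fourier_profile (\<theta> t) (fourier_L2 (\<theta> t)) \<beta>"
proof
  show "is_fourier_L2 (\<lambda>x. complex_of_real (\<theta> t x)) (fourier_L2 (\<theta> t))"
    by (rule in_sobolevD(1)[OF in_sobolev[OF assms]])
  show "integrable lborel (\<lambda>\<xi>. freq_weight \<beta> \<xi> * norm (fourier_L2 (\<theta> t) \<xi>))"
  proof -
    obtain K where "\<And>f :: real^'n \<Rightarrow> real. in_sobolev (real CARD('n) + 2) f \<Longrightarrow>
        integrable lborel (\<lambda>\<xi>. freq_weight \<beta> \<xi> * norm (fourier_L2 f \<xi>)) \<and>
        freq_norm \<beta> (fourier_L2 f) \<le> K * sobolev_norm (real CARD('n) + 2) f"
      by (rule freq_norm_sobolev[where 'n='n, OF \<beta>]) blast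
    then show ?thesis using in_sobolev[OF assms] by blast
  qed
  show "isCont (\<theta> t) x" for x
  proof -
    have "0 < t + 1" "t \<in> {0..t + 1}" using assms by auto
    then obtain v G where "\<And>x. GDERIV (\<theta> t) x :> G x"
      by (rule transport) blast
    then show ?thesis by (rule GDERIV_imp_isCont)
  qed
qed

lemma time_lipschitz:
  assumes "0 < T" "t \<in> {0..T}"
  obtains L where "0 \<le> L"
    "\<forall>\<^sub>F \<tau> in at t within {0..T}. freq_norm \<beta> (\<lambda>\<xi>. fourier_L2 (\<theta> \<tau>) \<xi> - fourier_L2 (\<theta> t) \<xi>) \<le> L * \<bar>\<tau> - t\<bar>"
  by (rule freq_norm_C1_sobolev[OF \<beta> C1[OF assms(1)] assms(2)])

text \<open>The Lipschitz constants depend on the time, but they give continuity at each time, and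
  compactness of the interval does the rest.\<close>

lemma freq_norm_bounded:
  assumes "0 < T"
  obtains C where "\<And>t. t \<in> {0..T} \<Longrightarrow> freq_norm \<beta> (fourier_L2 (\<theta> t)) \<le> C"
proof -
  let ?N = "\<lambda>t. freq_norm \<beta> (fourier_L2 (\<theta> t))"
  have "continuous_on {0..T} ?N"
    unfolding continuous_on_eq_continuous_within
  proof
    fix t assume t: "t \<in> {0..T}"
    obtain L where L: "0 \<le> L"
      "\<forall>\<^sub>F \<tau> in at t within {0..T}. freq_norm \<beta> (\<lambda>\<xi>. fourier_L2 (\<theta> \<tau>) \<xi> - fourier_L2 (\<theta> t) \<xi>) \<le> L * \<bar>\<tau> - t\<bar>"
      by (rule time_lipschitz[OF assms t])
    have "((\<lambda>\<tau>. L * \<bar>\<tau> - t\<bar>) \<longlongrightarrow> L * \<bar>t - t\<bar>) (at t within {0..T})"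
      by (intro tendsto_intros)
    then have lim: "((\<lambda>\<tau>. L * \<bar>\<tau> - t\<bar>) \<longlongrightarrow> 0) (at t within {0..T})" by simp
    have "\<forall>\<^sub>F \<tau> in at t within {0..T}. \<tau> \<in> {0..T}"
      by (simp add: eventually_at_filter)
    with L(2) have "\<forall>\<^sub>F \<tau> in at t within {0..T}. norm (?N \<tau> - ?N t) \<le> L * \<bar>\<tau> - t\<bar>"
    proof eventually_elim
      case (elim \<tau>)
      interpret p1: fourier_profile "\<theta> \<tau>" "fourier_L2 (\<theta> \<tau>)" \<beta> by (rule profile) (use elim in simp)
      interpret p2: fourier_profile "\<theta> t" "fourier_L2 (\<theta> t)" \<beta> by (rule profile) (use t in simp)
      show ?case
        using freq_norm_diff_le(2)[OF p1.measurable_g p2.measurable_g p1.int_weight_g p2.int_weight_g] elim(1) by simp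
    qed
    from Lim_null_comparison[OF this lim] have "((\<lambda>\<tau>. ?N \<tau> - ?N t) \<longlongrightarrow> 0) (at t within {0..T})" .
    then show "continuous (at t within {0..T}) ?N"
      unfolding continuous_within by (simp add: LIM_zero_iff)
  qed
  then have "bounded (?N ` {0..T})"
    by (intro compact_imp_bounded compact_continuous_image compact_Icc)
  then obtain C where "\<forall>t\<in>{0..T}. \<bar>?N t\<bar> \<le> C"
    unfolding bounded_iff by auto
  then show ?thesis by (intro that[of C]) (auto simp: abs_le_iff)
qed

definition energy :: "real \<Rightarrow> real \<Rightarrow> real" where
  "energy m t = (LINT x|lborel. excess m (\<theta> t x))"

definition loss :: "real \<Rightarrow> real \<Rightarrow> real" where
  "loss m t = dissipation \<alpha> (fourier_L2 (\<theta> t)) (\<lambda>x. excess m (\<theta> t x))"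

text \<open>Differentiation under the integral. The pointwise limit comes from the equation at each
  \<open>x\<close>; domination comes from the uniform Lipschitz bound at time \<open>t\<close>,
  together with the finite measure of the set where \<theta> exceeds m / 2.\<close>

lemma energy_has_derivative:
  assumes m: "0 < m" and T: "0 < T" and t: "t \<in> {0..T}"
  shows "(energy m has_real_derivative - loss m t) (at t within {0..T})"
proof -
  obtain v G where v: "\<And>x. ((\<lambda>\<tau>. \<theta> \<tau> x) has_real_derivative v x) (at t within {0..T})"
    and G: "\<And>x. GDERIV (\<theta> t) x :> G x" and eq: "\<And>x. v x + velocity \<alpha> (\<theta> t) x \<bullet> G x = 0"
    by (rule transport[OF T t]) blast
  interpret fourier_profile "\<theta> t" "fourier_L2 (\<theta> t)" \<beta> by (rule profile) (use t in simp)
  obtain L where L: "0 \<le> L"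
    "\<forall>\<^sub>F \<tau> in at t within {0..T}. freq_norm \<beta> (\<lambda>\<xi>. fourier_L2 (\<theta> \<tau>) \<xi> - fourier_L2 (\<theta> t) \<xi>) \<le> L * \<bar>\<tau> - t\<bar>"
    by (rule time_lipschitz[OF T t])
  let ?M = "freq_norm \<beta> (fourier_L2 (\<theta> t)) + 1"
  have M: "0 \<le> ?M" using freq_norm_nonneg[of \<beta> "fourier_L2 (\<theta> t)"] by simp
  let ?B = "\<lambda>x. 2 * ?M * L * indicator {x. m / 2 < \<theta> t x} x"
  let ?q = "\<lambda>\<tau> x. (excess m (\<theta> \<tau> x) - excess m (\<theta> t x)) / (\<tau> - t)"
  let ?d = "\<lambda>x. 2 * max 0 (\<theta> t x - m) * v x"
  have B: "integrable lborel ?B"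
    by (intro integrable_mult_right integrable_superlevel) (use m in simp)
  have "((\<lambda>\<tau>. L * \<bar>\<tau> - t\<bar>) \<longlongrightarrow> L * \<bar>t - t\<bar>) (at t within {0..T})"
    by (intro tendsto_intros)
  \<comment> \<open>The bound m / 2 keeps points with \<theta> at most m / 2 at time
    \<open>t\<close> below the level \<open>m\<close>, where the quotient vanishes; the bound 1 is
    the slack contained in \<open>?M\<close>.\<close>
  then have "\<forall>\<^sub>F \<tau> in at t within {0..T}. L * \<bar>\<tau> - t\<bar> < min 1 (m / 2)"
    using m by (intro order_tendstoD(2)) auto
  moreover have "\<forall>\<^sub>F \<tau> in at t within {0..T}. \<tau> \<in> {0..T} \<and> \<tau> \<noteq> t"
    by (simp add: eventually_at_filter)
  ultimately have ev: "\<forall>\<^sub>F \<tau> in at t within {0..T}. \<forall>x. \<bar>?q \<tau> x\<bar> \<le> ?B x"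
    using L(2)
  proof eventually_elim
    case (elim \<tau>)
    show ?case
    proof
      fix x
      have d: "\<bar>\<theta> \<tau> x - \<theta> t x\<bar> \<le> L * \<bar>\<tau> - t\<bar>"
        using profile_diff_le[OF profile profile, of \<tau> t x] elim t by auto
      show "\<bar>?q \<tau> x\<bar> \<le> ?B x"
      proof (cases "m / 2 < \<theta> t x")
        case True
        have "\<bar>\<theta> \<tau> x - \<theta> t x\<bar> < 1" using d elim by simp
        then have le_M: "\<bar>\<theta> \<tau> x\<bar> \<le> ?M" using bounded_f[of x] by linarith
        have "\<bar>excess m (\<theta> \<tau> x) - excess m (\<theta> t x)\<bar> \<le> 2 * ?M * \<bar>\<theta> \<tau> x - \<theta> t x\<bar>"
          by (rule excess_diff_le) (use m le_M bounded_f[of x] in auto)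
        also have "\<dots> \<le> 2 * ?M * (L * \<bar>\<tau> - t\<bar>)" by (rule mult_left_mono[OF d]) (use M in simp)
        finally have "\<bar>excess m (\<theta> \<tau> x) - excess m (\<theta> t x)\<bar> / \<bar>\<tau> - t\<bar> \<le> 2 * ?M * L"
          using elim by (simp add: divide_le_eq mult.assoc)
        then show ?thesis using True by (simp add: abs_divide)
      next
        case False
        then have "\<theta> t x \<le> m" "\<theta> \<tau> x \<le> m" using d elim m by auto
        then show ?thesis using False by (simp add: excess_eq_0_iff[THEN iffD2])
      qed
    qed
  qed
  have q_lim: "((\<lambda>\<tau>. ?q \<tau> x) \<longlongrightarrow> ?d x) (at t within {0..T})" for x
    using DERIV_chain2[OF DERIV_excess v, of m x] by (simp add: has_field_derivative_iff)
  have "((\<lambda>\<tau>. (energy m \<tau> - energy m t) / (\<tau> - t)) \<longlongrightarrow> (LINT x|lborel. ?d x)) (at t within {0..T})"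
    \<comment> \<open>Dominated convergence is applied along sequences of times, after dropping the
      finitely many that are not yet close to \<open>t\<close>.\<close>
    unfolding tendsto_at_iff_sequentially comp_def
  proof (intro allI impI)
    fix X :: "nat \<Rightarrow> real" assume X: "\<forall>i. X i \<in> {0..T} - {t}" and Xt: "X \<longlonglongrightarrow> t"
    have fX: "filterlim X (at t within {0..T}) sequentially"
      using X Xt by (auto simp: filterlim_at)
    from eventually_compose_filterlim[OF ev fX]
    obtain N where N: "\<And>k. N \<le> k \<Longrightarrow> \<forall>x. \<bar>?q (X k) x\<bar> \<le> ?B x"
      by (auto simp: eventually_sequentially)
    have X': "0 \<le> X k" for k using X by auto
    have [measurable]: "(\<lambda>x. ?q (X k) x) \<in> borel_measurable borel" for k
    proof -
      interpret Xk: fourier_profile "\<theta> (X k)" "fourier_L2 (\<theta> (X k))" \<beta> by (rule profile[OF X'])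
      show ?thesis by measurable
    qed
    have qX: "(\<lambda>k. ?q (X k) x) \<longlonglongrightarrow> ?d x" for x
      by (rule filterlim_compose[OF q_lim fX])
    have [measurable]: "?d \<in> borel_measurable borel"
      by (rule borel_measurable_LIMSEQ_real[OF qX]) measurable
    have "(\<lambda>k. LINT x|lborel. ?q (X (k + N)) x) \<longlonglongrightarrow> (LINT x|lborel. ?d x)"
    proof (rule integral_dominated_convergence[where w="?B"])
      show "AE x in lborel. (\<lambda>k. ?q (X (k + N)) x) \<longlonglongrightarrow> ?d x"
        by (intro AE_I2 LIMSEQ_ignore_initial_segment[OF qX])
      show "AE x in lborel. norm (?q (X (k + N)) x) \<le> ?B x" for k
        using N[of "k + N"] by (intro AE_I2) simp
    qed (use B in measurable)
    moreover have "(LINT x|lborel. ?q (X k) x) = (energy m (X k) - energy m t) / (X k - t)" for k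
    proof -
      interpret Xk: fourier_profile "\<theta> (X k)" "fourier_L2 (\<theta> (X k))" \<beta> by (rule profile[OF X'])
      show ?thesis
        unfolding energy_def using Bochner_Integration.integral_diff[OF Xk.integrable_excess[OF m] integrable_excess[OF m]]
        by simp
    qed
    ultimately have "(\<lambda>k. (energy m (X (k + N)) - energy m t) / (X (k + N) - t)) \<longlonglongrightarrow> (LINT x|lborel. ?d x)"
      by (simp only:)
    then show "(\<lambda>k. (energy m (X k) - energy m t) / (X k - t)) \<longlonglongrightarrow> (LINT x|lborel. ?d x)"
      by (rule LIMSEQ_offset)
  qed
  moreover have "(LINT x|lborel. ?d x) = - loss m t"
  proof -
    have dq: "?d x = - (2 * max 0 (\<theta> t x - m) * (velocity \<alpha> (\<theta> t) x \<bullet> G x))" for x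
      using eq[of x] by (simp add: eq_neg_iff_add_eq_0[symmetric])
    show ?thesis
      unfolding dq loss_def transport_integral[OF \<alpha> fourier_profile_axioms G m, symmetric]
      by (rule Bochner_Integration.integral_minus)
  qed
  ultimately show ?thesis by (simp add: has_field_derivative_iff)
qed

lemma energy_nonneg: "0 \<le> energy m t"
  unfolding energy_def by (intro Bochner_Integration.integral_nonneg) simp

lemma energy_mono:
  assumes "0 < l" "l \<le> m" "0 \<le> t"
  shows "energy m t \<le> energy l t"
proof -
  interpret fourier_profile "\<theta> t" "fourier_L2 (\<theta> t)" \<beta> by (rule profile[OF assms(3)])
  show ?thesis
    unfolding energy_def
    by (rule integral_mono) (use assms in \<open>auto intro: integrable_excess excess_mono\<close>)
qed

text \<open>By continuity the set where the initial value exceeds \<open>m\<close> is open, and it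
  contains \<open>x0\<close>, so it is not null.\<close>

lemma energy_initial_pos:
  assumes "0 < m" "m < \<theta>0 x0"
  shows "0 < energy m 0"
proof -
  interpret fourier_profile "\<theta> 0" "fourier_L2 (\<theta> 0)" \<beta> by (rule profile) simp
  have 0: "\<theta> 0 x0 = \<theta>0 x0"
    using solution zero_less_one unfolding smooth_global_solution_def smooth_solution_def by blast
  have int: "integrable lborel (\<lambda>x. excess m (\<theta> 0 x))" by (rule integrable_excess[OF assms(1)])
  have "energy m 0 \<noteq> 0"
  proof
    assume "energy m 0 = 0"
    then have ae: "AE x in lborel. excess m (\<theta> 0 x) = 0"
      unfolding energy_def by (subst (asm) integral_nonneg_eq_0_iff_AE[OF int]) auto
    have op: "open {x. m < \<theta> 0 x}"
      using cont by (intro open_Collect_less continuous_on_const) (simp add: continuous_on_eq_continuous_at)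
    have "AE x in lborel. x \<notin> {x. m < \<theta> 0 x}"
      using ae by eventually_elim (simp add: excess_eq_0_iff)
    then have "{x. m < \<theta> 0 x} \<in> null_sets lborel"
      using op by (subst (asm) AE_iff_null) auto
    then have "negligible {x. m < \<theta> 0 x}"
      by (simp add: negligible_iff_null_sets null_sets_completionI)
    moreover have "x0 \<in> {x. m < \<theta> 0 x}" using assms 0 by simp
    ultimately show False using open_not_negligible[OF op] by blast
  qed
  then show ?thesis using energy_nonneg[of m 0] by simp
qed

text \<open>Gronwall from below: the rate \<open>r\<close> comes from the bound on
  \<open>freq_norm\<close> over a compact time interval and may grow with \<open>t\<close>, but
  positivity at time \<open>t\<close> is all that is claimed.\<close>

lemma energy_pos:
  assumes m: "0 < m" "m < \<theta>0 x0" and t: "0 \<le> t"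
  shows "0 < energy m t"
proof -
  obtain C where C: "\<And>s. s \<in> {0..t + 1} \<Longrightarrow> freq_norm \<beta> (fourier_L2 (\<theta> s)) \<le> C"
    using freq_norm_bounded[of "t + 1"] t by auto
  define r where "r = (2 * pi) powr (2 * \<alpha>) * C"
  have loss: "loss m s \<le> r * energy m s" if "s \<in> {0..t}" for s
  proof -
    interpret fourier_profile "\<theta> s" "fourier_L2 (\<theta> s)" \<beta> by (rule profile) (use that in simp)
    have "loss m s \<le> (2 * pi) powr (2 * \<alpha>) * freq_norm \<beta> (fourier_L2 (\<theta> s)) * energy m s"
      using abs_dissipation_le[OF \<alpha> refl integrable_excess[OF m(1)]] by (simp add: loss_def energy_def)
    also have "\<dots> \<le> r * energy m s"
      unfolding r_def using C[of s] that by (intro mult_right_mono mult_left_mono energy_nonneg) auto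
    finally show ?thesis .
  qed
  have "- (energy m t * exp (r * t)) \<le> - (energy m 0 * exp (r * 0))"
  proof (rule nonincreasing_within[of "\<lambda>s. - (energy m s * exp (r * s))" "\<lambda>s. (loss m s - r * energy m s) * exp (r * s)"])
    show "((\<lambda>s. - (energy m s * exp (r * s))) has_real_derivative (loss m u - r * energy m u) * exp (r * u)) (at u within {0..T})"
      if "0 < T" "u \<in> {0..T}" for T u
      by (rule derivative_eq_intros energy_has_derivative[OF m(1) that] refl)+ (simp add: algebra_simps)
    show "(loss m u - r * energy m u) * exp (r * u) \<le> 0" if "0 \<le> u" "u \<le> t" for u
      using loss[of u] that by (simp add: mult_nonpos_nonneg)
  qed (use t in auto)
  moreover have "0 < energy m 0 * exp (r * 0)" using energy_initial_pos[OF m] by simp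
  ultimately have "0 < energy m t * exp (r * t)" by linarith
  then show ?thesis by (simp add: zero_less_mult_iff)
qed

text \<open>The gap is split at its midpoint: the lower half pays for Chebyshev, which bounds the
  set above \<open>k\<close> by the energy at level \<open>l\<close>, and the upper half is the gap
  in the dissipation estimate. It supplies one power of m - l with the factor 1/2; Chebyshev
  supplies 4^(-b) and (m - l)^(2 b), where b = 2 \<alpha>/n.\<close>

lemma loss_ge:
  assumes "0 < l" "l < m" "0 \<le> t" "0 < energy l t"
  shows "(4 * pi) powr \<alpha> * 2 powr (- (2 * \<alpha> / real CARD('n))) / (2 * \<alpha> * subordination_const \<alpha>)
      * (1 / 2) * 4 powr (- (2 * \<alpha> / real CARD('n))) * (m - l) powr (1 + 2 * (2 * \<alpha> / real CARD('n)))
      * energy l t powr (- (2 * \<alpha> / real CARD('n))) * energy m t \<le> loss m t"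
proof -
  interpret fourier_profile "\<theta> t" "fourier_L2 (\<theta> t)" \<beta> by (rule profile[OF assms(3)])
  let ?b = "2 * \<alpha> / real CARD('n)"
  let ?K = "(4 * pi) powr \<alpha> * 2 powr (- ?b) / (2 * \<alpha> * subordination_const \<alpha>)"
  define k where "k = (l + m) / 2"
  have k: "0 < l" "l < k" "k < m" "k - l = (m - l) / 2" "m - k = (m - l) / 2"
    using assms by (auto simp: k_def field_simps)
  define a where "a = energy l t / ((m - l) / 2)\<^sup>2"
  have a: "0 < a" using assms by (simp add: a_def)
  have "measure lborel {x. k < \<theta> t x} \<le> a"
    using measure_superlevel_le[OF k(1,2)] unfolding a_def energy_def k(4) .
  from dissipation_ge[OF \<alpha> refl _ k(3) a this]
  have "?K * ((m - l) / 2) * a powr (- ?b) * energy m t \<le> loss m t"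
    using k by (simp add: loss_def energy_def k(5))
  moreover have "a powr (- ?b) = 4 powr (- ?b) * (m - l) powr (2 * ?b) * energy l t powr (- ?b)"
  proof -
    have "a = energy l t * 4 * (m - l) powr (- 2)"
      using assms by (simp add: a_def power_divide powr_minus_divide field_simps)
    then have "a powr (- ?b) = energy l t powr (- ?b) * 4 powr (- ?b) * ((m - l) powr (- 2)) powr (- ?b)"
      by (simp only: powr_mult)
    also have "((m - l) powr (- 2)) powr (- ?b) = (m - l) powr (2 * ?b)" by (simp add: powr_powr)
    finally show ?thesis by (simp only: mult_ac)
  qed
  moreover have "(m - l) powr (1 + 2 * ?b) = (m - l) * (m - l) powr (2 * ?b)"
    using assms by (simp add: powr_add)
  ultimately show ?thesis by (simp only: mult_ac times_divide_eq_right times_divide_eq_left mult_1_right)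
qed

end

theorem theorem1p1:
  fixes \<alpha> :: real and \<theta>0 :: "real^'n \<Rightarrow> real"
  assumes "CARD('n) \<ge> 2"
    and "0 < \<alpha>" and "\<alpha> < 1"
    and "schwartz \<theta>0"
    and "(SUP x. \<theta>0 x) > 0"
  shows "\<not> (\<exists>\<theta> :: real \<Rightarrow> real^'n \<Rightarrow> real. smooth_global_solution \<alpha> \<theta>0 \<theta>)"
proof
  assume "\<exists>\<theta> :: real \<Rightarrow> real^'n \<Rightarrow> real. smooth_global_solution \<alpha> \<theta>0 \<theta>"
  then obtain \<theta> :: "real \<Rightarrow> real^'n \<Rightarrow> real" where "smooth_global_solution \<alpha> \<theta>0 \<theta>" ..
  then interpret active_scalar \<alpha> \<theta>0 \<theta> by unfold_locales (use assms in auto)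
  obtain x0 where x0: "\<theta>0 x0 > 0"
  proof (rule ccontr)
    assume "\<not> thesis"
    then have "\<And>x. \<theta>0 x \<le> 0" using that by (meson not_le)
    then have "(SUP x. \<theta>0 x) \<le> 0" by (intro cSUP_least) auto
    then show False using assms(5) by simp
  qed
  \<comment> \<open>Half of a positive value of \<theta>0: strictly below that value, so the
    energies at all levels up to \<open>M\<close> stay positive.\<close>
  define M where "M = \<theta>0 x0 / 2"
  have M: "0 < M" "M < \<theta>0 x0" using x0 by (auto simp: M_def)
  let ?b = "2 * \<alpha> / real CARD('n)"
  let ?k = "(4 * pi) powr \<alpha> * 2 powr (- ?b) / (2 * \<alpha> * subordination_const \<alpha>) * (1 / 2) * 4 powr (- ?b)"
  show False
  proof (rule level_cascade_contradiction[of ?k "1 + 2 * ?b" ?b M energy loss])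
    show "0 < ?k" using subordination_const_pos[OF \<alpha>] \<alpha> by simp
    show "0 < 1 + 2 * ?b" "0 < ?b" using \<alpha> by (auto intro: add_pos_nonneg)
    show "0 < M" by (rule M)
    show "(energy m has_real_derivative - loss m t) (at t within {0..T})"
      if "0 < m" "0 < T" "t \<in> {0..T}" for m T t
      by (rule energy_has_derivative[OF that])
    show pos: "0 < energy m t" if "0 < m" "m \<le> M" "0 \<le> t" for m t
      by (rule energy_pos[of m x0]) (use that M in auto)
    show "?k * (m - l) powr (1 + 2 * ?b) * energy l t powr (- ?b) * energy m t \<le> loss m t"
      if "0 < l" "l < m" "m \<le> M" "0 \<le> t" for l m t
      by (rule loss_ge) (use that pos in auto)
    show "energy m t \<le> energy l t" if "0 < l" "l \<le> m" "0 \<le> t" for l m t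
      by (rule energy_mono[OF that])
  qed
qed

end
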